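(* Let $f_{\text{2-opt}}$ be the function that maps a complete graph with (rational) edge weights to the number of 2-optimal tours in it. There is an algorithm that, given a simple graph $G=(V,E)$, computes the number of path covers of $G$ of size $\ell$ for every $1 \le \ell \le |V|$, running in time polynomial in $|V|+|E|$ when given oracle access to $f_{\text{2-opt}}$, and using $|V|$ calls to $f_{\text{2-opt}}$.
   Context: A tour in a graph is a Hamiltonian cycle; its weight is the sum of the weights of its edges. A 2-change on a tour $T$ removes two non-adjacent edges of $T$ and adds the unique pair of edges not in $T$ that reconnects the two resulting paths into a new tour. A tour $T$ is 2-optimal if no 2-change on $T$ yields a tour of strictly smaller weight. A path cover of a simple graph $G$ is a collection of vertex-disjoint paths (single vertices allowed as paths) such that every vertex of $G$ lies on exactly one path; its size is the number of paths. *)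

theory Defs
  imports Complex_Main "HOL-Library.Log_Nat" "HOL-Computational_Algebra.Polynomial"
begin

text \<open>Undirected edges are two-element sets of vertices. A tour is represented by its edge set,
  so that rotating or reversing the cyclic vertex order does not produce a different tour.\<close>

definition cycle_edges :: "'a list \<Rightarrow> 'a set set" where
  "cycle_edges xs = {{xs ! i, xs ! (Suc i mod length xs)} | i. i < length xs}"

definition tour :: "'a set \<Rightarrow> 'a set set \<Rightarrow> bool" where
  "tour V T \<longleftrightarrow>
     (\<exists>xs. distinct xs \<and> set xs = V \<and> length xs \<ge> 3 \<and> T = cycle_edges xs)"

text \<open>If two disjoint edges are removed from a tour, exactly one pair of edges outside the tour
  reconnects the remaining two paths into a tour; this is the pair \<open>g, h\<close> below.\<close>

definition two_change :: "'a set \<Rightarrow> 'a set set \<Rightarrow> 'a set set \<Rightarrow> bool" where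
  "two_change V T T' \<longleftrightarrow> tour V T \<and> tour V T' \<and>
     (\<exists>e f g h. e \<in> T \<and> f \<in> T \<and> e \<inter> f = {} \<and> g \<notin> T \<and> h \<notin> T \<and> g \<noteq> h \<and>
        T' = (T - {e, f}) \<union> {g, h})"

definition tour_weight :: "('a set \<Rightarrow> rat) \<Rightarrow> 'a set set \<Rightarrow> rat" where
  "tour_weight w T = (\<Sum>e\<in>T. w e)"

definition two_optimal :: "'a set \<Rightarrow> ('a set \<Rightarrow> rat) \<Rightarrow> 'a set set \<Rightarrow> bool" where
  "two_optimal V w T \<longleftrightarrow>
     tour V T \<and> \<not> (\<exists>T'. two_change V T T' \<and> tour_weight w T' < tour_weight w T)"

definition f_two_opt :: "'a set \<Rightarrow> ('a set \<Rightarrow> rat) \<Rightarrow> nat" where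
  "f_two_opt V w = card {T. two_optimal V w T}"

definition simple_graph :: "'a set \<Rightarrow> 'a set set \<Rightarrow> bool" where
  "simple_graph V E \<longleftrightarrow> finite V \<and> (\<forall>e\<in>E. e \<subseteq> V \<and> card e = 2)"

definition path_edges :: "'a list \<Rightarrow> 'a set set" where
  "path_edges xs = {{xs ! i, xs ! Suc i} | i. Suc i < length xs}"

text \<open>A path is a subgraph, given by its vertex set and its edge set; in particular it carries
  no direction.\<close>

definition is_path :: "'a set \<Rightarrow> 'a set set \<Rightarrow> 'a set \<times> 'a set set \<Rightarrow> bool" where
  "is_path V E P \<longleftrightarrow>
     (\<exists>xs. xs \<noteq> [] \<and> distinct xs \<and> set xs \<subseteq> V \<and> path_edges xs \<subseteq> E \<and>
        P = (set xs, path_edges xs))"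

definition path_cover :: "'a set \<Rightarrow> 'a set set \<Rightarrow> ('a set \<times> 'a set set) set \<Rightarrow> bool" where
  "path_cover V E C \<longleftrightarrow>
     (\<forall>P\<in>C. is_path V E P) \<and>
     (\<forall>P\<in>C. \<forall>Q\<in>C. P \<noteq> Q \<longrightarrow> fst P \<inter> fst Q = {}) \<and>
     (\<forall>v\<in>V. \<exists>!P. P \<in> C \<and> v \<in> fst P)"

definition num_path_covers :: "'a set \<Rightarrow> 'a set set \<Rightarrow> nat \<Rightarrow> nat" where
  "num_path_covers V E l = card {C. path_cover V E C \<and> card C = l}"

text \<open>The machine model is a structured version of the random access machine with logarithmic
  cost, which is polynomially equivalent to the multitape Turing machine. A program uses
  finitely many arrays, named by the numerals in its text. Every array is indexed by integers and
  has integer entries of unbounded size; a scalar variable is the entry of an array at index 0.\<close>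

type_synonym mem = "nat \<Rightarrow> int \<Rightarrow> int"

datatype bop = Add | Sub | Mul | Div | Mod | Less | Eq

datatype expr = Const int | Cell nat expr | Bin bop expr expr

datatype com =
    Skip
  | Assign nat expr expr  \<comment> \<open>\<open>Assign a i e\<close> is \<open>a[i] := e\<close>\<close>
  | Seq com com
  | Cond expr com com     \<comment> \<open>nonzero means true\<close>
  | While expr com
  | Query nat nat expr    \<comment> \<open>\<open>Query b a e\<close> is \<open>b[0] := oracle (a[0], \<dots>, a[e - 1])\<close>\<close>

fun bop_val :: "bop \<Rightarrow> int \<Rightarrow> int \<Rightarrow> int" where
  "bop_val Add x y = x + y"
| "bop_val Sub x y = x - y"
| "bop_val Mul x y = x * y"
| "bop_val Div x y = x div y"
| "bop_val Mod x y = x mod y"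
| "bop_val Less x y = (if x < y then 1 else 0)"
| "bop_val Eq x y = (if x = y then 1 else 0)"

fun val :: "expr \<Rightarrow> mem \<Rightarrow> int" where
  "val (Const k) s = k"
| "val (Cell a i) s = s a (val i s)"
| "val (Bin f d e) s = bop_val f (val d s) (val e s)"

text \<open>The cost of an integer is one plus its binary length. An expression is charged for the value
  of each of its nodes, hence for all operands, results and addresses that occur.\<close>

definition int_cost :: "int \<Rightarrow> nat" where
  "int_cost x = 1 + floorlog 2 (nat \<bar>x\<bar>)"

fun expr_cost :: "expr \<Rightarrow> mem \<Rightarrow> nat" where
  "expr_cost (Const k) s = int_cost k"
| "expr_cost (Cell a i) s = expr_cost i s + int_cost (val (Cell a i) s)"
| "expr_cost (Bin f d e) s = expr_cost d s + expr_cost e s + int_cost (val (Bin f d e) s)"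

definition query_word :: "nat \<Rightarrow> expr \<Rightarrow> mem \<Rightarrow> int list" where
  "query_word a e s = map (\<lambda>i. s a (int i)) [0..<nat (val e s)]"

text \<open>\<open>exec orc c s t q s'\<close>: with oracle \<open>orc\<close>, the program \<open>c\<close> started in memory \<open>s\<close> terminates in
  memory \<open>s'\<close> after time \<open>t\<close> with exactly \<open>q\<close> oracle calls. The oracle is a partial function;
  a call outside its domain blocks. A call is charged for the length of the question and of the
  answer.\<close>

inductive exec :: "(int list \<Rightarrow> int option) \<Rightarrow> com \<Rightarrow> mem \<Rightarrow> nat \<Rightarrow> nat \<Rightarrow> mem \<Rightarrow> bool"
  for orc where
  Skip: "exec orc Skip s 1 0 s"
| Assign: "exec orc (Assign a i e) s (1 + expr_cost i s + expr_cost e s) 0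
     (s(a := (s a)(val i s := val e s)))"
| Seq: "exec orc c s t q s' \<Longrightarrow> exec orc d s' u r s'' \<Longrightarrow>
     exec orc (Seq c d) s (1 + t + u) (q + r) s''"
| CondTrue: "val e s \<noteq> 0 \<Longrightarrow> exec orc c s t q s' \<Longrightarrow>
     exec orc (Cond e c d) s (1 + expr_cost e s + t) q s'"
| CondFalse: "val e s = 0 \<Longrightarrow> exec orc d s t q s' \<Longrightarrow>
     exec orc (Cond e c d) s (1 + expr_cost e s + t) q s'"
| WhileFalse: "val e s = 0 \<Longrightarrow> exec orc (While e c) s (1 + expr_cost e s) 0 s"
| WhileTrue: "val e s \<noteq> 0 \<Longrightarrow> exec orc c s t q s' \<Longrightarrow> exec orc (While e c) s' u r s'' \<Longrightarrow>
     exec orc (While e c) s (1 + expr_cost e s + t + u) (q + r) s''"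
| Query: "orc (query_word a e s) = Some y \<Longrightarrow>
     exec orc (Query b a e) s
       (1 + expr_cost e s + (\<Sum>x\<leftarrow>query_word a e s. int_cost x) + int_cost y) 1
       (s(b := (s b)(0 := y)))"

inductive_cases Skip_elim: "exec orc Skip s t q s'"
inductive_cases Assign_elim: "exec orc (Assign a i e) s t q s'"
inductive_cases Seq_elim: "exec orc (Seq c d) s t q s'"
inductive_cases Cond_elim: "exec orc (Cond e c d) s t q s'"
inductive_cases While_elim: "exec orc (While e c) s t q s'"
inductive_cases Query_elim: "exec orc (Query b a e) s t q s'"

lemma exec_deterministic:
  "exec orc c s t q s' \<Longrightarrow> exec orc c s u r s'' \<Longrightarrow> t = u \<and> q = r \<and> s' = s''"
proof (induction arbitrary: u r s'' rule: exec.induct)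
  case (Skip s)
  then show ?case by (elim Skip_elim) simp
next
  case (Assign a i e s)
  then show ?case by (elim Assign_elim) simp
next
  case (Seq c s t q s' d u' r' s2)
  show ?case
    by (rule Seq_elim[OF Seq.prems]) (fastforce dest: Seq.IH)
next
  case (CondTrue e s c t q s' d)
  show ?case
    by (rule Cond_elim[OF CondTrue.prems]) (use CondTrue.hyps(1) in \<open>fastforce dest: CondTrue.IH\<close>)+
next
  case (CondFalse e s d t q s' c)
  show ?case
    by (rule Cond_elim[OF CondFalse.prems]) (use CondFalse.hyps(1) in \<open>fastforce dest: CondFalse.IH\<close>)+
next
  case (WhileFalse e s c)
  show ?case
    by (rule While_elim[OF WhileFalse.prems]) (use WhileFalse.hyps in simp_all)
next
  case (WhileTrue e s c t q s' u' r' s2)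
  show ?case
    by (rule While_elim[OF WhileTrue.prems]) (use WhileTrue.hyps(1) in \<open>fastforce dest: WhileTrue.IH\<close>)+
next
  case (Query a e s y b)
  show ?case
    by (rule Query_elim[OF Query.prems]) (use Query.hyps in simp)
qed

text \<open>A complete graph on \<open>{0..<n}\<close> with rational edge weights is given to the oracle as a list of
  length \<open>1 + 2 * n * n\<close>: first \<open>n\<close>, then, row by row, a numerator and a positive denominator
  for each pair \<open>(i, j)\<close>. The weight of an edge \<open>{i, j}\<close> with \<open>i < j\<close> is the fraction at \<open>(i, j)\<close>;
  the entries at \<open>(i, j)\<close> with \<open>i \<ge> j\<close> are ignored. Fractions need not be reduced.\<close>

definition inst_size :: "int list \<Rightarrow> nat" where
  "inst_size xs = nat (xs ! 0)"

definition inst_num :: "int list \<Rightarrow> nat \<Rightarrow> nat \<Rightarrow> int" where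
  "inst_num xs i j = xs ! (1 + 2 * (i * inst_size xs + j))"

definition inst_den :: "int list \<Rightarrow> nat \<Rightarrow> nat \<Rightarrow> int" where
  "inst_den xs i j = xs ! (2 + 2 * (i * inst_size xs + j))"

definition valid_inst :: "int list \<Rightarrow> bool" where
  "valid_inst xs \<longleftrightarrow> xs \<noteq> [] \<and> xs ! 0 \<ge> 0 \<and>
     length xs = 1 + 2 * inst_size xs * inst_size xs \<and>
     (\<forall>i j. i < j \<and> j < inst_size xs \<longrightarrow> inst_den xs i j > 0)"

definition inst_weight :: "int list \<Rightarrow> nat set \<Rightarrow> rat" where
  "inst_weight xs e = Fract (inst_num xs (Min e) (Max e)) (inst_den xs (Min e) (Max e))"

definition two_opt_oracle :: "int list \<Rightarrow> int option" where
  "two_opt_oracle xs =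
     (if valid_inst xs then Some (int (f_two_opt {0..<inst_size xs} (inst_weight xs))) else None)"

text \<open>A simple graph on \<open>{0..<n}\<close> is given to a program in array 0, as \<open>n\<close> followed by the
  adjacency matrix, row by row. All other entries of the memory are initially 0.\<close>

definition graph_input :: "nat \<Rightarrow> nat set set \<Rightarrow> mem" where
  "graph_input n E a k =
     (if a = 0 \<and> k = 0 then int n
      else if a = 0 \<and> (\<exists>i<n. \<exists>j<n. {i, j} \<in> E \<and> k = int (1 + i * n + j)) then 1
      else 0)"

end

theory Submission
  imports Defs
begin

text \<open>Given \<open>G\<close> on \<open>n\<close> vertices and \<open>k \<ge> n\<close>, take \<open>k\<close> hubs and four vertices \<open>4v, \<dots>, 4v + 3\<close> for every
  vertex \<open>v\<close> of \<open>G\<close>. Edges at hubs have weight 0, edges between odd vertices of two gadgets that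
  belong to adjacent vertices of \<open>G\<close> have weight 0, all other edges between gadgets have weight 1.
  Negative weights inside a gadget make every 2-optimal tour traverse it in one of four ways, two of
  which have even ends (only usable by a path with a single vertex) and two of which have odd ends.
  An edge of weight 1 can be exchanged together with an edge between two hubs, and such an edge
  exists because \<open>k \<ge> n\<close>. Hence the 2-optimal tours are those of weight \<open>- 24 n\<close>, and they arise from a path
  cover by inserting its paths into different gaps of a cyclic order of the hubs. A path with \<open>m\<close>
  vertices can be inserted in \<open>2 ^ (m + 1)\<close> ways, for \<open>m = 1\<close> as well as for \<open>m \<ge> 2\<close>, so that a cover
  with \<open>l\<close> paths contributes \<open>(k - 1)! l! (k choose l) 2 ^ (n + l) / 2\<close> tours.

  Up to known factors the answers for \<open>k = n, \<dots>, 2n - 1\<close> are the values at \<open>n - 1, \<dots>, 2n - 2\<close> of a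
  polynomial of degree less than \<open>n\<close> whose coefficients in the basis \<open>x choose j\<close> are multiples of the
  numbers of path covers. The program forms the differences of these values, extrapolates them down to 0,
  and reads off the coefficients.\<close>

section \<open>Cyclic lists and 2-changes\<close>

text \<open>The obstacle is that 2-optimality is a local property: tours without any global merit
  must be excluded, not only non-optimal ones. A 2-change that is aimed at one favourable new edge
  has no control over the second new edge, about which only \<open>gweight <= 1\<close> is known.
  The weights -10, -4, -2 inside a gadget are spaced so that the gain survives this unknown term.
  Once the 2-optimal tours are in normal form they all have the same weight, and comparison with a
  tour of minimum weight shows that every tour in normal form is 2-optimal. One oracle answer is a
  single linear combination of the numbers of covers. Adding hubs leaves the gadgets alone and
  changes only the number of gaps, so the number of hubs is a parameter that yields \<open>n\<close>
  independent equations. With fewer than \<open>n\<close> hubs an edge between two hubs may be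
  missing, which is why the polynomial is sampled from \<open>n - 1\<close> on and has to be
  continued downwards. In this basis the coefficients are nonnegative, so all table entries are
  bounded by oracle answers and no growth of numbers has to be analysed separately.\<close>

definition nxt :: "'a list \<Rightarrow> 'a \<Rightarrow> 'a" where
  "nxt zs x = zs ! (Suc (THE i. i < length zs \<and> zs ! i = x) mod length zs)"

lemma nxt_nth:
  assumes "distinct zs" "i < length zs"
  shows "nxt zs (zs ! i) = zs ! (Suc i mod length zs)"
proof -
  have "(THE j. j < length zs \<and> zs ! j = zs ! i) = i"
    using assms by (intro the_equality) (auto simp: nth_eq_iff_index_eq)
  then show ?thesis by (simp add: nxt_def)
qed

lemma nxt_append:
  assumes "distinct (xs @ a # b # ys)"
  shows "nxt (xs @ a # b # ys) a = b"
  using nxt_nth[OF assms, of "length xs"] by (simp add: nth_append)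

lemma Suc_mod_inj:
  assumes "i < m" "j < m" "Suc i mod m = Suc j mod m"
  shows "i = j"
  using assms by (auto simp: mod_Suc split: if_splits)

lemma nxt_inj:
  assumes "distinct zs" "x \<in> set zs" "y \<in> set zs" "nxt zs x = nxt zs y"
  shows "x = y"
proof -
  obtain i j where ij: "i < length zs" "j < length zs" "x = zs ! i" "y = zs ! j"
    using assms by (auto simp: in_set_conv_nth)
  then have "Suc i mod length zs = Suc j mod length zs"
    using assms by (simp add: nxt_nth)
      (metis mod_less_divisor nth_eq_iff_index_eq ij(1) less_nat_zero_code neq0_conv)
  then show ?thesis using ij Suc_mod_inj by blast
qed

lemma nxt_in_set:
  assumes "distinct zs" "x \<in> set zs"
  shows "nxt zs x \<in> set zs"
proof -
  obtain i where "i < length zs" "x = zs ! i" using assms by (auto simp: in_set_conv_nth)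
  then show ?thesis using assms by (simp add: nxt_nth)
      (metis mod_less_divisor nth_mem less_nat_zero_code neq0_conv)
qed

text \<open>Iterating the successor from one position reaches every position. This is the form in
  which subtours are excluded below.\<close>

lemma nxt_closed:
  assumes "distinct zs" "S \<subseteq> set zs" "S \<noteq> {}" "\<And>x. x \<in> S \<Longrightarrow> nxt zs x \<in> S"
  shows "S = set zs"
proof -
  obtain i where i: "i < length zs" "zs ! i \<in> S"
    using assms by (metis all_not_in_conv in_set_conv_nth subsetD)
  have step: "zs ! ((i + m) mod length zs) \<in> S" for m
  proof (induction m)
    case (Suc m)
    have "nxt zs (zs ! ((i + m) mod length zs)) = zs ! (Suc ((i + m) mod length zs) mod length zs)"
      using i assms(1) by (intro nxt_nth) (auto intro!: mod_less_divisor)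
    with Suc assms(4) show ?case by (metis add_Suc_right mod_Suc_eq)
  qed (use i in simp)
  have "zs ! j \<in> S" if "j < length zs" for j
  proof -
    \<comment> \<open>Walking from \<open>i\<close> past the end of the list and on to
      \<open>j\<close> avoids a case distinction on the order of \<open>i\<close> and
      \<open>j\<close>.\<close>
    have "(i + (length zs - i + j)) mod length zs = j" using i that by simp
    then show ?thesis using step by metis
  qed
  then show ?thesis using assms(2) by (auto simp: in_set_conv_nth)
qed

lemma cycle_edges_nxt:
  assumes "distinct zs"
  shows "cycle_edges zs = (\<lambda>x. {x, nxt zs x}) ` set zs"
  unfolding cycle_edges_def using assms
  by (auto simp: nxt_nth in_set_conv_nth image_iff) (metis nth_mem nxt_nth)+

lemma nxt_neq:
  assumes "distinct zs" "length zs \<ge> 2" "x \<in> set zs"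
  shows "nxt zs x \<noteq> x"
proof
  assume "nxt zs x = x"
  then have "{x} = set zs" using assms by (intro nxt_closed) auto
  then show False using assms distinct_card[of zs] by (metis Suc_1 card_1_singleton_iff not_less_eq_eq le_refl One_nat_def)
qed

lemma nxt_nxt_neq:
  assumes "distinct zs" "length zs \<ge> 3" "x \<in> set zs"
  shows "nxt zs (nxt zs x) \<noteq> x"
proof
  assume "nxt zs (nxt zs x) = x"
  then have "{x, nxt zs x} = set zs" using assms nxt_in_set by (intro nxt_closed) fastforce+
  then have "card (set zs) \<le> 2" using card_insert_le_m1[of 2 "{nxt zs x}" x] by simp
  then show False using assms distinct_card[of zs] by simp
qed

text \<open>Two vertices with the same outgoing edge would be successors of each other, a cycle of
  length 2. Hence the weight of a tour can be summed over its vertices.\<close>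

lemma nxt_edge_inj:
  assumes "distinct zs" "length zs \<ge> 3"
  shows "inj_on (\<lambda>x. {x, nxt zs x}) (set zs)"
proof (rule inj_onI)
  fix x y assume xy: "x \<in> set zs" "y \<in> set zs" "{x, nxt zs x} = {y, nxt zs y}"
  show "x = y"
  proof (rule ccontr)
    assume "x \<noteq> y"
    then have "nxt zs x = y" "nxt zs y = x" using xy(3) by (auto simp: doubleton_eq_iff)
    then show False using nxt_nxt_neq[OF assms xy(1)] by simp
  qed
qed

lemma tour_weight_cycle:
  assumes "distinct zs" "length zs \<ge> 3"
  shows "tour_weight w (cycle_edges zs) = (\<Sum>x\<in>set zs. w {x, nxt zs x})"
  unfolding tour_weight_def cycle_edges_nxt[OF assms(1)]
  using nxt_edge_inj[OF assms] by (simp add: sum.reindex o_def)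

section \<open>Edge sets of lists: splitting, reversal, rotation\<close>

lemma path_edges_Nil [simp]: "path_edges [] = {}"
  and path_edges_single [simp]: "path_edges [x] = {}"
  by (auto simp: path_edges_def)

lemma path_edges_Cons [simp]: "path_edges (x # y # ys) = insert {x, y} (path_edges (y # ys))"
proof -
  have "(\<exists>i. e = {(x # y # ys) ! i, (x # y # ys) ! Suc i} \<and> Suc i < length (x # y # ys)) \<longleftrightarrow>
     e = {x, y} \<or> (\<exists>i. e = {(y # ys) ! i, (y # ys) ! Suc i} \<and> Suc i < length (y # ys))" (is "?L \<longleftrightarrow> ?R") for e
  proof
    assume ?L
    then obtain i where i: "e = {(x # y # ys) ! i, (x # y # ys) ! Suc i}" "Suc i < length (x # y # ys)" by blast
    then show ?R by (cases i) auto
  next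
    assume ?R
    then show ?L
    proof
      assume "e = {x, y}"
      then show ?L by (intro exI[of _ 0]) simp
    next
      assume "\<exists>i. e = {(y # ys) ! i, (y # ys) ! Suc i} \<and> Suc i < length (y # ys)"
      then obtain i where "e = {(y # ys) ! i, (y # ys) ! Suc i} \<and> Suc i < length (y # ys)" by blast
      then show ?L by (intro exI[of _ "Suc i"]) simp
    qed
  qed
  then show ?thesis unfolding path_edges_def by (intro set_eqI, unfold insert_iff mem_Collect_eq)
qed

lemma path_edges_append:
  "path_edges (xs @ y # ys) = path_edges (xs @ [y]) \<union> path_edges (y # ys)"
proof (induction xs)
  case (Cons x xs) then show ?case by (cases xs) auto
qed simp

lemma path_edges_rev [simp]: "path_edges (rev xs) = path_edges xs"
proof (induction xs)
  case (Cons x xs)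
  then show ?case
  proof (cases xs)
    case (Cons y ys)
    have "path_edges (rev (x # xs)) = path_edges (rev ys @ y # [x])" using Cons by simp
    also have "\<dots> = path_edges (rev xs) \<union> {{y, x}}"
      using Cons by (subst path_edges_append) simp
    also have "\<dots> = path_edges (x # xs)" using Cons Cons.IH by (auto simp: insert_commute)
    finally show ?thesis .
  qed simp
qed simp

lemma path_edges_subset: "e \<in> path_edges xs \<Longrightarrow> e \<subseteq> set xs"
  by (auto simp: path_edges_def)

lemma cycle_edges_path:
  "cycle_edges (x # xs) = path_edges (x # xs @ [x])"
proof -
  have "(x # xs) ! (Suc i mod length (x # xs)) = (x # xs @ [x]) ! Suc i"
    if "i < length (x # xs)" for i
  proof (cases "Suc i < length (x # xs)")
    case True then show ?thesis by (auto simp: nth_append)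
  next
    case False then have "i = length xs" using that by simp
    then show ?thesis by (simp add: nth_append)
  qed
  moreover have "(x # xs) ! i = (x # xs @ [x]) ! i" if "i < length (x # xs)" for i
    using that by (cases i) (auto simp: nth_append)
  ultimately show ?thesis unfolding cycle_edges_def path_edges_def
    by (intro Collect_cong ex_cong1) auto
qed

lemma cycle_edges_rotate: "cycle_edges (xs @ ys) = cycle_edges (ys @ xs)"
proof (cases "xs = [] \<or> ys = []")
  case False
  then obtain x xs' y ys' where "xs = x # xs'" "ys = y # ys'" by (auto simp: neq_Nil_conv)
  then show ?thesis
    using path_edges_append[of "x # xs'" y "ys' @ [x]"] path_edges_append[of "y # ys'" x "xs' @ [y]"]
    by (simp add: cycle_edges_path Un_commute)
qed auto

lemma cycle_edges_rev: "cycle_edges (x # rev xs) = cycle_edges (x # xs)"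
  using path_edges_rev[of "x # xs @ [x]"] by (simp add: cycle_edges_path)

text \<open>In an oriented tour, joining \<open>a\<close> to \<open>c\<close> and their successors
  to each other amounts to reversing the segment from \<open>nxt zs a\<close> to \<open>c\<close>.
  If the two removed edges share a vertex, both sides are equal, so users of the inequality need no
  disjointness condition.\<close>

lemma two_opt_exchange:
  assumes opt: "two_optimal V w (cycle_edges zs)" and zs: "distinct zs" "set zs = V" "length zs \<ge> 3"
    and ac: "a \<in> V" "c \<in> V" "a \<noteq> c"
  shows "w {a, nxt zs a} + w {c, nxt zs c} \<le> w {a, c} + w {nxt zs a, nxt zs c}"
proof -
  let ?s = "nxt zs"
  have main: "w {a, ?s a} + w {c, ?s c} \<le> w {a, c} + w {?s a, ?s c}"
    if ij: "i < j" "j < length zs" "a = zs ! i" "c = zs ! j" for a c i j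
  proof (cases "?s a = c \<or> ?s c = a")
    case True
    then show ?thesis by (auto simp: insert_commute)
  next
    case False
    have aV: "a \<in> set zs" "c \<in> set zs" using ij by auto
    have ne: "a \<noteq> c" using ij zs by (simp add: nth_eq_iff_index_eq)
    define A where "A = take i zs"
    define b where "b = ?s a"
    define d where "d = ?s c"
    have Suci: "Suc i < length zs" using ij by simp
    have b: "b = zs ! Suc i" unfolding b_def using ij zs Suci by (simp add: nxt_nth)
    have "Suc i \<noteq> j" using False b b_def ij by auto
    then have Sij: "Suc i < j" using ij by simp
    define B where "B = take (j - Suc (Suc i)) (drop (Suc (Suc i)) zs)"
    define C where "C = drop (Suc j) zs"
    have zs_eq: "zs = A @ a # b # B @ c # C"
    proof -
      have 1: "zs = A @ a # drop (Suc i) zs" unfolding A_def ij using ij id_take_nth_drop[of i zs] by simp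
      have 2: "drop (Suc i) zs = b # drop (Suc (Suc i)) zs" using Suci b by (simp add: Cons_nth_drop_Suc)
      have 3: "drop (j - Suc (Suc i)) (drop (Suc (Suc i)) zs) = drop j zs" using Sij by (metis drop_drop le_add_diff_inverse2 Suc_leI)
      have 4: "drop j zs = c # C" using ij C_def by (simp add: Cons_nth_drop_Suc)
      have 5: "drop (Suc (Suc i)) zs = B @ drop j zs" unfolding B_def using 3 append_take_drop_id by metis
      show ?thesis using 1 2 4 5 by simp
    qed
    define zs' where "zs' = A @ a # c # rev B @ b # C"
    have set': "set zs' = V" "distinct zs'" "length zs' = length zs"
      using zs zs_eq unfolding zs'_def by auto
    \<comment> \<open>\<open>e0\<close> is the first vertex of \<open>zs\<close>. Appending it
      closes the cycle, so that cyclic edge sets become edge sets of open lists; if \<open>C\<close>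
      is empty, the successor \<open>d\<close> of \<open>c\<close> is \<open>e0\<close>
      itself.\<close>
    define e0 where "e0 = hd (A @ [a])"
    obtain A' where A': "A @ [a] = e0 # A'" unfolding e0_def by (cases A) auto
    have hdC: "d = hd (C @ [e0])"
    proof (cases C)
      case Nil
      then have "Suc j = length zs" using C_def ij by simp
      then have "d = zs ! 0" using ij zs nxt_nth[of zs j] d_def by simp
      then show ?thesis using zs_eq Nil A' by (cases A) (auto simp: e0_def)
    next
      case (Cons y ys)
      then show ?thesis using nxt_append[of "A @ a # b # B" c y ys] zs_eq zs d_def by simp
    qed
    obtain D where D: "C @ [e0] = d # D" using hdC by (cases "C @ [e0]") auto
    \<comment> \<open>\<open>M\<close> collects the edges that both tours share: the middle segment
      keeps its edges when it is reversed.\<close>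
    define M where "M = path_edges (A @ [a]) \<union> path_edges (b # B @ [c]) \<union> path_edges (d # D)"
    have assoc: "A @ a # xs = e0 # A' @ xs" for xs using A' by (cases A) auto
    have T: "cycle_edges zs = insert {a,b} (insert {c,d} M)"
    proof -
      have "cycle_edges zs = path_edges (e0 # (A' @ b # B @ c # C) @ [e0])"
        using zs_eq cycle_edges_path[of e0 "A' @ b # B @ c # C"] by (simp add: assoc)
      also have "e0 # (A' @ b # B @ c # C) @ [e0] = A @ a # b # B @ c # d # D"
        using D by (simp add: assoc)
      also have "path_edges \<dots> = path_edges (A @ [a]) \<union> path_edges (a # b # B @ c # d # D)"
        by (rule path_edges_append)
      also have "path_edges (a # b # B @ c # d # D) = insert {a,b} (path_edges ((b # B) @ c # d # D))"
        by simp
      also have "path_edges ((b # B) @ c # d # D) = path_edges ((b # B) @ [c]) \<union> path_edges (c # d # D)"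
        by (rule path_edges_append)
      finally show ?thesis unfolding M_def by auto
    qed
    have T': "cycle_edges zs' = insert {a,c} (insert {b,d} M)"
    proof -
      have "cycle_edges zs' = path_edges (e0 # (A' @ c # rev B @ b # C) @ [e0])"
        using zs'_def cycle_edges_path[of e0 "A' @ c # rev B @ b # C"] by (simp add: assoc)
      also have "e0 # (A' @ c # rev B @ b # C) @ [e0] = A @ a # c # rev B @ b # d # D"
        using D by (simp add: assoc)
      also have "path_edges \<dots> = path_edges (A @ [a]) \<union> path_edges (a # c # rev B @ b # d # D)"
        by (rule path_edges_append)
      also have "path_edges (a # c # rev B @ b # d # D) = insert {a,c} (path_edges ((c # rev B) @ b # d # D))"
        by simp
      also have "path_edges ((c # rev B) @ b # d # D) = path_edges ((c # rev B) @ [b]) \<union> path_edges (b # d # D)"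
        by (rule path_edges_append)
      also have "path_edges ((c # rev B) @ [b]) = path_edges (b # B @ [c])"
        using path_edges_rev[of "b # B @ [c]"] by simp
      finally show ?thesis unfolding M_def by auto
    qed
    have bV: "b \<in> set zs" "d \<in> set zs" using aV zs b_def d_def nxt_in_set by metis+
    have edge: "\<exists>x\<in>set zs. e = {x, ?s x}" if "e \<in> cycle_edges zs" for e
      using that zs by (auto simp: cycle_edges_nxt)
    have dist: "a \<noteq> b" "c \<noteq> d" "b \<noteq> d" "b \<noteq> c" "a \<noteq> d"
    proof -
      have "?s a \<noteq> a" "?s c \<noteq> c" using nxt_neq[of zs] aV zs by auto
      moreover have "?s a \<noteq> ?s c" using nxt_inj[of zs a c] aV zs ne by auto
      ultimately show "a \<noteq> b" "c \<noteq> d" "b \<noteq> d" "b \<noteq> c" "a \<noteq> d"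
        using False b_def d_def by auto
    qed
    have g: "{a, c} \<notin> cycle_edges zs"
      using edge[of "{a,c}"] False ne by (auto simp: doubleton_eq_iff)
    have h: "{b, d} \<notin> cycle_edges zs"
    proof
      assume "{b, d} \<in> cycle_edges zs"
      then obtain x where "x \<in> set zs" "{b,d} = {x, ?s x}" using edge by blast
      then have "?s b = d \<or> ?s d = b" by (auto simp: doubleton_eq_iff)
      then have "b = c \<or> d = a" using nxt_inj[of zs] bV aV zs b_def d_def by blast
      then show False using dist by simp
    qed
    have notin: "{a,b} \<notin> M" "{c,d} \<notin> M"
    proof -
      have 0: "set (d # D) \<subseteq> insert e0 (set C)" unfolding D[symmetric] by auto
      have e0: "e0 \<in> set (A @ [a])" using A' by simp
      have all: "distinct (A @ a # b # B @ c # C)" using zs zs_eq by simp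
      have "\<not> {a,b} \<subseteq> set (A @ [a])" "\<not> {a,b} \<subseteq> set (b # B @ [c])"
         "\<not> {c,d} \<subseteq> set (A @ [a])" "\<not> {a,b} \<subseteq> insert e0 (set C)" "\<not> {c,d} \<subseteq> insert e0 (set C)"
        using all e0 by auto
      moreover have "\<not> {c,d} \<subseteq> set (b # B @ [c])"
      proof -
        have "d \<in> insert e0 (set C)" using 0 by auto
        then show ?thesis using all e0 by auto
      qed
      ultimately show "{a,b} \<notin> M" "{c,d} \<notin> M"
        unfolding M_def using path_edges_subset 0 by (metis UnE subset_trans)+
    qed
    have T'T: "cycle_edges zs' = (cycle_edges zs - {{a,b},{c,d}}) \<union> {{a,c},{b,d}}"
      unfolding T' T using notin by auto
    have gh: "{a,c} \<noteq> {b,d}" using dist ne by (auto simp: doubleton_eq_iff)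
    have "two_change V (cycle_edges zs) (cycle_edges zs')"
      unfolding two_change_def tour_def
    proof (intro conjI)
      show "\<exists>xs. distinct xs \<and> set xs = V \<and> 3 \<le> length xs \<and> cycle_edges zs = cycle_edges xs" using zs by blast
      show "\<exists>xs. distinct xs \<and> set xs = V \<and> 3 \<le> length xs \<and> cycle_edges zs' = cycle_edges xs"
        using set' zs by metis
      show "\<exists>e f g h. e \<in> cycle_edges zs \<and> f \<in> cycle_edges zs \<and> e \<inter> f = {} \<and> g \<notin> cycle_edges zs \<and>
       h \<notin> cycle_edges zs \<and> g \<noteq> h \<and> cycle_edges zs' = cycle_edges zs - {e, f} \<union> {g, h}"
      proof (intro exI conjI)
        show "{a,b} \<in> cycle_edges zs" "{c,d} \<in> cycle_edges zs" using T by auto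
        show "{a,b} \<inter> {c,d} = {}" using dist ne by auto
      qed (use g h gh T'T in simp_all)
    qed
    then have le: "tour_weight w (cycle_edges zs) \<le> tour_weight w (cycle_edges zs')"
      using opt unfolding two_optimal_def by force
    have fin: "finite M" unfolding M_def path_edges_def by auto
    have "{a,b} \<noteq> {c,d}" using dist ne by (auto simp: doubleton_eq_iff)
    then have "tour_weight w (cycle_edges zs) = w {a,b} + (w {c,d} + sum w M)"
      unfolding tour_weight_def T using fin notin by simp
    moreover have "tour_weight w (cycle_edges zs') = w {a,c} + (w {b,d} + sum w M)"
      unfolding tour_weight_def T' using fin gh g h T by simp
    ultimately show ?thesis using le b_def d_def by simp
  qed
  obtain i j where ij: "i < length zs" "j < length zs" "a = zs ! i" "c = zs ! j"
    using ac zs by (auto simp: in_set_conv_nth)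
  then have "i \<noteq> j" using ac by auto
  then show ?thesis using main[of i j a c] main[of j i c a] ij
    by (metis add.commute insert_commute linorder_neqE_nat)
qed

section \<open>The gadget instance\<close>

text \<open>In terms of residues mod 4, the edges 01 and 23 weigh -10, the edges 02 and 13 weigh -4,
  and the edges 03 and 12 weigh -2.\<close>

definition gweight :: "nat \<Rightarrow> nat set set \<Rightarrow> nat \<Rightarrow> nat \<Rightarrow> int" where
  "gweight n E i j =
     (if 4 * n \<le> i \<or> 4 * n \<le> j then 0
      else if i div 4 = j div 4 then - 2 * (1 + (int (i mod 4) + int (j mod 4) - 3)^2)
      else if {i div 4, j div 4} \<in> E \<and> odd i \<and> odd j then 0 else 1)"

text \<open>Says that the edge from \<open>x\<close> to what follows is free. The empty list counts
  as linked because the tour is closed at the root, which is a hub.\<close>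

definition link :: "nat \<Rightarrow> nat set set \<Rightarrow> nat \<Rightarrow> nat list \<Rightarrow> bool" where
  "link n E x ys \<longleftrightarrow> ys = [] \<or> 4 * n \<le> x \<or> 4 * n \<le> hd ys \<or>
     ({x div 4, hd ys div 4} \<in> E \<and> odd x \<and> odd (hd ys))"

text \<open>The Hamiltonian paths of a gadget with weights -10, -4, -10. The index \<open>q\<close>
  is the residue of the first vertex, and the last vertex has residue \<open>(q + 2) mod 4\<close>,
  hence the same parity.\<close>

definition block :: "nat \<Rightarrow> nat \<Rightarrow> nat list" where
  "block v q = map (\<lambda>r. 4 * v + r)
     (if q = 0 then [0, 1, 3, 2] else if q = 1 then [1, 0, 2, 3]
      else if q = 2 then [2, 3, 1, 0] else [3, 2, 0, 1])"

text \<open>Normal form of a tour that is cut at a hub. A link is demanded only after a block, since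
  hubs have free edges to everything.\<close>

inductive blocked :: "nat \<Rightarrow> nat set set \<Rightarrow> nat list \<Rightarrow> bool" for n E where
  Nil: "blocked n E []"
| hub: "4 * n \<le> u \<Longrightarrow> blocked n E xs \<Longrightarrow> blocked n E (u # xs)"
| block: "v < n \<Longrightarrow> q < 4 \<Longrightarrow> blocked n E xs \<Longrightarrow> link n E (last (block v q)) xs \<Longrightarrow>
     blocked n E (block v q @ xs)"

lemma gweight_commute: "gweight n E i j = gweight n E j i"
  by (auto simp: gweight_def insert_commute add.commute)

lemma gweight_le_1: "gweight n E i j \<le> 1"
proof -
  have *: "- 2 * (1 + y) \<le> 1" if "0 \<le> y" for y :: int using that by simp
  have "(if A then 0 else if B then z else if C then 0 else 1) \<le> 1" if "z \<le> 1" for A B C and z :: int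
    using that by simp
  then show ?thesis unfolding gweight_def using *[OF zero_le_power2] by blast
qed

lemma gweight_nonneg: "i div 4 \<noteq> j div 4 \<Longrightarrow> 0 \<le> gweight n E i j"
  by (auto simp: gweight_def)

lemma gweight_same: "v < n \<Longrightarrow> q < 4 \<Longrightarrow> r < 4 \<Longrightarrow>
    gweight n E (4 * v + q) (4 * v + r) = - 2 * (1 + (int q + int r - 3)^2)"
  by (auto simp: gweight_def)

lemma block_sets: "set (block v q) = {4 * v, 4 * v + 1, 4 * v + 2, 4 * v + 3}"
  and block_list: "block v q = [block v q ! 0, block v q ! 1, block v q ! 2, block v q ! 3]"
  by (auto simp: block_def)

lemma div4_in: "y div 4 = v \<Longrightarrow> y \<in> {4 * v, 4 * v + 1, 4 * v + 2, 4 * v + (3 :: nat)}"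
  by auto

lemma in_div4: "y \<in> {4 * v, 4 * v + 1, 4 * v + 2, 4 * v + (3 :: nat)} \<Longrightarrow> y div 4 = v"
  by auto

lemma block_div4: "y \<in> set (block v q) \<Longrightarrow> y div 4 = v"
  unfolding block_sets by (rule in_div4)

lemma block_nth_div4:
  assumes "i < 4"
  shows "block v q ! i div 4 = v"
proof -
  have "length (block v q) = 4" by (simp add: block_def)
  then show ?thesis using assms by (intro block_div4[of _ v q] nth_mem) simp
qed

section \<open>Normal form of 2-optimal tours\<close>

locale tsp_instance =
  fixes n k :: nat and E :: "nat set set" and w :: "nat set \<Rightarrow> rat"
  assumes n_pos: "1 \<le> n" and n_le_k: "n \<le> k" and graph: "simple_graph {0..<n} E"
    and w_eq: "\<And>i j. i < 4 * n + k \<Longrightarrow> j < 4 * n + k \<Longrightarrow> i \<noteq> j \<Longrightarrow>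
          w {i, j} = of_int (gweight n E i j)"
begin

abbreviation V where "V \<equiv> {0..<4 * n + k}"

context
  fixes zs assumes opt: "two_optimal V w (cycle_edges zs)"
    and zs: "distinct zs" "set zs = V"
begin

abbreviation s where "s \<equiv> nxt zs"
abbreviation g where "g \<equiv> gweight n E"

lemma len: "length zs = 4 * n + k" "length zs \<ge> 5"
  using zs distinct_card[of zs] n_pos n_le_k by auto

lemma s_lt: "x < 4 * n + k \<Longrightarrow> s x < 4 * n + k"
  using nxt_in_set[of zs x] zs by auto

lemma s_neq: "x < 4 * n + k \<Longrightarrow> s x \<noteq> x"
  using nxt_neq[of zs x] zs len by auto

lemma s_s_neq: "x < 4 * n + k \<Longrightarrow> s (s x) \<noteq> x"
  using nxt_nxt_neq[of zs x] zs len by auto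

lemma s_inj: "x < 4 * n + k \<Longrightarrow> y < 4 * n + k \<Longrightarrow> s x = s y \<Longrightarrow> x = y"
  using nxt_inj[of zs x y] zs by auto

lemma exchange:
  assumes "a < 4 * n + k" "c < 4 * n + k" "a \<noteq> c"
  shows "g a (s a) + g c (s c) \<le> g a c + g (s a) (s c)"
proof -
  have "w {a, s a} + w {c, s c} \<le> w {a, c} + w {s a, s c}"
    using two_opt_exchange[OF opt zs] len assms by auto
  moreover have "s a \<noteq> s c" using s_inj assms by blast
  ultimately have "(of_int (g a (s a) + g c (s c)) :: rat) \<le> of_int (g a c + g (s a) (s c))"
    using assms s_lt s_lt s_neq[THEN not_sym] by (simp add: w_eq)
  then show ?thesis by (simp only: of_int_le_iff)
qed

lemma gweight_out:
  assumes "v < n" "q < 4" "x div 4 \<noteq> v"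
  shows "0 \<le> g (4 * v + q) x"
  using assms by (intro gweight_nonneg) auto

text \<open>Otherwise neither of the two vertices leaves by its edge of weight -10, so their
  outgoing edges weigh at least -8 together. Exchanging these edges gains the edge of weight -10 and
  another one of weight at most 1, in total at most -9.\<close>

lemma mates:
  assumes "v < n" "q = 0 \<or> q = 2"
  shows "s (4 * v + q) = 4 * v + Suc q \<or> s (4 * v + Suc q) = 4 * v + q"
proof (rule ccontr)
  assume no: "\<not> ?thesis"
  have q: "q < 4" "Suc q < 4" using assms by auto
  have ge: "g (4 * v + r) (s (4 * v + r)) \<ge> -4" if r: "r = q \<or> r = Suc q" for r
  proof (cases "s (4 * v + r) div 4 = v")
    case True
    define t where "t = s (4 * v + r) mod 4"
    have t: "s (4 * v + r) = 4 * v + t" "t < 4" using True t_def by presburger+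
    have "t \<noteq> r" using s_neq[of "4 * v + r"] r q assms t by auto
    moreover have "\<not> (r = q \<and> t = Suc q \<or> r = Suc q \<and> t = q)" using no t by auto
    moreover have "t = 0 \<or> t = 1 \<or> t = 2 \<or> t = 3" using t by auto
    ultimately have "(int r + int t - 3)^2 \<le> 1" using r assms(2) by (elim disjE) simp_all
    moreover have "g (4 * v + r) (4 * v + t) = - 2 * (1 + (int r + int t - 3)^2)"
      using gweight_same[of v n r t E] assms(1) t(2) r q by linarith
    moreover have "-4 \<le> - 2 * (1 + y)" if "y \<le> 1" for y :: int using that by simp
    ultimately show ?thesis unfolding t(1) by metis
  next
    case False
    have "r < 4" using q r by auto
    then show ?thesis using gweight_out[of v r "s (4 * v + r)"] assms(1) False by linarith
  qed
  have "g (4 * v + q) (s (4 * v + q)) + g (4 * v + Suc q) (s (4 * v + Suc q))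
     \<le> g (4 * v + q) (4 * v + Suc q) + g (s (4 * v + q)) (s (4 * v + Suc q))"
    using assms q by (intro exchange) auto
  moreover have "g (4 * v + q) (4 * v + Suc q) = -10"
    using gweight_same[of v n q "Suc q"] assms q by auto
  ultimately show False using ge[of q] ge[of "Suc q"] gweight_le_1[of n E "s (4 * v + q)" "s (4 * v + Suc q)"] by linarith
qed

text \<open>A gadget closed under successors would be a subtour on four vertices, but there is at
  least one hub as well.\<close>

lemma no_4cycle:
  assumes "v < n" "s ` {4 * v, 4 * v + 1, 4 * v + 2, 4 * v + 3} \<subseteq> {4 * v, 4 * v + 1, 4 * v + 2, 4 * v + 3}"
  shows False
proof -
  have "{4 * v, 4 * v + 1, 4 * v + 2, 4 * v + 3} = set zs"
    using assms zs by (intro nxt_closed) auto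
  then have "card (set zs) \<le> 4"
    using card_length[of "[4 * v, 4 * v + 1, 4 * v + 2, 4 * v + 3]"] by simp
  then show False using len zs distinct_card[of zs] by simp
qed

definition follows where
  "follows v q \<longleftrightarrow> s (block v q ! 0) = block v q ! 1 \<and>
     s (block v q ! 1) = block v q ! 2 \<and> s (block v q ! 2) = block v q ! 3"

lemma exit_nonneg:
  assumes "x div 4 = v" "s x \<notin> {4 * v, 4 * v + 1, 4 * v + 2, 4 * v + 3}"
  shows "0 \<le> g x (s x)"
proof -
  have "s x div 4 \<noteq> v" using assms(2) by auto
  then show ?thesis using assms(1) by (intro gweight_nonneg) auto
qed

text \<open>By \<open>mates\<close> both edges of weight -10 are in the tour. They can be directed
  in four ways; two are impossible, and the other two force an edge of weight -4 between
  them.\<close>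

lemma block_exists:
  assumes v: "v < n"
  shows "\<exists>q<4. follows v q"
proof -
  let ?a = "4 * v" let ?b = "4 * v + 1" let ?c = "4 * v + 2" let ?d = "4 * v + 3"
  have lt: "?a < 4 * n + k" "?b < 4 * n + k" "?c < 4 * n + k" "?d < 4 * n + k" using v by auto
  have m: "s ?a = ?b \<or> s ?b = ?a" "s ?c = ?d \<or> s ?d = ?c"
    using mates[OF v, of 0] mates[OF v, of 2] by (simp_all add: eval_nat_numeral)
  have gs: "g ?b ?d = -4" "g ?a ?c = -4" "g ?b ?c = -2" "g ?a ?d = -2"
    using gweight_same[OF v, of 1 3] gweight_same[OF v, of 0 2] gweight_same[OF v, of 1 2] gweight_same[OF v, of 0 3] by auto
  have F: "follows v 0 \<longleftrightarrow> s ?a = ?b \<and> s ?b = ?d \<and> s ?d = ?c"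
    "follows v 1 \<longleftrightarrow> s ?b = ?a \<and> s ?a = ?c \<and> s ?c = ?d"
    "follows v 2 \<longleftrightarrow> s ?c = ?d \<and> s ?d = ?b \<and> s ?b = ?a"
    "follows v 3 \<longleftrightarrow> s ?d = ?c \<and> s ?c = ?a \<and> s ?a = ?b"
    unfolding follows_def block_def by simp_all
  have d4: "?a div 4 = v" "?b div 4 = v" "?c div 4 = v" "?d div 4 = v" by auto
  note exit = exit_nonneg[OF d4(1)] exit_nonneg[OF d4(2)] exit_nonneg[OF d4(3)] exit_nonneg[OF d4(4)]
  have gs': "g ?c ?b = -2" "g ?d ?a = -2" using gs gweight_commute by metis+
  have n4: "\<not> (s ?a \<in> {?a,?b,?c,?d} \<and> s ?b \<in> {?a,?b,?c,?d} \<and> s ?c \<in> {?a,?b,?c,?d} \<and> s ?d \<in> {?a,?b,?c,?d})"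
    using no_4cycle[OF v] by auto
  consider (1) "s ?a = ?b" "s ?c = ?d" | (2) "s ?b = ?a" "s ?d = ?c"
    | (3) "s ?a = ?b" "s ?d = ?c" | (4) "s ?b = ?a" "s ?c = ?d" using m by blast
  then show ?thesis
  proof cases
    \<comment> \<open>Both edges point upwards. The edges leaving \<open>b\<close> and
      \<open>d\<close> weigh at least -2 together, because two edges of weight -2 would close the
      gadget; the exchange would bring at most -4 + 1 = -3. Case 2 is the same with \<open>a\<close>
      and \<open>c\<close>.\<close>
    case 1
    have o: "s ?b \<noteq> ?a" "s ?d \<noteq> ?c" "s ?b \<noteq> ?b" "s ?d \<noteq> ?d" "s ?b \<noteq> ?d" "s ?d \<noteq> ?b"
        using 1 s_s_neq[of "?a"] s_s_neq[of "?c"] s_neq[of "?b"] s_neq[of "?d"] lt s_inj[of "?b" "?c"] s_inj[of "?d" "?a"] by auto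
    have "g ?b (s ?b) + g ?d (s ?d) \<le> -4 + g (s ?b) (s ?d)"
      using exchange[of ?b ?d] lt gs by auto
    moreover have "g ?b (s ?b) \<ge> (if s ?b = ?c then -2 else 0)"
    proof (cases "s ?b = ?c")
      case False
      then have "s ?b \<notin> {?a, ?b, ?c, ?d}" using o by blast
      then show ?thesis using exit False by simp
    qed (use gs gs' in simp)
    moreover have "g ?d (s ?d) \<ge> (if s ?d = ?a then -2 else 0)"
    proof (cases "s ?d = ?a")
      case False
      then have "s ?d \<notin> {?a, ?b, ?c, ?d}" using o by blast
      then show ?thesis using exit False by simp
    qed (use gs gs' in simp)
    moreover have "\<not> (s ?b = ?c \<and> s ?d = ?a)" using n4 1 by auto
    ultimately have False using gweight_le_1[of n E "s ?b" "s ?d"] by (auto split: if_splits)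
    then show ?thesis ..
  next
    case 2
    have o: "s ?a \<noteq> ?b" "s ?c \<noteq> ?d" "s ?a \<noteq> ?a" "s ?c \<noteq> ?c" "s ?a \<noteq> ?c" "s ?c \<noteq> ?a"
        using 2 s_s_neq[of "?b"] s_s_neq[of "?d"] s_neq[of "?a"] s_neq[of "?c"] lt s_inj[of "?a" "?d"] s_inj[of "?c" "?b"] by auto
    have "g ?a (s ?a) + g ?c (s ?c) \<le> -4 + g (s ?a) (s ?c)"
      using exchange[of ?a ?c] lt gs by auto
    moreover have "g ?a (s ?a) \<ge> (if s ?a = ?d then -2 else 0)"
    proof (cases "s ?a = ?d")
      case False
      then have "s ?a \<notin> {?a, ?b, ?c, ?d}" using o by blast
      then show ?thesis using exit False by simp
    qed (use gs gs' in simp)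
    moreover have "g ?c (s ?c) \<ge> (if s ?c = ?b then -2 else 0)"
    proof (cases "s ?c = ?b")
      case False
      then have "s ?c \<notin> {?a, ?b, ?c, ?d}" using o by blast
      then show ?thesis using exit False by simp
    qed (use gs gs' in simp)
    moreover have "\<not> (s ?a = ?d \<and> s ?c = ?b)" using n4 2 by auto
    ultimately have False using gweight_le_1[of n E "s ?a" "s ?c"] by (auto split: if_splits)
    then show ?thesis ..
  next
    \<comment> \<open>If both connecting edges of weight -4 are missing, the edges at
      \<open>b\<close> and \<open>c\<close> leave the gadget and weigh at least 0, whereas the
      exchange would bring at most -2 + 1. Case 4 is the same with \<open>a\<close> and
      \<open>d\<close>.\<close>
    case 3
    have "s ?b = ?d \<or> s ?c = ?a"
    proof (rule ccontr)
      assume c: "\<not> ?thesis"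
      have o: "s ?b \<noteq> ?a" "s ?c \<noteq> ?d" "s ?b \<noteq> ?b" "s ?c \<noteq> ?c" "s ?b \<noteq> ?c" "s ?c \<noteq> ?b"
        using 3 s_s_neq[of "?a"] s_s_neq[of "?d"] s_neq[of "?b"] s_neq[of "?c"] lt s_inj[of "?b" "?d"] s_inj[of "?c" "?a"] by auto
      have "g ?b (s ?b) + g ?c (s ?c) \<le> -2 + g (s ?b) (s ?c)"
        using exchange[of ?b ?c] lt gs by auto
      moreover have "g ?b (s ?b) \<ge> 0"
      proof -
        have "s ?b \<notin> {?a, ?b, ?c, ?d}" using o c by blast
        then show ?thesis using exit by simp
      qed
      moreover have "g ?c (s ?c) \<ge> 0"
      proof -
        have "s ?c \<notin> {?a, ?b, ?c, ?d}" using o c by blast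
        then show ?thesis using exit by simp
      qed
      ultimately show False using gweight_le_1[of n E "s ?b" "s ?c"] by auto
    qed
    then have "follows v 0 \<or> follows v 3" using F 3 by auto
    then show ?thesis by (elim disjE) (rule exI[of _ 0], simp, rule exI[of _ 3], simp)
  next
    case 4
    have "s ?a = ?c \<or> s ?d = ?b"
    proof (rule ccontr)
      assume c: "\<not> ?thesis"
      have o: "s ?a \<noteq> ?b" "s ?d \<noteq> ?c" "s ?a \<noteq> ?a" "s ?d \<noteq> ?d" "s ?a \<noteq> ?d" "s ?d \<noteq> ?a"
        using 4 s_s_neq[of "?b"] s_s_neq[of "?c"] s_neq[of "?a"] s_neq[of "?d"] lt s_inj[of "?a" "?c"] s_inj[of "?d" "?b"] by auto
      have "g ?a (s ?a) + g ?d (s ?d) \<le> -2 + g (s ?a) (s ?d)"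
        using exchange[of ?a ?d] lt gs by auto
      moreover have "g ?a (s ?a) \<ge> 0"
      proof -
        have "s ?a \<notin> {?a, ?b, ?c, ?d}" using o c by blast
        then show ?thesis using exit by simp
      qed
      moreover have "g ?d (s ?d) \<ge> 0"
      proof -
        have "s ?d \<notin> {?a, ?b, ?c, ?d}" using o c by blast
        then show ?thesis using exit by simp
      qed
      ultimately show False using gweight_le_1[of n E "s ?a" "s ?d"] by auto
    qed
    then have "follows v 1 \<or> follows v 2" using F 4 by auto
    then show ?thesis by (elim disjE) (rule exI[of _ 1], simp, rule exI[of _ 2], simp)
  qed
qed

text \<open>The other three vertices of the block already have a predecessor inside the gadget, and
  the successor map is injective.\<close>

lemma entry_unique:
  assumes "follows v q" "v < n" "p < 4 * n + k" "s p div 4 = v" "p div 4 \<noteq> v"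
  shows "s p = block v q ! 0"
proof -
  have "s p \<in> set (block v q)" using div4_in[OF assms(4)] block_sets by blast
  then have "s p \<in> {block v q ! 0, block v q ! 1, block v q ! 2, block v q ! 3}"
    using block_list[of v q] by (metis list.set(1) list.simps(15))
  moreover have "s p \<noteq> block v q ! Suc i" if "i < 3" for i
  proof
    assume "s p = block v q ! Suc i"
    also have "\<dots> = s (block v q ! i)"
      using assms(1) that unfolding follows_def by (auto simp: numeral_eq_Suc less_Suc_eq)
    finally have "s p = s (block v q ! i)" .
    moreover have d: "block v q ! i div 4 = v" using block_nth_div4[of i] that by simp
    ultimately have "p = block v q ! i" using assms s_inj[of p "block v q ! i"] by simp
    then show False using assms d by simp
  qed
  from this[of 0] this[of 1] this[of 2] have "s p \<noteq> block v q ! 1" "s p \<noteq> block v q ! 2" "s p \<noteq> block v q ! 3"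
    by (simp_all add: numeral_eq_Suc)
  ultimately show ?thesis by blast
qed

text \<open>An edge of weight 1 would be improvable together with an edge between two hubs, and a
  pigeonhole argument supplies such an edge.\<close>

lemma cross_edge:
  assumes x: "x < 4 * n" "s x < 4 * n" "x div 4 \<noteq> s x div 4"
  shows "{x div 4, s x div 4} \<in> E \<and> odd x \<and> odd (s x)"
proof (rule ccontr)
  assume "\<not> ?thesis"
  then have g1: "g x (s x) = 1" using x by (auto simp: gweight_def)
  \<comment> \<open>If both \<open>u\<close> and \<open>s u\<close> were hubs, the exchange at
    \<open>x\<close> and \<open>u\<close> would replace total weight 1 by two edges at hubs, of
    weight 0.\<close>
  have hub: "s u < 4 * n" if "4 * n \<le> u" "u < 4 * n + k" for u
  proof (rule ccontr)
    assume "\<not> s u < 4 * n"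
    then have "g u (s u) = 0" "g x u = 0" "g (s x) (s u) = 0" using that by (auto simp: gweight_def)
    then show False using exchange[of x u] g1 x that by auto
  qed
  have same: "p = p'" if sm: "p < 4 * n + k" "p' < 4 * n + k" "s p div 4 = v" "s p' div 4 = v"
    "p div 4 \<noteq> v" "p' div 4 \<noteq> v" "v < n" for p p' v
  proof -
    obtain q where "follows v q" using block_exists sm(7) by blast
    then have "s p = s p'" using entry_unique sm by metis
    then show ?thesis using s_inj that by blast
  qed
  \<comment> \<open>So every hub enters a gadget, and no gadget is entered twice. Since
    \<open>n <= k\<close>, all gadgets are entered from hubs, including the one of
    \<open>s x\<close>, which is entered from the non-hub \<open>x\<close>.\<close>
  have "inj_on (\<lambda>u. s u div 4) {4 * n..<4 * n + k}"
  proof (rule inj_onI)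
    fix u u' assume u: "u \<in> {4 * n..<4 * n + k}" "u' \<in> {4 * n..<4 * n + k}" "s u div 4 = s u' div 4"
    then have "s u div 4 < n" "u div 4 \<ge> n" "u' div 4 \<ge> n" using hub[of u] by auto
    then have "u div 4 \<noteq> s u div 4" "u' div 4 \<noteq> s u div 4" by linarith+
    moreover have "u < 4 * n + k" "u' < 4 * n + k" using u by auto
    ultimately show "u = u'" using \<open>s u div 4 < n\<close> u(3)[symmetric] by (intro same[of u u' "s u div 4"]) blast+
  qed
  then have "card ((\<lambda>u. s u div 4) ` {4 * n..<4 * n + k}) = k" by (simp add: card_image)
  moreover have "(\<lambda>u. s u div 4) ` {4 * n..<4 * n + k} \<subseteq> {..<n}" using hub by force
  ultimately have "(\<lambda>u. s u div 4) ` {4 * n..<4 * n + k} = {..<n}"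
    using n_le_k card_mono[of "{..<n}" "(\<lambda>u. s u div 4) ` {4 * n..<4 * n + k}"]
    by (intro card_subset_eq) simp_all
  moreover have "s x div 4 < n" using x by auto
  ultimately have "s x div 4 \<in> (\<lambda>u. s u div 4) ` {4 * n..<4 * n + k}" by blast
  then obtain u where "u \<in> {4 * n..<4 * n + k}" "s x div 4 = s u div 4" by blast
  then have u: "4 * n \<le> u" "u < 4 * n + k" "s u div 4 = s x div 4" by simp_all
  have "n \<le> u div 4" "s x div 4 < n" using u x by auto
  then have "u div 4 \<noteq> s x div 4" by linarith
  moreover have "x < 4 * n + k" "s x div 4 < n" using x by auto
  ultimately have "u = x" using u x by (intro same[of u x "s x div 4"]) blast+
  then show False using u x by simp
qed

context
  fixes xs assumes root: "zs = 4 * n # xs"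
begin

lemma s_suffix: "xs = as @ a # bs \<Longrightarrow> s a = (case bs of [] \<Rightarrow> 4 * n | b # _ \<Rightarrow> b)"
proof (cases bs)
  case Nil
  assume "xs = as @ a # bs"
  then show ?thesis using nxt_nth[of zs "length xs"] zs(1) root Nil by (simp add: nth_append)
next
  case (Cons b bs')
  assume "xs = as @ a # bs"
  then show ?thesis using nxt_append[of "4 * n # as" a b bs'] zs(1) root Cons by simp
qed

text \<open>The list is consumed from the left. The invariant that a suffix contains only whole
  gadgets ensures that a gadget vertex at its front is the first vertex of its block.\<close>

lemma blocked_suffix:
  assumes "xs = as @ ys" "\<And>y. y \<in> set ys \<Longrightarrow> y < 4 * n \<Longrightarrow> set (block (y div 4) 0) \<subseteq> set ys"
  shows "blocked n E ys"
  using assms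
proof (induction "length ys" arbitrary: as ys rule: less_induct)
  case less
  have dist: "distinct ys" "4 * n \<notin> set ys" using zs(1) root less.prems(1) by auto
  have bset: "set (block v q) = set (block v q')" for v q q' using block_sets by metis
  show ?case
  proof (cases ys)
    case Nil
    then show ?thesis by (simp add: blocked.Nil)
  next
    case ys: (Cons x r)
    show ?thesis
    proof (cases "4 * n \<le> x")
      case True
      have "blocked n E r"
      proof (rule less.hyps[of r "as @ [x]"])
        fix y assume y: "y \<in> set r" "y < 4 * n"
        then have "set (block (y div 4) 0) \<subseteq> set ys" using less.prems(2)[of y] ys by simp
        moreover have "x \<notin> set (block (y div 4) 0)"
        proof
          assume "x \<in> set (block (y div 4) 0)"
          then have "x div 4 = y div 4" using in_div4 block_sets by blast
          moreover have "n \<le> x div 4" "y div 4 < n" using True y by auto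
          ultimately show False by simp
        qed
        ultimately show "set (block (y div 4) 0) \<subseteq> set r" using ys by auto
      qed (use ys less.prems in auto)
      then show ?thesis using True ys by (auto intro: blocked.hub)
    next
      case False
      define v where "v = x div 4"
      have v: "v < n" using False v_def by auto
      obtain q where q: "q < 4" "follows v q" using block_exists[OF v] by blast
      let ?b = "\<lambda>i. block v q ! i"
      have "set (block (x div 4) 0) \<subseteq> set ys" using less.prems(2)[of x] ys False by simp
      then have sub: "set (block v q) \<subseteq> set ys" using bset[of v q 0] v_def by simp
      have bin: "block v q ! i \<in> set ys" if "i < 4" for i
      proof -
        have "length (block v q) = 4" by (simp add: block_def)
        then show ?thesis using that sub by (metis nth_mem subsetD)
      qed
      have nextb: "?b 0 # ?b 1 # ?b 2 # ?b 3 # [] = block v q" using block_list by metis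
      have fol: "s (?b 0) = ?b 1" "s (?b 1) = ?b 2" "s (?b 2) = ?b 3"
        using q(2) unfolding follows_def by auto
      \<comment> \<open>Were \<open>x\<close> a later vertex of its block, its predecessor would
        stand behind \<open>x\<close> in the list, yet be followed by \<open>x\<close>.\<close>
      have notx: "?b (Suc i) \<noteq> x" if i: "s (?b i) = ?b (Suc i)" "i < 3" for i
      proof
        assume e: "?b (Suc i) = x"
        have "?b i < 4 * n + k" using block_nth_div4[of i v q] i(2) v by auto
        then have "?b i \<noteq> x" using s_neq[of "?b i"] e i by auto
        then obtain r1 r2 where r: "r = r1 @ ?b i # r2" using bin[of i] i(2) ys by (auto dest: split_list)
        then have "x = (case r2 of [] \<Rightarrow> 4 * n | b # _ \<Rightarrow> b)"
          using s_suffix[of "as @ x # r1" "?b i" r2] less.prems(1) ys i e by simp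
        then show False using dist ys r by (auto split: list.splits)
      qed
      have "x \<in> set (block v q)" using div4_in[of x v] block_sets v_def by blast
      then have "x \<in> {?b 0, ?b 1, ?b 2, ?b 3}" by (subst (asm) nextb[symmetric]) simp
      moreover have "?b 1 \<noteq> x" "?b 2 \<noteq> x" "?b 3 \<noteq> x"
        using notx[of 0] notx[of 1] notx[of 2] fol by (simp_all add: numeral_2_eq_2 numeral_3_eq_3)
      ultimately have "x = ?b 0" by blast
      \<comment> \<open>The tour cannot return to the root here, because the successor is a gadget
        vertex; so the list goes on.\<close>
      have step: "\<exists>r'. bs = s a # r'" if "ys = as' @ a # bs" "a \<in> {?b 0, ?b 1, ?b 2}" for as' a bs
      proof -
        have "s a div 4 = v" using that(2) fol block_nth_div4[of 1 v q] block_nth_div4[of 2 v q] block_nth_div4[of 3 v q] by auto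
        then have "s a < 4 * n" using v by auto
        then show ?thesis using s_suffix[of "as @ as'" a bs] less.prems(1) that(1) by (auto split: list.splits)
      qed
      obtain r1 where r1: "r = ?b 1 # r1" using step[of "[]" x r] ys \<open>x = ?b 0\<close> fol by auto
      obtain r2 where r2: "r1 = ?b 2 # r2" using step[of "[x]" "?b 1" r1] ys r1 fol by auto
      obtain r3 where r3: "r2 = ?b 3 # r3" using step[of "[x, ?b 1]" "?b 2" r2] ys r1 r2 fol by auto
      have yseq: "ys = block v q @ r3" using ys r1 r2 r3 \<open>x = ?b 0\<close> by (metis append_Cons append_Nil nextb)
      have "blocked n E r3"
      proof (rule less.hyps[of r3 "as @ block v q"])
        fix y assume y: "y \<in> set r3" "y < 4 * n"
        have "y \<notin> set (block v q)" using dist y yseq by auto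
        then have "y div 4 \<noteq> v" using div4_in[of y v] block_sets by blast
        then have "set (block (y div 4) 0) \<inter> set (block v q) = {}"
          using block_div4[of _ v q] block_div4[of _ "y div 4" 0] by (metis disjoint_iff)
        moreover have "set (block (y div 4) 0) \<subseteq> set ys" using less.prems(2)[of y] y yseq by simp
        ultimately show "set (block (y div 4) 0) \<subseteq> set r3" using yseq by auto
      qed (use yseq less.prems block_list[of v q] in \<open>auto simp: block_def\<close>)
      moreover have "link n E (last (block v q)) r3"
      proof (cases r3)
        case (Cons y r4)
        have l: "last (block v q) = ?b 3" using nextb by (metis last.simps list.distinct(1))
        have "xs = (as @ [?b 0, ?b 1, ?b 2]) @ ?b 3 # y # r4"
          using less.prems(1) ys r1 r2 r3 Cons \<open>x = ?b 0\<close> by simp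
        then have "s (?b 3) = y" using s_suffix[of "as @ [?b 0, ?b 1, ?b 2]" "?b 3" "y # r4"] by simp
        moreover have "?b 3 div 4 = v" using block_nth_div4[of 3] by simp
        moreover have "y div 4 \<noteq> v"
        proof -
          have "y \<notin> set (block v q)" using dist yseq Cons by auto
          then show ?thesis using div4_in[of y v] block_sets by blast
        qed
        moreover have "?b 3 < 4 * n" using block_nth_div4[of 3 v q] v by auto
        ultimately show ?thesis using cross_edge[of "?b 3"] Cons l unfolding link_def
          by (metis leI list.sel(1))
      qed (simp add: link_def)
      ultimately show ?thesis unfolding yseq using v q by (intro blocked.block) auto
    qed
  qed
qed

lemma blocked_tour: "blocked n E xs"
proof (rule blocked_suffix[of "[]"])
  fix y assume y: "y \<in> set xs" "y < 4 * n"
  then have "y div 4 < n" by auto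
  moreover have "set xs = V - {4 * n}" using zs root by auto
  ultimately show "set (block (y div 4) 0) \<subseteq> set xs" using n_le_k n_pos by (auto simp: block_sets)
qed simp

end
end
end

section \<open>Two-optimal tours as rooted lists\<close>

lemma path_edges_Cons_minus:
  assumes "distinct (a # xs)"
  shows "path_edges (a # xs) - {e. a \<in> e} = path_edges xs"
  using assms path_edges_subset[of _ xs] by (cases xs) auto

text \<open>The head has only one edge, which determines the second vertex; deleting the head leaves
  the same problem for the tails.\<close>

lemma path_edges_hd_eq:
  assumes "distinct xs" "distinct ys" "set xs = set ys" "path_edges xs = path_edges ys"
    "xs \<noteq> []" "hd xs = hd ys"
  shows "xs = ys"
  using assms
proof (induction xs arbitrary: ys)
  case (Cons a xs)
  then obtain ys' where ys: "ys = a # ys'" by (cases ys) auto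
  have s: "set xs = set ys'" using Cons.prems ys by auto
  have p: "path_edges xs = path_edges ys'"
    using path_edges_Cons_minus[of a xs] path_edges_Cons_minus[of a ys'] Cons.prems ys by simp
  show ?case
  proof (cases xs)
    case Nil then show ?thesis using s ys by simp
  next
    case (Cons b xs')
    then obtain c ys'' where c: "ys' = c # ys''" using s by (cases ys') auto
    have "{a, b} \<in> path_edges ys" using Cons.prems(4) Cons by auto
    moreover have "{a, b} \<notin> path_edges ys'" using path_edges_subset[of "{a,b}" ys'] Cons.prems(2) ys by auto
    ultimately have "b = c" using ys c by (auto simp: doubleton_eq_iff)
    then have "xs = ys'" using Cons.IH[of ys'] Cons.prems ys s p Cons c by simp
    then show ?thesis using ys by simp
  qed
qed simp

text \<open>Inner vertices have degree at least two; this identifies the ends of a path from its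
  edge set alone.\<close>

lemma path_edges_end:
  assumes "distinct (as @ a # b # c # cs)"
  shows "card {e \<in> path_edges (as @ a # b # c # cs). b \<in> e} \<ge> 2"
proof -
  have "{{a,b},{b,c}} \<subseteq> {e \<in> path_edges (as @ a # b # c # cs). b \<in> e}"
    using path_edges_append[of as a "b # c # cs"] by auto
  moreover have "card {{a,b},{b,c}} = 2" using assms by (auto simp: card_2_iff doubleton_eq_iff)
  moreover have "finite (path_edges (as @ a # b # c # cs))" by (auto simp: path_edges_def)
  ultimately show ?thesis
    using card_mono[of "{e \<in> path_edges (as @ a # b # c # cs). b \<in> e}" "{{a,b},{b,c}}"] by simp
qed

text \<open>The head of \<open>ys\<close> has degree at most one, so it is an end of
  \<open>xs\<close>. After a possible reversal both lists start with it.\<close>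

lemma path_edges_eq_iff:
  assumes "distinct xs" "distinct ys"
  shows "set xs = set ys \<and> path_edges xs = path_edges ys \<longleftrightarrow> ys = xs \<or> ys = rev xs"
proof
  assume *: "set xs = set ys \<and> path_edges xs = path_edges ys"
  show "ys = xs \<or> ys = rev xs"
  proof (cases ys)
    case Nil then show ?thesis using * by simp
  next
    case (Cons b ys')
    have bx: "b \<in> set xs" using * Cons by simp
    have cb: "card {e \<in> path_edges xs. b \<in> e} \<le> 1"
    proof -
      \<comment> \<open>For \<open>ys' = []\<close> the value \<open>hd ys'\<close> is arbitrary,
        but then there are no edges at all.\<close>
      have "{e \<in> path_edges ys. b \<in> e} \<subseteq> {{b, hd ys'}}"
        using Cons assms path_edges_subset[of _ ys'] by (cases ys') auto
      then show ?thesis using * by (metis card_mono finite.emptyI finite.insertI is_singletonI is_singleton_altdef)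
    qed
    obtain as cs where x: "xs = as @ b # cs" using bx by (auto dest: split_list)
    have "as = [] \<or> cs = []"
    proof (rule ccontr)
      assume "\<not> ?thesis"
      then obtain as' a c cs' where "as = as' @ [a]" "cs = c # cs'" by (metis list.exhaust rev_exhaust)
      then show False using path_edges_end[of as' a b c cs'] cb x assms by simp
    qed
    then show ?thesis
    proof
      assume "as = []"
      then show ?thesis using path_edges_hd_eq[of xs ys] x * assms Cons by simp
    next
      assume "cs = []"
      then have "rev xs = ys" using path_edges_hd_eq[of "rev xs" ys] path_edges_rev[of xs] x * assms Cons by simp
      then show ?thesis by simp
    qed
  qed
qed auto

lemma cycle_edges_Cons_minus:
  assumes "distinct (r # xs)"
  shows "cycle_edges (r # xs) - {e. r \<in> e} = path_edges xs"
proof (cases xs rule: rev_cases)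
  case Nil then show ?thesis by (auto simp: cycle_edges_path)
next
  case (snoc ys y)
  have "cycle_edges (r # xs) = path_edges (r # xs) \<union> {{y, r}}"
    unfolding cycle_edges_path snoc using path_edges_append[of "r # ys" y "[r]"] by simp
  then show ?thesis using path_edges_Cons_minus[OF assms] by auto
qed

text \<open>Deleting the edges at the common root opens both cycles into paths, for which only the
  direction is undetermined.\<close>

lemma cycle_edges_eq_iff:
  assumes "distinct (r # xs)" "distinct (r # ys)" "set xs = set ys"
  shows "cycle_edges (r # xs) = cycle_edges (r # ys) \<longleftrightarrow> ys = xs \<or> ys = rev xs"
  using path_edges_eq_iff[of xs ys] cycle_edges_Cons_minus[of r] cycle_edges_rev[of r xs] assms
  by (metis distinct.simps(2))

section \<open>Weights of normal forms and the converse\<close>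

fun gpath :: "nat \<Rightarrow> nat set set \<Rightarrow> nat list \<Rightarrow> int" where
  "gpath n E (x # y # ys) = gweight n E x y + gpath n E (y # ys)"
| "gpath n E _ = 0"

lemma gpath_nth: "gpath n E xs = (\<Sum>i<length xs - 1. gweight n E (xs ! i) (xs ! Suc i))"
  by (induction n E xs rule: gpath.induct) (simp_all add: sum.lessThan_Suc_shift del: sum.lessThan_Suc)

text \<open>A block weighs -10 - 4 - 10. Its last vertex is kept to carry the edge to what
  follows.\<close>

lemma gpath_block:
  assumes "v < n" "q < 4"
  shows "gpath n E (block v q @ ys) = gpath n E (last (block v q) # ys) - 24"
proof -
  have "q = 0 \<or> q = 1 \<or> q = 2 \<or> q = 3" using assms by auto
  moreover note gweight_same[of v n 0 1 E]
    gweight_same[of v n 1 0 E]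
    gweight_same[of v n 1 3 E]
    gweight_same[of v n 3 1 E]
    gweight_same[of v n 3 2 E]
    gweight_same[of v n 2 3 E]
    gweight_same[of v n 0 2 E]
    gweight_same[of v n 2 0 E]
  ultimately show ?thesis using assms(1) by (elim disjE) (simp_all add: block_def)
qed

lemma gweight_link:
  assumes "simple_graph {0..<n} E" "link n E x (y # ys)"
  shows "gweight n E x y = 0"
proof -
  have "x div 4 \<noteq> y div 4" if "{x div 4, y div 4} \<in> E"
    using assms(1) that unfolding simple_graph_def by auto
  then show ?thesis using assms(2) by (auto simp: link_def gweight_def)
qed

text \<open>The weight -24 of a block is spread as -6 over its four vertices, so that the total
  depends on the set of vertices only. The arbitrary linked predecessor \<open>p\<close> makes the
  induction go through.\<close>

lemma gpath_blocked:
  assumes "simple_graph {0..<n} E" "blocked n E xs" "link n E p xs" "4 * n \<le> r"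
  shows "gpath n E (p # xs @ [r]) = - 6 * int (length (filter (\<lambda>x. x < 4 * n) xs))"
  using assms(2,3)
proof (induction arbitrary: p)
  case Nil
  then show ?case using assms(4) by (simp add: gweight_def)
next
  case (hub u xs)
  then have "link n E u xs" by (simp add: link_def)
  then show ?case using hub.IH[of u] hub.hyps by (simp add: gweight_def)
next
  case (block v q xs)
  obtain b bs where b: "block v q = b # bs" using block_list by blast
  have "\<forall>x\<in>set (block v q). x < 4 * n" using block.hyps(1) block_sets by auto
  then have "filter (\<lambda>x. x < 4 * n) (block v q) = block v q" by simp
  moreover have "length (block v q) = 4" by (simp add: block_def)
  moreover have "gweight n E p b = 0" using gweight_link[OF assms(1), of p b] block.prems b by simp
  then have "gpath n E (p # block v q @ xs @ [r]) = gpath n E (block v q @ xs @ [r])" using b by simp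
  ultimately show ?case using block.IH[OF block.hyps(4)] gpath_block[OF block.hyps(1,2)] by simp
qed

context tsp_instance
begin

text \<open>The hub \<open>4 * n\<close> serves as root: a tour that is cut there is a list, unique
  up to reversal.\<close>

definition rooted where
  "rooted = {xs. blocked n E xs \<and> distinct xs \<and> set xs = V - {4 * n}}"

lemma root_in_V: "4 * n \<in> V"
  using n_pos n_le_k by auto

lemma rooted_cycle:
  assumes "distinct xs" "set xs = V - {4 * n}"
  shows "distinct (4 * n # xs)" "set (4 * n # xs) = V" "length (4 * n # xs) = 4 * n + k"
proof -
  show 1: "distinct (4 * n # xs)" "set (4 * n # xs) = V"
    unfolding list.simps(15) distinct.simps assms(2) using assms(1) insert_Diff[OF root_in_V] by blast+
  show "length (4 * n # xs) = 4 * n + k" using distinct_card[OF 1(1)] 1(2) by simp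
qed

lemma tour_weight_gpath:
  assumes "distinct zs" "set zs = V" "zs = r # xs"
  shows "tour_weight w (cycle_edges zs) = of_int (gpath n E (r # xs @ [r]))"
proof -
  have len: "length zs = 4 * n + k" "length zs \<ge> 5"
    using distinct_card[OF assms(1)] assms(2) n_pos n_le_k by auto
  have "tour_weight w (cycle_edges zs) = (\<Sum>x\<in>set zs. w {x, nxt zs x})"
    using len by (intro tour_weight_cycle assms) auto
  also have "\<dots> = (\<Sum>x\<in>set zs. of_int (gweight n E x (nxt zs x)))"
  proof (intro sum.cong refl)
    fix x assume x: "x \<in> set zs"
    then have "nxt zs x \<noteq> x" "nxt zs x \<in> set zs" using nxt_neq[OF assms(1) _ x] nxt_in_set[OF assms(1) x] len by auto
    then show "w {x, nxt zs x} = of_int (gweight n E x (nxt zs x))"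
      using w_eq[of x "nxt zs x"] assms(2) x by auto
  qed
  also have "\<dots> = (\<Sum>i<length zs. of_int (gweight n E (zs ! i) (nxt zs (zs ! i))))"
    using assms(1) by (intro sum.reindex_bij_betw[symmetric] bij_betw_nth) auto
  also have "\<dots> = (\<Sum>i<length zs. of_int (gweight n E ((r # xs @ [r]) ! i) ((r # xs @ [r]) ! Suc i)))"
  proof (intro sum.cong refl)
    fix i assume i: "i \<in> {..<length zs}"
    have "zs ! i = (r # xs @ [r]) ! i" using i assms(3) by (cases i) (auto simp: nth_append)
    moreover have "nxt zs (zs ! i) = (r # xs @ [r]) ! Suc i"
      using i assms nxt_nth[OF assms(1), of i] by (auto simp: nth_append mod_Suc less_Suc_eq)
    ultimately show "of_int (gweight n E (zs ! i) (nxt zs (zs ! i))) =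
       (of_int (gweight n E ((r # xs @ [r]) ! i) ((r # xs @ [r]) ! Suc i)) :: rat)" by simp
  qed
  also have "\<dots> = of_int (gpath n E (r # xs @ [r]))"
    unfolding gpath_nth of_int_sum using assms(3) by simp
  finally show ?thesis .
qed

lemma rooted_weight:
  assumes "xs \<in> rooted"
  shows "tour_weight w (cycle_edges (4 * n # xs)) = - 24 * of_nat n"
proof -
  have xs: "distinct xs" "set xs = V - {4 * n}" "blocked n E xs" using assms by (auto simp: rooted_def)
  have "gpath n E (4 * n # xs @ [4 * n]) = - 6 * int (length (filter (\<lambda>x. x < 4 * n) xs))"
    by (rule gpath_blocked[OF graph xs(3)]) (simp_all add: link_def)
  also have "length (filter (\<lambda>x. x < 4 * n) xs) = card (set (filter (\<lambda>x. x < 4 * n) xs))"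
    using xs(1) by (intro distinct_card[symmetric]) simp
  also have "set (filter (\<lambda>x. x < 4 * n) xs) = {0..<4 * n}" unfolding set_filter xs(2) by auto
  finally show ?thesis using tour_weight_gpath[of "4 * n # xs"] rooted_cycle[OF xs(1,2)] by simp
qed

lemma tour_rooted:
  assumes "tour V T"
  obtains xs where "distinct xs" "set xs = V - {4 * n}" "T = cycle_edges (4 * n # xs)"
proof -
  obtain zs where zs: "distinct zs" "set zs = V" "T = cycle_edges zs" using assms by (auto simp: tour_def)
  then obtain as bs where "zs = as @ 4 * n # bs" using root_in_V by (metis split_list)
  then have "T = cycle_edges (4 * n # bs @ as)" "distinct (bs @ as)" "set (bs @ as) = V - {4 * n}"
    using zs cycle_edges_rotate[of as "4 * n # bs"] by auto
  then show ?thesis using that by blast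
qed

lemma rooted_tour:
  assumes "distinct xs" "set xs = V - {4 * n}"
  shows "tour V (cycle_edges (4 * n # xs))"
  unfolding tour_def using rooted_cycle[OF assms] n_pos by (intro exI[of _ "4 * n # xs"]) auto

lemma two_optimal_rooted:
  assumes "distinct xs" "set xs = V - {4 * n}" "two_optimal V w (cycle_edges (4 * n # xs))"
  shows "xs \<in> rooted"
  using blocked_tour[OF assms(3) _ _ refl] rooted_cycle[OF assms(1,2)] assms by (auto simp: rooted_def)

lemma finite_tours: "finite {T. tour V T}"
proof (rule finite_subset)
  show "{T. tour V T} \<subseteq> (\<lambda>zs. cycle_edges zs) ` {zs. set zs \<subseteq> V \<and> distinct zs}"
    by (auto simp: tour_def)
qed (simp add: finite_subset_distinct)

text \<open>For the converse, take a tour of minimum weight. It is 2-optimal, hence in normal form,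
  hence of weight \<open>- 24 * n\<close>, which is also the weight of every other normal form. So
  all of them are global minima.\<close>

lemma two_optimal_iff:
  assumes "distinct xs" "set xs = V - {4 * n}"
  shows "two_optimal V w (cycle_edges (4 * n # xs)) \<longleftrightarrow> xs \<in> rooted"
proof
  assume xs: "xs \<in> rooted"
  obtain ys where "distinct ys" "set ys = V - {4 * n}"
    using finite_distinct_list[of "V - {4 * n}"] by auto
  then have "tour_weight w ` {T. tour V T} \<noteq> {}" using rooted_tour by blast
  moreover have "finite (tour_weight w ` {T. tour V T})" using finite_tours by simp
  ultimately have "\<exists>m\<in>tour_weight w ` {T. tour V T}. \<not> (\<exists>x\<in>tour_weight w ` {T. tour V T}. x < m)"
    using ex_min_if_finite by blast
  then obtain T where T: "tour V T" and min: "\<And>T'. tour V T' \<Longrightarrow> tour_weight w T \<le> tour_weight w T'"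
    by (auto simp: not_less)
  then have "two_optimal V w T" by (auto simp: two_optimal_def two_change_def not_less)
  then have "tour_weight w T = - 24 * of_nat n"
    using tour_rooted[OF T] two_optimal_rooted rooted_weight by metis
  then have "tour_weight w (cycle_edges (4 * n # xs)) \<le> tour_weight w T'" if "tour V T'" for T'
    using min[OF that] rooted_weight[OF xs] by simp
  then show "two_optimal V w (cycle_edges (4 * n # xs))"
    using rooted_tour[OF assms] by (auto simp: two_optimal_def two_change_def not_less)
qed (use two_optimal_rooted assms in blast)

lemma finite_rooted: "finite rooted"
proof (rule finite_subset)
  show "rooted \<subseteq> {xs. set xs \<subseteq> V - {4 * n} \<and> distinct xs}" by (auto simp: rooted_def)
qed (simp add: finite_subset_distinct)

text \<open>A tour is cut into a list and its reverse, which differ because a list without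
  repetition and with at least two elements is no palindrome.\<close>

lemma card_rooted: "card rooted = 2 * f_two_opt V w"
proof -
  let ?f = "\<lambda>xs. cycle_edges (4 * n # xs)"
  have img: "{T. two_optimal V w T} = ?f ` rooted"
  proof (intro set_eqI iffI)
    fix T assume "T \<in> {T. two_optimal V w T}"
    then have T: "two_optimal V w T" "tour V T" by (auto simp: two_optimal_def)
    then show "T \<in> ?f ` rooted" using tour_rooted[OF T(2)] two_optimal_rooted by (metis image_eqI)
  next
    fix T assume "T \<in> ?f ` rooted"
    then show "T \<in> {T. two_optimal V w T}" using two_optimal_iff by (auto simp: rooted_def)
  qed
  have two: "card {xs \<in> rooted. ?f xs = T} = 2" if T: "T \<in> ?f ` rooted" for T
  proof -
    obtain ys where ys: "ys \<in> rooted" "T = ?f ys" using T by blast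
    then have d: "distinct ys" "set ys = V - {4 * n}" by (auto simp: rooted_def)
    have rev: "rev ys \<in> rooted"
      using ys d two_optimal_iff[of ys] two_optimal_iff[of "rev ys"] cycle_edges_rev[of "4 * n" ys] by simp
    have "{xs \<in> rooted. ?f xs = T} = {ys, rev ys}"
    proof (intro set_eqI iffI)
      fix xs assume "xs \<in> {xs \<in> rooted. ?f xs = T}"
      then have "xs \<in> rooted" "?f ys = ?f xs" using ys by auto
      then show "xs \<in> {ys, rev ys}"
        using cycle_edges_eq_iff[of "4 * n" ys xs] d by (auto simp: rooted_def)
    next
      fix xs assume "xs \<in> {ys, rev ys}"
      then show "xs \<in> {xs \<in> rooted. ?f xs = T}" using ys rev cycle_edges_rev[of "4 * n" ys] by auto
    qed
    moreover have "ys \<noteq> rev ys"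
    proof
      assume r: "ys = rev ys"
      have "length ys \<ge> 2" using rooted_cycle[OF d] n_pos by simp
      then obtain a b bs where ab: "ys = a # b # bs" by (cases ys; cases "tl ys") auto
      then have "last ys = a" using r by (metis last_rev list.sel(1))
      then have "a \<in> set (b # bs)" using ab by (metis last.simps last_in_set list.distinct(1))
      then show False using ab d(1) by simp
    qed
    ultimately show ?thesis by simp
  qed
  have "card rooted = (\<Sum>T\<in>?f ` rooted. card {xs \<in> rooted. ?f xs = T})"
    using sum.image_gen[OF finite_rooted, of "\<lambda>_. 1 :: nat" ?f] by simp
  also have "\<dots> = (\<Sum>T\<in>?f ` rooted. 2)" by (intro sum.cong refl two)
  finally show ?thesis unfolding f_two_opt_def img by simp
qed

end

section \<open>Arrangements of paths\<close>

definition path_pair :: "'a list \<Rightarrow> 'a set \<times> 'a set set" where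
  "path_pair xs = (set xs, path_edges xs)"

text \<open>A path cover, with the covered set given as a union instead of by unique existence.
  Adding or removing a path then is a set operation on \<open>S\<close>, as the inductions below
  require.\<close>

definition path_family :: "'a set set \<Rightarrow> ('a set \<times> 'a set set) set \<Rightarrow> 'a set \<Rightarrow> bool" where
  "path_family E C S \<longleftrightarrow>
     (\<forall>P\<in>C. \<exists>xs. xs \<noteq> [] \<and> distinct xs \<and> path_edges xs \<subseteq> E \<and> P = path_pair xs) \<and>
     (\<forall>P\<in>C. \<forall>Q\<in>C. P \<noteq> Q \<longrightarrow> fst P \<inter> fst Q = {}) \<and> \<Union> (fst ` C) = S"

lemma path_cover_iff: "path_cover S E C \<longleftrightarrow> path_family E C S"
proof
  assume c: "path_cover S E C"
  have "\<Union> (fst ` C) = S"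
  proof
    have "fst P \<subseteq> S" if "P \<in> C" for P
      using c that unfolding path_cover_def is_path_def by (metis fst_conv)
    then show "\<Union> (fst ` C) \<subseteq> S" by blast
    show "S \<subseteq> \<Union> (fst ` C)" using c unfolding path_cover_def by blast
  qed
  moreover have "\<exists>xs. xs \<noteq> [] \<and> distinct xs \<and> path_edges xs \<subseteq> E \<and> P = path_pair xs" if "P \<in> C" for P
    using c that unfolding path_cover_def is_path_def path_pair_def by metis
  ultimately show "path_family E C S" using c unfolding path_cover_def path_family_def by simp
next
  assume c: "path_family E C S"
  then have U: "\<Union> (fst ` C) = S" and disj: "\<forall>P\<in>C. \<forall>Q\<in>C. P \<noteq> Q \<longrightarrow> fst P \<inter> fst Q = {}"
    and paths: "\<forall>P\<in>C. \<exists>xs. xs \<noteq> [] \<and> distinct xs \<and> path_edges xs \<subseteq> E \<and> P = path_pair xs"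
    unfolding path_family_def by simp_all
  have "is_path S E P" if P: "P \<in> C" for P
  proof -
    obtain xs where "xs \<noteq> []" "distinct xs" "path_edges xs \<subseteq> E" "P = path_pair xs"
      using paths P by meson
    moreover have "fst P \<subseteq> S" using U P by auto
    ultimately show ?thesis unfolding is_path_def path_pair_def by auto
  qed
  moreover have "\<exists>!P. P \<in> C \<and> v \<in> fst P" if v: "v \<in> S" for v
  proof -
    obtain P where P: "P \<in> C" "v \<in> fst P" using U v by auto
    show ?thesis
    proof (rule ex1I)
      show "Q = P" if "Q \<in> C \<and> v \<in> fst Q" for Q using disj P that by (metis disjoint_iff)
    qed (use P in simp)
  qed
  ultimately show "path_cover S E C" using disj unfolding path_cover_def by simp
qed

lemma path_family_remove:
  assumes "path_family E C S" "P \<in> C"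
  shows "path_family E (C - {P}) (S - fst P)"
  using assms unfolding path_family_def by blast

lemma path_family_insert:
  assumes "path_family E C S" "xs \<noteq> []" "distinct xs" "path_edges xs \<subseteq> E" "set xs \<inter> S = {}"
  shows "path_family E (insert (path_pair xs) C) (set xs \<union> S)"
proof -
  have f: "fst (path_pair xs) = set xs" by (simp add: path_pair_def)
  have "set xs \<inter> fst Q = {}" if "Q \<in> C" for Q
    using assms(1,5) that unfolding path_family_def by blast
  then show ?thesis using assms unfolding path_family_def by (auto simp: f)
qed

section \<open>Words of blocks, and their arrangement between hubs\<close>

definition flat :: "(nat \<times> nat) list \<Rightarrow> nat list" where
  "flat ps = concat (map (\<lambda>(v, q). block v q) ps)"

lemma flat_simps [simp]: "flat [] = []" "flat ((v, q) # ps) = block v q @ flat ps"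
  by (simp_all add: flat_def)

text \<open>The ways to spell the path \<open>P\<close> by blocks: a direction, and a traversal for
  each vertex. With two or more vertices each block is joined to another one, which only odd ends
  allow.\<close>

definition words :: "nat set \<times> nat set set \<Rightarrow> (nat \<times> nat) list set" where
  "words P = {ps. ps \<noteq> [] \<and> distinct (map fst ps) \<and> path_pair (map fst ps) = P \<and>
     (\<forall>q\<in>set (map snd ps). q < 4 \<and> (2 \<le> length ps \<longrightarrow> odd q))}"

lemma block_Cons: "q < 4 \<Longrightarrow> \<exists>bs. block v q = (4 * v + q) # bs"
  by (auto simp: block_def) (presburger+)?

lemma length_block [simp]: "length (block v q) = 4"
  by (simp add: block_def)

lemma set_flat: "set (flat ps) = (\<Union>v\<in>set (map fst ps). set (block v 0))"
proof (induction ps)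
  case (Cons p ps)
  have "set (block (fst p) (snd p)) = set (block (fst p) 0)" by (simp only: block_sets)
  then show ?case using Cons by (simp add: flat_def case_prod_beta)
qed simp

lemma block_neq_Nil [simp]: "block v q \<noteq> []" "[] \<noteq> block v q"
  using length_block[of v q] by (auto simp del: length_block)

text \<open>A block reveals \<open>v\<close> and \<open>q\<close> by its first vertex
  \<open>4 * v + q\<close>, so words can be decoded from the left.\<close>

lemma flat_inj:
  assumes "\<forall>q\<in>set (map snd ps). q < 4" "\<forall>q\<in>set (map snd ps'). q < 4" "flat ps = flat ps'"
  shows "ps = ps'"
  using assms
proof (induction ps arbitrary: ps')
  case Nil
  then show ?case by (cases ps') auto
next
  case (Cons p ps)
  obtain v q where p: "p = (v, q)" by fastforce
  obtain p' ps'' where ps': "ps' = p' # ps''" using Cons.prems p by (cases ps') auto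
  obtain v' q' where p': "p' = (v', q')" by fastforce
  have "block v q = block v' q'" "flat ps = flat ps''" using Cons.prems p p' ps' by simp_all
  moreover have q4: "q < 4" "q' < 4" using Cons.prems p p' ps' by auto
  ultimately have "4 * v + q = 4 * v' + q'" using block_Cons[of q v] block_Cons[of q' v'] by auto
  then have "v = v' \<and> q = q'" using q4 by presburger
  then show ?case using Cons.IH[of ps''] Cons.prems p p' ps' \<open>flat ps = flat ps''\<close> by simp
qed

text \<open>The flag tells whether a path may come next; it is lowered by a path and raised by a
  hub. So every gap takes at most one path, which makes the decomposition of a list unique.\<close>

inductive arrangement :: "bool \<Rightarrow> nat set \<Rightarrow> (nat set \<times> nat set set) set \<Rightarrow> nat list \<Rightarrow> bool" where
  empty: "arrangement fr {} {} []"
| hub: "u \<in> A \<Longrightarrow> arrangement True (A - {u}) C zs \<Longrightarrow> arrangement fr A C (u # zs)"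
| path: "P \<in> C \<Longrightarrow> ps \<in> words P \<Longrightarrow> arrangement False A (C - {P}) zs \<Longrightarrow> arrangement True A C (flat ps @ zs)"

definition bounded_family :: "nat \<Rightarrow> (nat set \<times> nat set set) set \<Rightarrow> bool" where
  "bounded_family n C \<longleftrightarrow> (\<forall>P\<in>C. fst P \<subseteq> {..<n})"

lemma bounded_family_Diff: "bounded_family n C \<Longrightarrow> bounded_family n (C - D)"
  by (auto simp: bounded_family_def)

lemma flat_less:
  assumes "ps \<in> words P" "fst P \<subseteq> {..<n}"
  shows "\<forall>x\<in>set (flat ps). x < 4 * n" "flat ps \<noteq> []"
proof -
  have "path_pair (map fst ps) = P" using assms by (simp add: words_def)
  then have sub: "set (map fst ps) \<subseteq> {..<n}" using assms(2) unfolding path_pair_def by (metis fst_conv)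
  show "\<forall>x\<in>set (flat ps). x < 4 * n"
  proof
    fix x assume "x \<in> set (flat ps)"
    then obtain v where "v \<in> set (map fst ps)" "x \<in> set (block v 0)" unfolding set_flat by blast
    then have "x div 4 < n" using sub block_div4 by blast
    then show "x < 4 * n" by auto
  qed
  show "flat ps \<noteq> []" using assms by (cases ps) (auto simp: words_def)
qed

lemma arrangement_False_hd: "arrangement False A C zs \<Longrightarrow> zs = [] \<or> hd zs \<in> A"
  by (erule arrangement.cases) auto

lemma takeWhile_flat:
  assumes "ps \<in> words P" "fst P \<subseteq> {..<n}" "arrangement False A C zs" "A \<subseteq> {4 * n..}"
  shows "takeWhile (\<lambda>x. x < 4 * n) (flat ps @ zs) = flat ps" "dropWhile (\<lambda>x. x < 4 * n) (flat ps @ zs) = zs"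
proof -
  have "takeWhile (\<lambda>x. x < 4 * n) zs = [] \<and> dropWhile (\<lambda>x. x < 4 * n) zs = zs"
    using arrangement_False_hd[OF assms(3)] assms(4) by (cases zs) auto
  then show "takeWhile (\<lambda>x. x < 4 * n) (flat ps @ zs) = flat ps" "dropWhile (\<lambda>x. x < 4 * n) (flat ps @ zs) = zs"
    using flat_less[OF assms(1,2)] by simp_all
qed

lemma words_unique:
  assumes "ps \<in> words P" "ps' \<in> words P'" "flat ps = flat ps'"
  shows "ps = ps'" "P = P'"
proof -
  show "ps = ps'" using assms by (intro flat_inj) (auto simp: words_def)
  then show "P = P'" using assms by (auto simp: words_def)
qed

lemma hd_flat_less:
  assumes "ps \<in> words P" "fst P \<subseteq> {..<n}"
  shows "hd (flat ps @ zs) < 4 * n"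
  using flat_less[OF assms] by (metis hd_append2 hd_in_set)

text \<open>Gadget vertices are less than \<open>4 * n\<close> and hubs are not, so the longest
  initial run of gadget vertices is exactly the first word.\<close>

lemma arrangement_unique:
  assumes "arrangement fr A C zs" "arrangement fr' A C' zs" "A \<subseteq> {4 * n..}" "bounded_family n C" "bounded_family n C'"
  shows "C = C'"
  using assms
proof (induction arbitrary: C' fr')
  case (empty fr)
  from empty(1) show ?case
  proof (cases rule: arrangement.cases)
    case (path P ps zs)
    then show ?thesis using flat_less(2)[of ps P n] empty by (auto simp: bounded_family_def)
  qed auto
next
  case (hub u A C zs fr)
  from hub.prems(1) show ?case
  proof (cases rule: arrangement.cases)
    case hub
    then show ?thesis using hub.IH[of _ C'] hub.prems hub.hyps by auto
  next
    case (path P ps zs')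
    then have "hd (flat ps @ zs') < 4 * n" using hub.prems by (intro hd_flat_less) (auto simp: bounded_family_def)
    moreover have "4 * n \<le> u" using hub by auto
    ultimately show ?thesis using path by (metis list.sel(1) not_le)
  qed
next
  case (path P C ps A zs)
  have P: "fst P \<subseteq> {..<n}" using path by (auto simp: bounded_family_def)
  from path.prems(1) show ?case
  proof (cases rule: arrangement.cases)
    case empty
    then show ?thesis using flat_less[OF path.hyps(2) P] by simp
  next
    case (hub u zs')
    then have "4 * n \<le> u" "u = hd (flat ps @ zs)" using path.prems by auto
    then show ?thesis using hd_flat_less[OF path.hyps(2) P, of zs] by simp
  next
    case (path P' ps' zs')
    note p = path
    have P': "fst P' \<subseteq> {..<n}" using p path.prems by (auto simp: bounded_family_def)
    have "flat ps = flat ps'" "zs = zs'"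
      using takeWhile_flat[OF path.hyps(2) P path.hyps(3)] takeWhile_flat[OF p(4) P' p(5)] path.prems(2) p(2) by metis+
    then have "P = P'" "zs = zs'" using words_unique path.hyps(2) p(4) by auto
    then have "C - {P} = C' - {P}"
      using path.IH[of False "C' - {P}"] p path.prems bounded_family_Diff by blast
    then show ?thesis using path.hyps(1) p(3) \<open>P = P'\<close> by auto
  qed
qed

text \<open>A single vertex has four words; a longer path has two directions and two choices per vertex.
  Both cases give the same formula, which is what the gadget is made for.\<close>

lemma card_words:
  assumes "distinct xs" "xs \<noteq> []"
  shows "card (words (path_pair xs)) = 2 ^ (length xs + 1)" "finite (words (path_pair xs))"
proof -
  define Q :: "nat set" where "Q = {q. q < 4 \<and> (2 \<le> length xs \<longrightarrow> odd q)}"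
  define Y where "Y = {ys. distinct ys \<and> path_pair ys = path_pair xs}"
  define Z where "Z = {qs. set qs \<subseteq> Q \<and> length qs = length xs}"
  have Yeq: "Y = {xs, rev xs}"
    using path_edges_eq_iff[OF assms(1)] assms(1) unfolding Y_def path_pair_def by auto
  have len: "length ys = length xs" if "ys \<in> Y" for ys using that Yeq by auto
  have words: "words (path_pair xs) = (\<lambda>(ys, qs). zip ys qs) ` (Y \<times> Z)"
  proof (intro set_eqI iffI)
    fix ps assume ps: "ps \<in> words (path_pair xs)"
    then have Y: "map fst ps \<in> Y" by (auto simp: words_def Y_def)
    then have "length ps = length xs" using len by fastforce
    then have "map snd ps \<in> Z" using ps by (auto simp: words_def Z_def Q_def)
    then show "ps \<in> (\<lambda>(ys, qs). zip ys qs) ` (Y \<times> Z)"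
      using Y by (intro image_eqI[of _ _ "(map fst ps, map snd ps)"]) (auto simp: zip_map_fst_snd)
  next
    fix ps assume "ps \<in> (\<lambda>(ys, qs). zip ys qs) ` (Y \<times> Z)"
    then obtain ys qs where p: "ps = zip ys qs" "ys \<in> Y" "qs \<in> Z" by auto
    then have l: "length ys = length qs" "length ys = length xs" using len Z_def by auto
    have m: "map fst ps = ys" "map snd ps = qs" "length ps = length xs" using p l by simp_all
    have "ps \<noteq> []" using m assms by auto
    then show "ps \<in> words (path_pair xs)" using p(2,3) unfolding words_def mem_Collect_eq m
      by (auto simp: Y_def Z_def Q_def)
  qed
  have inj: "inj_on (\<lambda>(ys, qs). zip ys qs) (Y \<times> Z)"
  proof (rule inj_onI, clarify)
    fix ys qs ys' qs' assume "ys \<in> Y" "qs \<in> Z" "ys' \<in> Y" "qs' \<in> Z" "zip ys qs = zip ys' qs'"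
    then show "ys = ys' \<and> qs = qs'" using len Z_def
      by (metis (mono_tags, lifting) map_fst_zip map_snd_zip mem_Collect_eq)
  qed
  have finQ: "finite Q" by (rule finite_subset[of _ "{..<4}"]) (auto simp: Q_def)
  then have finZ: "finite Z" unfolding Z_def by (rule finite_lists_length_eq)
  show "finite (words (path_pair xs))" unfolding words using Yeq finZ by auto
  have "card (words (path_pair xs)) = card Y * card Q ^ length xs"
    unfolding words card_image[OF inj] card_cartesian_product using finQ by (simp add: Z_def card_lists_length_eq)
  also have "\<dots> = 2 ^ (length xs + 1)"
  proof (cases "2 \<le> length xs")
    case True
    have "q < 4 \<and> odd q \<longleftrightarrow> q = 1 \<or> q = 3" for q :: nat by presburger
    then have "Q = {1, 3}" using True unfolding Q_def by auto
    then have "card Q = 2" by simp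
    moreover have "card Y = 2"
    proof -
      obtain a b bs where "xs = a # b # bs" using True by (cases xs; cases "tl xs") auto
      then have "xs \<noteq> rev xs" using assms(1)
        by (metis last_rev list.sel(1) last.simps last_in_set list.distinct(1) distinct.simps(2))
      then show ?thesis unfolding Yeq by simp
    qed
    ultimately show ?thesis by simp
  next
    case False
    then obtain a where a: "xs = [a]" using assms(2) by (cases xs; cases "tl xs") auto
    have "Q = {..<4}" using False unfolding Q_def by auto
    then show ?thesis using a Yeq by simp
  qed
  finally show "card (words (path_pair xs)) = 2 ^ (length xs + 1)" .
qed

lemma arrangement_split:
  assumes "A \<noteq> {} \<or> C \<noteq> {}"
  shows "{zs. arrangement True A C zs} = (\<Union>u\<in>A. Cons u ` {zs. arrangement True (A - {u}) C zs}) \<union>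
     (\<Union>P\<in>C. (\<lambda>(ps, zs). flat ps @ zs) ` (words P \<times> {zs. arrangement False A (C - {P}) zs}))" (is "?L = ?R")
    "{zs. arrangement False A C zs} = (\<Union>u\<in>A. Cons u ` {zs. arrangement True (A - {u}) C zs})" (is "?L' = ?R'")
proof -
  show "?L = ?R"
  proof (intro set_eqI iffI)
    fix zs assume "zs \<in> ?L"
    then have "arrangement True A C zs" by simp
    then show "zs \<in> ?R" by (cases rule: arrangement.cases) (use assms in force)+
  next
    fix zs assume "zs \<in> ?R"
    then show "zs \<in> ?L" by (auto intro: arrangement.hub arrangement.path)
  qed
  show "?L' = ?R'"
  proof (intro set_eqI iffI)
    fix zs assume "zs \<in> ?L'"
    then have "arrangement False A C zs" by simp
    then show "zs \<in> ?R'" by (cases rule: arrangement.cases) (use assms in auto)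
  next
    fix zs assume "zs \<in> ?R'"
    then show "zs \<in> ?L'" by (auto intro: arrangement.hub arrangement.path)
  qed
qed

lemma card_arrangement_hub:
  assumes "finite A" "\<And>u. u \<in> A \<Longrightarrow> finite {zs. arrangement True (A - {u}) C zs} \<and> card {zs. arrangement True (A - {u}) C zs} = m"
  shows "card (\<Union>u\<in>A. Cons u ` {zs. arrangement True (A - {u}) C zs}) = card A * m"
proof -
  have "card (\<Union>u\<in>A. Cons u ` {zs. arrangement True (A - {u}) C zs}) = (\<Sum>u\<in>A. card (Cons u ` {zs. arrangement True (A - {u}) C zs}))"
    using assms by (intro card_UN_disjoint) auto
  also have "\<dots> = (\<Sum>u\<in>A. m)" using assms by (intro sum.cong refl) (simp add: card_image)
  finally show ?thesis by simp
qed

lemma card_arrangement_path: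
  assumes "finite C" "bounded_family n C" "A \<subseteq> {4 * n..}" "\<And>P. P \<in> C \<Longrightarrow> finite (words P)"
    "\<And>P. P \<in> C \<Longrightarrow> finite {zs. arrangement False A (C - {P}) zs} \<and> card (words P) * card {zs. arrangement False A (C - {P}) zs} = m"
  shows "card (\<Union>P\<in>C. (\<lambda>(ps, zs). flat ps @ zs) ` (words P \<times> {zs. arrangement False A (C - {P}) zs})) = card C * m"
proof -
  let ?X = "\<lambda>P. (\<lambda>(ps, zs). flat ps @ zs) ` (words P \<times> {zs. arrangement False A (C - {P}) zs})"
  have uniq: "P = P' \<and> ps = ps' \<and> zs = zs'"
    if a: "P \<in> C" "P' \<in> C" "ps \<in> words P" "ps' \<in> words P'" "arrangement False A (C - {P}) zs"
      "arrangement False A (C - {P'}) zs'" "flat ps @ zs = flat ps' @ zs'" for P P' ps ps' zs zs'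
  proof -
    have "fst P \<subseteq> {..<n}" "fst P' \<subseteq> {..<n}" using assms(2) a by (auto simp: bounded_family_def)
    then have "flat ps = flat ps'" "zs = zs'"
      using takeWhile_flat[OF a(3) _ a(5) assms(3)] takeWhile_flat[OF a(4) _ a(6) assms(3)] a(7) by metis+
    then show ?thesis using words_unique a by blast
  qed
  have inj: "inj_on (\<lambda>(ps, zs). flat ps @ zs) (words P \<times> {zs. arrangement False A (C - {P}) zs})" if P: "P \<in> C" for P
  proof (rule inj_onI, clarify)
    fix ps zs ps' zs' assume "ps \<in> words P" "arrangement False A (C - {P}) zs" "ps' \<in> words P"
      "arrangement False A (C - {P}) zs'" "flat ps @ zs = flat ps' @ zs'"
    then show "ps = ps' \<and> zs = zs'" using uniq[OF P P] by blast
  qed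
  have "card (\<Union>P\<in>C. ?X P) = (\<Sum>P\<in>C. card (?X P))"
  proof (rule card_UN_disjoint)
    show "\<forall>P\<in>C. finite (?X P)" using assms by simp
    show "\<forall>P\<in>C. \<forall>P'\<in>C. P \<noteq> P' \<longrightarrow> ?X P \<inter> ?X P' = {}"
    proof (intro ballI impI equals0I)
      fix P P' z assume a: "P \<in> C" "P' \<in> C" "P \<noteq> P'" "z \<in> ?X P \<inter> ?X P'"
      then obtain ps zs ps' zs' where "ps \<in> words P" "arrangement False A (C - {P}) zs" "ps' \<in> words P'"
        "arrangement False A (C - {P'}) zs'" "flat ps @ zs = flat ps' @ zs'" by auto
      then show False using uniq a by blast
    qed
  qed (use assms in simp)
  also have "\<dots> = (\<Sum>P\<in>C. m)"
    using assms(5) by (intro sum.cong refl) (simp add: card_image[OF inj] card_cartesian_product)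
  finally show ?thesis by simp
qed

text \<open>The factors are the orders of the hubs, the injective placements of the paths into gaps,
  and the spellings of the paths. The gap before the first hub is available only if the flag is
  raised. Splitting by the first item gives Pascal's rule.\<close>

lemma card_arrangement:
  assumes "finite A" "finite C" "bounded_family n C" "A \<subseteq> {4 * n..}" "\<And>P. P \<in> C \<Longrightarrow> finite (words P)"
  shows "finite {zs. arrangement fr A C zs} \<and> card {zs. arrangement fr A C zs} =
    fact (card A) * fact (card C) * ((if fr then card A + 1 else card A) choose card C) * (\<Prod>P\<in>C. card (words P))"
  using assms
proof (induction "card A + card C" arbitrary: A C fr rule: less_induct)
  case less
  show ?case
  proof (cases "A = {} \<and> C = {}")
    case True
    have "{zs. arrangement fr {} {} zs} = {[]}" by (auto elim: arrangement.cases intro: arrangement.empty)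
    then show ?thesis using True by simp
  next
    case False
    define a where "a = card A"
    define c where "c = card C"
    define W where "W = (\<Prod>P\<in>C. card (words P))"
    let ?H = "\<Union>u\<in>A. Cons u ` {zs. arrangement True (A - {u}) C zs}"
    let ?P = "\<Union>P\<in>C. (\<lambda>(ps, zs). flat ps @ zs) ` (words P \<times> {zs. arrangement False A (C - {P}) zs})"
    have hub: "finite {zs. arrangement True (A - {u}) C zs} \<and> card {zs. arrangement True (A - {u}) C zs} =
       fact (a - 1) * fact c * (a choose c) * W" if u: "u \<in> A" for u
    proof -
      have ca: "card (A - {u}) = a - 1" "a \<noteq> 0" using u less.prems(1) unfolding a_def by auto
      have "finite {zs. arrangement True (A - {u}) C zs} \<and> card {zs. arrangement True (A - {u}) C zs} =
        fact (card (A - {u})) * fact (card C) * ((if True then card (A - {u}) + 1 else card (A - {u})) choose card C) * W"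
        unfolding W_def
        using card_Diff1_less[OF less.prems(1) u] less.prems by (intro less.hyps) (linarith | blast)+
      then show ?thesis using ca c_def by simp
    qed
    have path: "finite {zs. arrangement False A (C - {P}) zs} \<and> card (words P) * card {zs. arrangement False A (C - {P}) zs} =
       fact a * fact (c - 1) * (a choose (c - 1)) * W" if P: "P \<in> C" for P
    proof -
      have cc: "card (C - {P}) = c - 1" "c \<noteq> 0" using P less.prems(2) unfolding c_def by auto
      have W: "W = card (words P) * (\<Prod>P\<in>C - {P}. card (words P))"
        unfolding W_def using P less.prems(2) by (simp add: prod.remove)
      have "finite {zs. arrangement False A (C - {P}) zs} \<and> card {zs. arrangement False A (C - {P}) zs} =
        fact (card A) * fact (card (C - {P})) * ((if False then card A + 1 else card A) choose card (C - {P}))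
          * (\<Prod>P\<in>C - {P}. card (words P))"
        using card_Diff1_less[OF less.prems(2) P] less.prems bounded_family_Diff
        by (intro less.hyps) (linarith | blast)+
      then show ?thesis using cc a_def W by simp
    qed
    have finH: "finite ?H" and finP: "finite ?P" using hub path less.prems by simp_all
    have cH: "card ?H = a * (fact (a - 1) * fact c * (a choose c) * W)"
      unfolding a_def using hub less.prems by (intro card_arrangement_hub) (auto simp: a_def)
    \<comment> \<open>\<open>a * fact (a - 1) = fact a\<close> fails for \<open>a = 0\<close>, but
      then \<open>c\<close> is nonzero and \<open>0 choose c\<close> vanishes.\<close>
    have aH: "a * (fact (a - 1) * fact c * (a choose c) * W) = fact a * fact c * (a choose c) * W"
    proof (cases a)
      case 0
      then have "c \<noteq> 0" using False less.prems a_def c_def by auto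
      then show ?thesis using 0 by (cases c) auto
    qed (simp add: algebra_simps)
    have cP: "card ?P = c * (fact a * fact (c - 1) * (a choose (c - 1)) * W)"
      unfolding c_def using path less.prems by (intro card_arrangement_path[of C n]) (auto simp: c_def)
    have aP: "c * (fact a * fact (c - 1) * (a choose (c - 1)) * W) = fact a * fact c * (if c = 0 then 0 else a choose (c - 1)) * W"
      by (cases c) (auto simp: algebra_simps)
    have disj: "?H \<inter> ?P = {}"
    proof (intro equals0I)
      fix z assume "z \<in> ?H \<inter> ?P"
      then obtain u zs where z1: "u \<in> A" "z = u # zs" by blast
      from \<open>z \<in> ?H \<inter> ?P\<close> obtain P ps zs' where "P \<in> C" "ps \<in> words P" "z = flat ps @ zs'" by auto
      note z = z1 this
      then have "hd z < 4 * n" using less.prems(3) hd_flat_less[of ps P n zs'] by (auto simp: bounded_family_def)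
      then show False using z less.prems(4) by auto
    qed
    have "A \<noteq> {} \<or> C \<noteq> {}" using False by blast
    note sp = arrangement_split[OF this]
    have pascal: "(a choose c) + (if c = 0 then 0 else a choose (c - 1)) = (a + 1) choose c"
      by (cases c) auto
    show ?thesis
    proof (cases fr)
      case True
      have "card {zs. arrangement True A C zs} = fact a * fact c * (a choose c) * W +
          fact a * fact c * (if c = 0 then 0 else a choose (c - 1)) * W"
        unfolding sp(1) card_Un_disjoint[OF finH finP disj] cH aH cP aP ..
      also have "\<dots> = fact a * fact c * ((a + 1) choose c) * W"
        unfolding pascal[symmetric] by (simp add: algebra_simps)
      finally show ?thesis using True finH finP unfolding sp(1)[symmetric] a_def c_def W_def
        by (simp add: sp(1))
    next
      case False
      have "card {zs. arrangement False A C zs} = fact a * fact c * (a choose c) * W"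
        unfolding sp(2) cH aH ..
      then show ?thesis using False finH unfolding a_def c_def W_def by (simp add: sp(2))
    qed
  qed
qed

section \<open>Counting by path covers\<close>

lemma path_familyD:
  assumes "path_family E C S"
  shows "\<And>P. P \<in> C \<Longrightarrow> fst P \<subseteq> S"
    "\<And>P. P \<in> C \<Longrightarrow> snd P \<subseteq> E"
    "\<And>P. P \<in> C \<Longrightarrow> \<exists>xs. xs \<noteq> [] \<and> distinct xs \<and> P = path_pair xs"
proof -
  note a = assms[unfolded path_family_def]
  show "fst P \<subseteq> S" if "P \<in> C" for P using a that by auto
  show "snd P \<subseteq> E" if P: "P \<in> C" for P
  proof -
    obtain xs where "path_edges xs \<subseteq> E" "P = path_pair xs" using a P by meson
    then show ?thesis by (simp add: path_pair_def)
  qed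
  show "\<exists>xs. xs \<noteq> [] \<and> distinct xs \<and> P = path_pair xs" if "P \<in> C" for P using a that by meson
qed

lemma parity_last_block: "q < 4 \<Longrightarrow> odd (last (block v q)) \<longleftrightarrow> odd q"
proof -
  assume "q < 4"
  then have "q = 0 \<or> q = 1 \<or> q = 2 \<or> q = 3" by auto
  then show ?thesis by (elim disjE) (simp_all add: block_def)
qed

lemma last_block_div4: "last (block v q) div 4 = v"
  by (intro block_div4[of _ v q] last_in_set) simp

lemma hd_block: "q < 4 \<Longrightarrow> hd (block v q @ zs) = 4 * v + q"
  using block_Cons[of q v] by auto

lemma words_Cons:
  assumes "(v, q) # ps \<in> words P"
  shows "q < 4" "v \<in> fst P"
  using assms by (auto simp: words_def path_pair_def)

text \<open>Consecutive vertices of the path are adjacent in the graph and their blocks have odd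
  ends, which are the two conditions of a link; the last block meets a hub or the end.\<close>

lemma blocked_flat:
  assumes "blocked n E zs" "zs = [] \<or> 4 * n \<le> hd zs"
    "\<forall>(v, q)\<in>set ps. v < n \<and> q < 4 \<and> (2 \<le> length ps \<longrightarrow> odd q)" "path_edges (map fst ps) \<subseteq> E"
  shows "blocked n E (flat ps @ zs)"
  using assms(3,4)
proof (induction ps)
  case Nil
  then show ?case using assms(1) by simp
next
  case (Cons p ps)
  obtain v q where p: "p = (v, q)" by fastforce
  have vq: "v < n" "q < 4" using Cons.prems p by auto
  show ?case
  proof (cases ps)
    case Nil
    then show ?thesis using p vq assms(1,2) by (auto simp: link_def intro: blocked.block)
  next
    case (Cons p' ps')
    obtain v' q' where p': "p' = (v', q')" by fastforce
    have "q' < 4" "odd q" "odd q'" "{v, v'} \<in> E" using Cons.prems p p' Cons by auto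
    moreover have "blocked n E (flat ps @ zs)" using Cons.IH Cons.prems Cons by auto
    moreover have "hd (flat ps @ zs) = 4 * v' + q'" using hd_block[OF \<open>q' < 4\<close>] Cons p' by simp
    ultimately have "link n E (last (block v q)) (flat ps @ zs)"
      using vq by (simp add: link_def parity_last_block last_block_div4)
    then show ?thesis using p vq \<open>blocked n E (flat ps @ zs)\<close> by (auto intro: blocked.block)
  qed
qed

lemma arrangement_blocked:
  assumes "arrangement fr A C zs" "path_family E C S" "S \<subseteq> {..<n}" "A \<subseteq> {4 * n..}"
  shows "blocked n E zs \<and> distinct zs \<and> set zs = A \<union> (\<Union>v\<in>S. set (block v 0))"
  using assms
proof (induction arbitrary: S)
  case (empty fr)
  then have "S = {}" by (simp add: path_family_def)
  then show ?case by (simp add: blocked.Nil)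
next
  case (hub u A C zs fr)
  then have IH: "blocked n E zs" "distinct zs" "set zs = A - {u} \<union> (\<Union>v\<in>S. set (block v 0))"
    by blast+
  have "4 * n \<le> u" using hub by auto
  moreover have "u \<notin> (\<Union>v\<in>S. set (block v 0))"
  proof
    assume "u \<in> (\<Union>v\<in>S. set (block v 0))"
    then obtain v where "v \<in> S" "u div 4 = v" using block_div4 by blast
    moreover from this have "v < n" using hub by auto
    ultimately show False using \<open>4 * n \<le> u\<close> by linarith
  qed
  ultimately show ?case using IH hub.hyps(1) by (auto intro: blocked.hub)
next
  case (path P C ps A zs)
  have P: "fst P \<subseteq> S" "snd P \<subseteq> E" using path_familyD[OF path.prems(1) path.hyps(1)] by auto
  have w: "path_pair (map fst ps) = P" "distinct (map fst ps)" "\<forall>q\<in>set (map snd ps). q < 4 \<and> (2 \<le> length ps \<longrightarrow> odd q)"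
    using path.hyps(2) by (auto simp: words_def)
  have fst_ps: "set (map fst ps) = fst P" "path_edges (map fst ps) = snd P"
    using w(1) unfolding path_pair_def by (metis fst_conv, metis snd_conv)
  have "path_family E (C - {P}) (S - fst P)" using path_family_remove path.prems path.hyps by blast
  then have IH: "blocked n E zs" "distinct zs" "set zs = A \<union> (\<Union>v\<in>S - fst P. set (block v 0))"
    using path.IH[of "S - fst P"] path.prems by blast+
  have "zs = [] \<or> 4 * n \<le> hd zs" using arrangement_False_hd[OF path.hyps(3)] path.prems by auto
  moreover have "\<forall>(v, q)\<in>set ps. v < n \<and> q < 4 \<and> (2 \<le> length ps \<longrightarrow> odd q)"
  proof (clarify)
    fix v q assume vq: "(v, q) \<in> set ps"
    then have "v \<in> set (map fst ps)" "q \<in> set (map snd ps)" by force+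
    then show "v < n \<and> q < 4 \<and> (2 \<le> length ps \<longrightarrow> odd q)" using w(3) fst_ps P path.prems(2) by blast
  qed
  ultimately have "blocked n E (flat ps @ zs)" using IH(1) fst_ps P by (intro blocked_flat) auto
  moreover have "distinct (flat ps)"
    using w(2)
  proof (induction ps)
    case (Cons p ps)
    obtain v q where p: "p = (v, q)" by fastforce
    have "set (block v q) \<inter> set (flat ps) = {}"
    proof (intro equals0I)
      fix x assume "x \<in> set (block v q) \<inter> set (flat ps)"
      then obtain v' where v': "v' \<in> set (map fst ps)" "x \<in> set (block v' 0)" "x \<in> set (block v q)"
        unfolding set_flat by blast
      then have "v = v'" using block_div4 by metis
      then show False using Cons.prems p v' by simp
    qed
    moreover have "distinct (block v q)" by (simp add: block_def)
    ultimately show ?case using Cons p by auto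
  qed simp
  moreover have sf: "set (flat ps) = (\<Union>v\<in>fst P. set (block v 0))" unfolding set_flat fst_ps ..
  moreover have "set (flat ps) \<inter> set zs = {}"
  proof (intro equals0I)
    fix x assume "x \<in> set (flat ps) \<inter> set zs"
    then obtain v where v: "v \<in> fst P" "x \<in> set (block v 0)" "x \<in> set zs" unfolding sf by blast
    then have "x div 4 = v" using block_div4 by blast
    moreover have "v < n" using v P path.prems by blast
    ultimately have "x < 4 * n" by linarith
    then have "x \<notin> A" using path.prems by auto
    then obtain v' where "v' \<in> S - fst P" "x div 4 = v'" using v(3) IH(3) block_div4 by blast
    then show False using \<open>x div 4 = v\<close> v by blast
  qed
  moreover have "set (flat ps @ zs) = A \<union> (\<Union>v\<in>S. set (block v 0))"
    unfolding set_append sf IH(3) using P(1) by blast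
  ultimately show ?case using IH(2) by simp
qed

text \<open>A list that begins with a hub makes no use of the raised flag, so it may also stand
  behind a path.\<close>

lemma arrangement_hub_start:
  assumes "arrangement True A C xs" "xs = [] \<or> 4 * n \<le> hd xs" "bounded_family n C"
  shows "arrangement False A C xs"
  using assms(1)
proof (cases rule: arrangement.cases)
  case empty
  then show ?thesis by (simp add: arrangement.empty)
next
  case (hub u zs)
  then show ?thesis by (simp add: arrangement.hub)
next
  case (path P ps zs)
  then have "fst P \<subseteq> {..<n}" using assms(3) by (auto simp: bounded_family_def)
  then have "hd xs < 4 * n" "xs \<noteq> []" using hd_flat_less[OF path(3)] flat_less(2)[OF path(3)] path(1) by auto
  then show ?thesis using assms(2) by auto
qed

text \<open>The cover is read off from right to left. A block before a hub, or at the end, opens a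
  path with one vertex; a block before another block prolongs the path of the latter at its
  front.\<close>

lemma blocked_arrangement:
  assumes "blocked n E xs" "distinct xs"
  shows "\<exists>C. arrangement True (set xs \<inter> {4 * n..}) C xs \<and> path_family E C {v. v < n \<and> 4 * v \<in> set xs}"
  using assms
proof (induction)
  case Nil
  show ?case by (intro exI[of _ "{}"]) (auto simp: path_family_def intro: arrangement.empty)
next
  case (hub u xs)
  then obtain C where C: "arrangement True (set xs \<inter> {4 * n..}) C xs" "path_family E C {v. v < n \<and> 4 * v \<in> set xs}"
    by auto
  have "set (u # xs) \<inter> {4 * n..} - {u} = set xs \<inter> {4 * n..}" using hub by auto
  moreover have "{v. v < n \<and> 4 * v \<in> set (u # xs)} = {v. v < n \<and> 4 * v \<in> set xs}" using hub by auto
  ultimately show ?case using C arrangement.hub[of u "set (u # xs) \<inter> {4 * n..}" C xs True] hub by auto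
next
  case (block v q xs)
  let ?A = "set xs \<inter> {4 * n..}"
  let ?S = "{v. v < n \<and> 4 * v \<in> set xs}"
  obtain C where C: "arrangement True ?A C xs" "path_family E C ?S" using block by auto
  have lt: "x < 4 * n" if "x \<in> set (block v q)" for x
  proof -
    have "x div 4 = v" using that by (rule block_div4)
    then show ?thesis using block.hyps(1) by linarith
  qed
  then have A: "set (block v q @ xs) \<inter> {4 * n..} = ?A" by fastforce
  have vin: "4 * v \<in> set (block v q)" by (simp add: block_sets)
  then have vS: "v \<notin> ?S" using block.prems by auto
  have "{v'. v' < n \<and> 4 * v' \<in> set (block v q)} = {v}"
    using vin block.hyps(1) by (auto dest: block_div4)
  then have S: "{v'. v' < n \<and> 4 * v' \<in> set (block v q @ xs)} = insert v ?S" by auto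
  have bf: "bounded_family n C" using path_familyD(1)[OF C(2)] by (auto simp: bounded_family_def)
  have Sfst: "\<And>P. P \<in> C \<Longrightarrow> fst P \<subseteq> ?S" using path_familyD(1)[OF C(2)] .
  show ?case
  proof (cases "xs = [] \<or> 4 * n \<le> hd xs")
    case True
    have "arrangement False ?A C xs" using arrangement_hub_start[OF C(1) True bf] .
    let ?P = "path_pair [v]"
    have "?P \<notin> C" using Sfst vS by (fastforce simp: path_pair_def)
    then have "insert ?P C - {?P} = C" by auto
    moreover have "[(v, q)] \<in> words ?P" using block.hyps by (auto simp: words_def)
    ultimately have "arrangement True ?A (insert ?P C) (flat [(v, q)] @ xs)"
      using \<open>arrangement False ?A C xs\<close> arrangement.path[of ?P "insert ?P C" "[(v, q)]" ?A xs] by simp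
    moreover have "path_family E (insert ?P C) (set [v] \<union> ?S)"
      using C(2) vS by (intro path_family_insert) auto
    ultimately show ?thesis unfolding A S by (intro exI[of _ "insert ?P C"]) simp
  next
    case False
    have "\<exists>P ps zs. xs = flat ps @ zs \<and> P \<in> C \<and> ps \<in> words P \<and> arrangement False ?A (C - {P}) zs"
      using C(1)
    proof (cases rule: arrangement.cases)
      case (hub u zs)
      have "4 * n \<le> u" using hub(2) by simp
      then show ?thesis using False hub(1) by simp
    next
      case (path P ps zs)
      then show ?thesis by blast
    qed (use False in simp)
    then obtain P ps zs where p: "xs = flat ps @ zs" "P \<in> C" "ps \<in> words P" "arrangement False ?A (C - {P}) zs"
      by blast
    obtain v1 q1 ps' where ps: "ps = (v1, q1) # ps'"
      using p(3) by (cases ps) (auto simp: words_def)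
    have w: "q1 < 4" "v1 \<in> fst P" using words_Cons p(3) ps by blast+
    have w2: "path_pair (map fst ps) = P" "distinct (map fst ps)" "\<forall>q\<in>set (map snd ps). q < 4 \<and> (2 \<le> length ps \<longrightarrow> odd q)"
      using p(3) by (auto simp: words_def)
    have fst_ps: "set (map fst ps) = fst P" "path_edges (map fst ps) = snd P"
      using w2(1) unfolding path_pair_def by (metis fst_conv, metis snd_conv)
    have hd: "hd xs = 4 * v1 + q1" using hd_block[OF w(1)] p(1) ps by simp
    have "\<not> 4 * n \<le> last (block v q)" using lt[of "last (block v q)"] by simp
    then have "{v, (4 * v1 + q1) div 4} \<in> E" "odd (last (block v q))" "odd (4 * v1 + q1)"
      using block.hyps(4) False hd unfolding link_def last_block_div4 by auto
    then have e: "{v, v1} \<in> E" "odd q" "odd q1" using w(1) parity_last_block[OF block.hyps(2)] by auto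
    let ?xs = "v # map fst ps"
    let ?P = "path_pair ?xs"
    have vP: "v \<notin> fst P" using vS Sfst p(2) by blast
    \<comment> \<open>If \<open>ps\<close> is a single block, its parity was free until now; the
      link from the new block makes it odd, as the longer word requires.\<close>
    have odd: "\<forall>q\<in>set (map snd ps). q < 4 \<and> odd q"
      using w2(3) e ps by (cases ps') auto
    then have word: "(v, q) # ps \<in> words ?P"
      using block.hyps(2) e w2(2) vP fst_ps unfolding words_def by auto
    have "?P \<notin> C" using Sfst[of ?P] vS by (auto simp: path_pair_def)
    then have "insert ?P (C - {P}) - {?P} = C - {P}" by auto
    then have "arrangement True ?A (insert ?P (C - {P})) (flat ((v, q) # ps) @ zs)"
      using p(4) word arrangement.path[of ?P "insert ?P (C - {P})" "(v, q) # ps" ?A zs] by simp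
    moreover have "path_family E (insert ?P (C - {P})) (set ?xs \<union> (?S - fst P))"
    proof (intro path_family_insert path_family_remove C(2) p(2))
      show "path_edges ?xs \<subseteq> E"
        using path_familyD(2)[OF C(2) p(2)] fst_ps(2) e ps by auto
      show "distinct ?xs" using w2(2) vP fst_ps by auto
      show "set ?xs \<inter> (?S - fst P) = {}" using fst_ps vS by auto
    qed simp
    moreover have "set ?xs \<union> (?S - fst P) = insert v ?S" using fst_ps Sfst[OF p(2)] by auto
    ultimately show ?thesis unfolding A S using p(1) by (intro exI[of _ "insert ?P (C - {P})"]) simp
  qed
qed

text \<open>Paths are nonempty, so disjointness makes \<open>fst\<close> injective on the
  family.\<close>

lemma path_family_card:
  assumes "path_family E C S" "finite S"
  shows "finite C" "(\<Sum>P\<in>C. card (fst P)) = card S"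
proof -
  have inj: "inj_on fst C"
  proof (rule inj_onI)
    fix P Q assume PQ: "P \<in> C" "Q \<in> C" "fst P = fst Q"
    obtain xs where "xs \<noteq> []" "P = path_pair xs" using path_familyD(3)[OF assms(1) PQ(1)] by blast
    then have "fst P \<noteq> {}" by (simp add: path_pair_def)
    then show "P = Q" using PQ assms(1) unfolding path_family_def by (metis inf.idem)
  qed
  have "fst ` C \<subseteq> Pow S" using path_familyD(1)[OF assms(1)] by auto
  then have "finite (fst ` C)" using assms(2) finite_subset by blast
  then show fin: "finite C" using inj by (simp add: finite_image_iff)
  have "card (\<Union>P\<in>C. fst P) = (\<Sum>P\<in>C. card (fst P))"
  proof (rule card_UN_disjoint)
    show "\<forall>P\<in>C. finite (fst P)" using path_familyD(1)[OF assms(1)] assms(2) finite_subset by blast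
  qed (use fin assms(1) in \<open>simp_all add: path_family_def\<close>)
  then show "(\<Sum>P\<in>C. card (fst P)) = card S" using assms(1) by (simp add: path_family_def)
qed

lemma finite_path_covers: "finite {C. path_cover {0..<n :: nat} E C}"
proof (rule finite_subset)
  show "{C. path_cover {0..<n} E C} \<subseteq> Pow (Pow {0..<n} \<times> Pow (Pow {0..<n}))"
  proof (intro subsetI PowI)
    fix C P assume "C \<in> {C. path_cover {0..<n} E C}" "P \<in> C"
    then have f: "path_family E C {0..<n}" by (simp add: path_cover_iff)
    obtain xs where xs: "P = path_pair xs" using path_familyD(3)[OF f \<open>P \<in> C\<close>] by blast
    have "set xs \<subseteq> {0..<n}" using path_familyD(1)[OF f \<open>P \<in> C\<close>] xs by (simp add: path_pair_def)
    then show "P \<in> Pow {0..<n} \<times> Pow (Pow {0..<n})"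
      unfolding xs path_pair_def using path_edges_subset by fastforce
  qed
qed simp

text \<open>The exponents \<open>m + 1\<close> add up to the number of vertices plus the number of
  paths. The shape of a cover has disappeared; only its size counts.\<close>

lemma prod_words:
  assumes "path_family E C {0..<n}"
  shows "(\<Prod>P\<in>C. card (words P)) = 2 ^ (n + card C)"
proof -
  have "card (words P) = 2 ^ (card (fst P) + 1)" if "P \<in> C" for P
  proof -
    obtain xs where "xs \<noteq> []" "distinct xs" "P = path_pair xs" using path_familyD(3)[OF assms \<open>P \<in> C\<close>] by blast
    then show ?thesis using card_words[of xs] by (simp add: path_pair_def distinct_card)
  qed
  then have "(\<Prod>P\<in>C. card (words P)) = (\<Prod>P\<in>C. 2 ^ (card (fst P) + 1))" by simp
  also have "\<dots> = 2 ^ (\<Sum>P\<in>C. card (fst P) + 1)" by (rule power_sum[symmetric])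
  also have "(\<Sum>P\<in>C. card (fst P) + 1) = n + card C"
    using path_family_card(2)[OF assms] unfolding sum.distrib by simp
  finally show ?thesis .
qed

context tsp_instance
begin

text \<open>The root stands before the list, so the first gap is open and the remaining
  \<open>k - 1\<close> hubs leave \<open>k\<close> gaps.\<close>

lemma rooted_arrangement:
  "rooted = (\<Union>C\<in>{C. path_cover {0..<n} E C}. {xs. arrangement True {4 * n + 1..<4 * n + k} C xs})"
proof (intro set_eqI iffI)
  fix xs assume "xs \<in> rooted"
  then have xs: "blocked n E xs" "distinct xs" "set xs = V - {4 * n}" by (auto simp: rooted_def)
  have 1: "set xs \<inter> {4 * n..} = {4 * n + 1..<4 * n + k}" unfolding xs(3) by auto
  have 2: "{v. v < n \<and> 4 * v \<in> set xs} = {0..<n}" unfolding xs(3) by auto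
  show "xs \<in> (\<Union>C\<in>{C. path_cover {0..<n} E C}. {xs. arrangement True {4 * n + 1..<4 * n + k} C xs})"
    using blocked_arrangement[OF xs(1,2)] unfolding 1 2 path_cover_iff by blast
next
  fix xs assume "xs \<in> (\<Union>C\<in>{C. path_cover {0..<n} E C}. {xs. arrangement True {4 * n + 1..<4 * n + k} C xs})"
  then obtain C where C: "path_family E C {0..<n}" "arrangement True {4 * n + 1..<4 * n + k} C xs"
    unfolding path_cover_iff by blast
  have "blocked n E xs \<and> distinct xs \<and> set xs = {4 * n + 1..<4 * n + k} \<union> (\<Union>v\<in>{0..<n}. set (block v 0))"
    by (rule arrangement_blocked[OF C(2,1)]) auto
  moreover have "(\<Union>v\<in>{0..<n}. set (block v 0)) = {0..<4 * n}"
  proof (intro set_eqI iffI)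
    fix x assume "x \<in> {0..<4 * n}"
    then have "x div 4 \<in> {0..<n}" "x \<in> set (block (x div 4) 0)" using div4_in[of x] by (auto simp: block_sets)
    then show "x \<in> (\<Union>v\<in>{0..<n}. set (block v 0))" by blast
  qed (auto dest!: block_div4)
  ultimately have a: "blocked n E xs" "distinct xs" "set xs = {4 * n + 1..<4 * n + k} \<union> {0..<4 * n}" by simp_all
  have "{4 * n + 1..<4 * n + k} \<union> {0..<4 * n} = V - {4 * n}" by auto
  then show "xs \<in> rooted" using a by (simp add: rooted_def)
qed

lemma card_rooted_sum:
  "card rooted = (\<Sum>C\<in>{C. path_cover {0..<n} E C}. fact (k - 1) * fact (card C) * (k choose card C) * 2 ^ (n + card C))"
proof -
  let ?A = "{4 * n + 1..<4 * n + k}"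
  have one: "finite {xs. arrangement True ?A C xs} \<and> card {xs. arrangement True ?A C xs} =
     fact (k - 1) * fact (card C) * (k choose card C) * 2 ^ (n + card C)" if C: "path_family E C {0..<n}" for C
  proof -
    have k: "k - 1 + 1 = k" using n_pos n_le_k by simp
    have "finite {xs. arrangement True ?A C xs} \<and> card {xs. arrangement True ?A C xs} =
      fact (card ?A) * fact (card C) * ((if True then card ?A + 1 else card ?A) choose card C) * (\<Prod>P\<in>C. card (words P))"
    proof (rule card_arrangement)
      show "finite C" using path_family_card[OF C] by simp
      show "bounded_family n C" using path_familyD(1)[OF C] by (fastforce simp: bounded_family_def)
      show "finite (words P)" if "P \<in> C" for P
        using path_familyD(3)[OF C that] card_words(2) by blast
    qed auto
    then show ?thesis using k prod_words[OF C] by simp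
  qed
  have bf: "bounded_family n C" if C: "path_family E C {0..<n}" for C
    using path_familyD(1)[OF C] by (fastforce simp: bounded_family_def)
  have "card rooted = (\<Sum>C\<in>{C. path_cover {0..<n} E C}. card {xs. arrangement True ?A C xs})"
    unfolding rooted_arrangement
  proof (rule card_UN_disjoint)
    show "\<forall>C\<in>{C. path_cover {0..<n} E C}. \<forall>D\<in>{C. path_cover {0..<n} E C}. C \<noteq> D \<longrightarrow>
      {xs. arrangement True ?A C xs} \<inter> {xs. arrangement True ?A D xs} = {}"
    proof (intro ballI impI equals0I)
      fix C D xs assume a: "C \<in> {C. path_cover {0..<n} E C}" "D \<in> {C. path_cover {0..<n} E C}" "C \<noteq> D"
        "xs \<in> {xs. arrangement True ?A C xs} \<inter> {xs. arrangement True ?A D xs}"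
      then have "path_family E C {0..<n}" "path_family E D {0..<n}" "arrangement True ?A C xs" "arrangement True ?A D xs"
        by (simp_all add: path_cover_iff)
      then have "C = D" using bf by (intro arrangement_unique[of True ?A C xs True D n]) auto
      then show False using a by simp
    qed
    show "\<forall>C\<in>{C. path_cover {0..<n} E C}. finite {xs. arrangement True ?A C xs}" using one path_cover_iff by blast
  qed (rule finite_path_covers)
  also have "\<dots> = (\<Sum>C\<in>{C. path_cover {0..<n} E C}. fact (k - 1) * fact (card C) * (k choose card C) * 2 ^ (n + card C))"
    by (intro sum.cong refl) (use one in \<open>simp add: path_cover_iff\<close>)
  finally show ?thesis .
qed

text \<open>The coefficient of \<open>x choose j\<close> in the polynomial that is sampled at
  \<open>x = k - 1\<close>. The index is \<open>j = l - 1\<close> because covers have at least one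
  path.\<close>

definition cover_coeff :: "nat \<Rightarrow> nat" where
  "cover_coeff j = num_path_covers {0..<n} E (j + 1) * 2 ^ j * fact j"

lemma card_cover_bounds:
  assumes "path_cover {0..<n} E C"
  shows "1 \<le> card C" "card C \<le> n"
proof -
  have C: "path_family E C {0..<n}" using assms by (simp add: path_cover_iff)
  note fam = path_family_card[OF C]
  have "C \<noteq> {}" using C n_pos by (auto simp: path_family_def)
  then show "1 \<le> card C" using fam by (simp add: Suc_le_eq card_gt_0_iff)
  have "card (fst P) \<ge> 1" if "P \<in> C" for P
  proof -
    obtain xs where "xs \<noteq> []" "P = path_pair xs" using path_familyD(3)[OF C \<open>P \<in> C\<close>] by blast
    then show ?thesis by (simp add: path_pair_def Suc_le_eq card_gt_0_iff)
  qed
  then have "(\<Sum>P\<in>C. 1) \<le> (\<Sum>P\<in>C. card (fst P))" by (intro sum_mono) auto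
  then show "card C \<le> n" using fam by simp
qed

text \<open>\<open>l * (k choose l) = k * ((k - 1) choose (l - 1))\<close> moves the dependence on
  \<open>k\<close> into one binomial coefficient. The factor \<open>k\<close> completes
  \<open>fact (k - 1)\<close> to \<open>fact k\<close>, and one factor 2 of
  \<open>2 ^ (n + l)\<close> cancels against the two directions of a tour.\<close>

lemma f_two_opt_eq:
  "f_two_opt V w = fact k * 2 ^ n * (\<Sum>j<n. cover_coeff j * ((k - 1) choose j))"
proof -
  let ?PC = "{C. path_cover {0..<n} E C}"
  let ?g = "\<lambda>l. fact (k - 1) * fact l * (k choose l) * 2 ^ (n + l) :: nat"
  have "2 * f_two_opt V w = (\<Sum>C\<in>?PC. ?g (card C))" using card_rooted card_rooted_sum by simp
  also have "\<dots> = (\<Sum>l\<in>{1..n}. \<Sum>C\<in>{C \<in> ?PC. card C = l}. ?g (card C))"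
    using card_cover_bounds by (intro sum.group[symmetric] finite_path_covers) auto
  also have "\<dots> = (\<Sum>l\<in>{1..n}. num_path_covers {0..<n} E l * ?g l)"
    by (intro sum.cong refl) (simp add: num_path_covers_def)
  also have "\<dots> = (\<Sum>j<n. num_path_covers {0..<n} E (j + 1) * ?g (j + 1))"
    by (rule sum.reindex_bij_witness[of _ "\<lambda>j. j + 1" "\<lambda>l. l - 1"]) auto
  also have "\<dots> = (\<Sum>j<n. 2 * (fact k * 2 ^ n * (cover_coeff j * ((k - 1) choose j))))"
  proof (intro sum.cong refl)
    fix j
    obtain k' where k': "k = Suc k'" using n_pos n_le_k by (cases k) auto
    have "Suc j * (Suc k' choose Suc j) = Suc k' * (k' choose j)" using Suc_times_binomial_eq[of k' j] by (simp only: mult.commute)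
    then have "fact (Suc j) * (Suc k' choose Suc j) = fact j * (Suc k' * (k' choose j))"
      by (metis fact_Suc mult.assoc mult.commute of_nat_id)
    then have "fact k' * fact (Suc j) * (Suc k' choose Suc j) * 2 ^ (n + Suc j)
       = fact k' * (fact j * (Suc k' * (k' choose j))) * 2 ^ (n + Suc j)" by (simp only: mult.assoc)
    also have "\<dots> = 2 * (fact (Suc k') * 2 ^ n * (2 ^ j * fact j * (k' choose j)))"
      by (simp add: power_add algebra_simps)
    finally show "num_path_covers {0..<n} E (j + 1) * ?g (j + 1) = 2 * (fact k * 2 ^ n * (cover_coeff j * ((k - 1) choose j)))"
      unfolding cover_coeff_def k' by (simp only: diff_Suc_1 Suc_eq_plus1[symmetric]) (simp only: mult_ac)
  qed
  also have "\<dots> = 2 * (fact k * 2 ^ n * (\<Sum>j<n. cover_coeff j * ((k - 1) choose j)))"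
    by (simp only: sum_distrib_left)
  finally show ?thesis by simp
qed

text \<open>A crude count of vertex sequences, enough to give the oracle answers polynomially many
  bits.\<close>

lemma f_two_opt_le: "f_two_opt V w \<le> (4 * n + k) ^ (4 * n + k)"
proof -
  have "{T. two_optimal V w T} \<subseteq> cycle_edges ` {zs. set zs \<subseteq> V \<and> length zs = 4 * n + k}"
  proof
    fix T assume "T \<in> {T. two_optimal V w T}"
    then have "tour V T" by (simp add: two_optimal_def)
    then obtain xs where "distinct xs" "set xs = V - {4 * n}" "T = cycle_edges (4 * n # xs)" by (rule tour_rooted)
    then show "T \<in> cycle_edges ` {zs. set zs \<subseteq> V \<and> length zs = 4 * n + k}"
      using rooted_cycle[of xs] by blast
  qed
  moreover have fin: "finite {zs. set zs \<subseteq> V \<and> length zs = 4 * n + k}" by (rule finite_lists_length_eq) simp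
  ultimately have "f_two_opt V w \<le> card {zs. set zs \<subseteq> V \<and> length zs = 4 * n + k}"
    unfolding f_two_opt_def using surj_card_le by blast
  then show ?thesis by (simp add: card_lists_length_eq)
qed

end

section \<open>Difference tables and running times\<close>

text \<open>The \<open>a\<close>-th forward difference at \<open>x\<close> of the polynomial with
  coefficients \<open>c\<close> in the basis \<open>x choose m\<close>; one difference turns
  \<open>x choose m\<close> into \<open>x choose (m - 1)\<close>.\<close>

definition diff_table :: "(nat \<Rightarrow> nat) \<Rightarrow> nat \<Rightarrow> nat \<Rightarrow> nat \<Rightarrow> nat" where
  "diff_table c n a x = (\<Sum>m<n. if a \<le> m then c m * (x choose (m - a)) else 0)"

lemma diff_table_Suc: "diff_table c n a (Suc x) = diff_table c n a x + diff_table c n (Suc a) x"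
  unfolding diff_table_def sum.distrib[symmetric]
proof (intro sum.cong refl)
  fix m
  show "(if a \<le> m then c m * (Suc x choose (m - a)) else 0) =
    (if a \<le> m then c m * (x choose (m - a)) else 0) + (if Suc a \<le> m then c m * (x choose (m - Suc a)) else 0)"
  proof (cases "Suc a \<le> m")
    case True
    then have "m - a = Suc (m - Suc a)" by simp
    then show ?thesis using True by (simp add: algebra_simps)
  qed (auto simp: not_less_eq_eq le_antisym)
qed

lemma diff_table_diff: "int (diff_table c n a (Suc x)) - int (diff_table c n a x) = int (diff_table c n (Suc a) x)"
  by (simp add: diff_table_Suc)

lemma diff_table_0: "a < n \<Longrightarrow> diff_table c n a 0 = c a"
proof -
  assume a: "a < n"
  have "diff_table c n a 0 = (\<Sum>m<n. if m = a then c m else 0)"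
    unfolding diff_table_def by (intro sum.cong refl) (auto simp: binomial_eq_0)
  then show ?thesis using a by simp
qed

text \<open>The degree is less than \<open>n\<close>, so this difference is constant. It is the
  known entry from which the table is continued downwards.\<close>

lemma diff_table_last: "diff_table c n (n - 1) x = diff_table c n (n - 1) y"
  unfolding diff_table_def by (intro sum.cong refl) auto

lemma diff_table_mono: "x \<le> y \<Longrightarrow> diff_table c n a x \<le> diff_table c n a y"
  by (induction y) (auto simp: le_Suc_eq diff_table_Suc)

text \<open>All entries are nonnegative, so a difference is at most the larger of the two values.
  Hence bounds for the sampled values are bounds for the whole table.\<close>

lemma diff_table_le: "diff_table c n a x \<le> diff_table c n 0 (x + a)"
proof (induction a arbitrary: x)
  case (Suc a)
  have "diff_table c n (Suc a) x \<le> diff_table c n a (Suc x)" by (simp add: diff_table_Suc)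
  also have "\<dots> \<le> diff_table c n 0 (Suc x + a)" by (rule Suc.IH)
  finally show ?case by simp
qed simp

section \<open>Cost of expressions, and rules for total correctness with running times\<close>

fun esize :: "expr \<Rightarrow> nat" where
  "esize (Const k) = 1"
| "esize (Cell a i) = 1 + esize i"
| "esize (Bin f d e) = 1 + esize d + esize e"

fun small :: "expr \<Rightarrow> bool" where
  "small (Const k) \<longleftrightarrow> \<bar>k\<bar> \<le> 16"
| "small (Cell a i) \<longleftrightarrow> small i"
| "small (Bin f d e) \<longleftrightarrow> small d \<and> small e"

definition mem_le :: "nat \<Rightarrow> mem \<Rightarrow> bool" where
  "mem_le b s \<longleftrightarrow> (\<forall>a x. \<bar>s a x\<bar> \<le> 2 ^ b)"

lemma abs_div_le: "\<bar>x div y\<bar> \<le> \<bar>x :: int\<bar>"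
proof (cases "y = 0")
  case False
  have "\<bar>x div y\<bar> \<le> \<bar>x\<bar>" if "y > 0" for x y :: int
  proof (cases "x \<ge> 0")
    case True
    then have "0 \<le> x div y" using that by (simp add: pos_imp_zdiv_nonneg_iff)
    moreover have "x div y \<le> x" using True that zdiv_mono2[of x 1 y] by simp
    ultimately show ?thesis using True by simp
  next
    case False
    then have "x div y < 0" using that by (simp add: pos_imp_zdiv_neg_iff)
    moreover have "x \<le> x div y"
    proof -
      have "x div 1 \<le> x div y" using False that by (intro zdiv_mono2_neg) auto
      then show ?thesis by simp
    qed
    ultimately show ?thesis using False by simp
  qed
  from this[of y x] this[of "- y" "- x"] show ?thesis using False
    by (cases "y > 0") (simp_all add: div_minus_minus)
qed simp

lemma abs_mod_le: "\<bar>x mod y\<bar> \<le> \<bar>x\<bar> + \<bar>y :: int\<bar>"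
proof (cases "y = 0")
  case False
  then show ?thesis using abs_mod_less[of y x] by linarith
qed simp

text \<open>An operation on values bounded by \<open>A\<close> and \<open>B\<close> has a result of
  at most \<open>A + B\<close> or \<open>A * B\<close>, and both are at most
  \<open>2 ^ b * (A * B)\<close>. This covers intermediate values that are never stored. The
  condition \<open>4 <= b\<close> pays for constants up to 16.\<close>

lemma val_bound:
  assumes "mem_le b s" "4 \<le> b"
  shows "small e \<Longrightarrow> \<bar>val e s\<bar> \<le> 2 ^ (b * esize e)"
proof (induction e)
  case (Const k)
  have "(16 :: int) = 2 ^ 4" by simp
  also have "\<dots> \<le> 2 ^ b" using assms(2) by (intro power_increasing) auto
  finally show ?case using Const by simp
next
  case (Cell a i)
  have "\<bar>val (Cell a i) s\<bar> \<le> 2 ^ b" using assms(1) by (simp add: mem_le_def)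
  also have "(2 :: int) ^ b \<le> 2 ^ (b * esize (Cell a i))" by (intro power_increasing) auto
  finally show ?case .
next
  case (Bin f d e)
  define A :: int where "A = 2 ^ (b * esize d)"
  define B :: int where "B = 2 ^ (b * esize e)"
  have AB: "1 \<le> A" "1 \<le> B" unfolding A_def B_def by simp_all
  have d: "\<bar>val d s\<bar> \<le> A" and e: "\<bar>val e s\<bar> \<le> B" using Bin A_def B_def by auto
  have "A * 1 \<le> A * B" "1 * B \<le> A * B" using AB by (intro mult_left_mono mult_right_mono; simp)+
  then have "A + B \<le> 2 * (A * B)" by simp
  also have "\<dots> \<le> 2 ^ b * (A * B)"
  proof (rule mult_right_mono)
    have "(2::int) ^ 1 \<le> 2 ^ b" using assms(2) by (intro power_increasing) auto
    then show "(2::int) \<le> 2 ^ b" by simp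
  qed (use AB in simp)
  finally have sum: "A + B \<le> 2 ^ b * (A * B)" .
  have prod: "A * B \<le> 2 ^ b * (A * B)" using AB by simp
  have mul: "\<bar>val d s * val e s\<bar> \<le> A * B" unfolding abs_mult using d e by (intro mult_mono) auto
  have div: "\<bar>val d s div val e s\<bar> \<le> A" using abs_div_le[of "val d s" "val e s"] d by linarith
  have mod: "\<bar>val d s mod val e s\<bar> \<le> A + B" using abs_mod_le[of "val d s" "val e s"] d e by linarith
  define U where "U = 2 ^ b * (A * B)"
  have U: "1 \<le> U" "A \<le> U" "A + B \<le> U" "A * B \<le> U" using sum prod AB unfolding U_def by linarith+
  have "\<bar>bop_val f (val d s) (val e s)\<bar> \<le> U"
    using mul div mod U d e by (cases f) auto
  then have "\<bar>bop_val f (val d s) (val e s)\<bar> \<le> 2 ^ b * (A * B)" unfolding U_def .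
  also have "2 ^ b * (A * B) = 2 ^ (b * esize (Bin f d e))"
    unfolding A_def B_def by (simp add: power_add algebra_simps)
  finally show ?case by simp
qed

lemma int_cost_le:
  assumes "\<bar>x\<bar> \<le> 2 ^ m"
  shows "int_cost x \<le> 2 + m"
proof -
  have "nat \<bar>x\<bar> \<le> 2 ^ m" using assms by (simp add: nat_le_iff)
  also have "(2::nat) ^ m < 2 ^ (m + 1)" by simp
  finally have "floorlog 2 (nat \<bar>x\<bar>) \<le> m + 1" by (intro floorlog_leI) auto
  then show ?thesis by (simp add: int_cost_def)
qed

lemma expr_cost_le:
  assumes "mem_le b s" "4 \<le> b"
  shows "small e \<Longrightarrow> expr_cost e s \<le> esize e * (2 + b * esize e)"
proof (induction e)
  case (Const k)
  then show ?case using int_cost_le[OF val_bound[OF assms Const]] by simp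
next
  case (Cell a i)
  let ?m = "2 + b * esize (Cell a i)"
  have "int_cost (val (Cell a i) s) \<le> ?m" by (intro int_cost_le val_bound assms Cell)
  moreover have "expr_cost i s \<le> esize i * ?m"
    using Cell by (intro order.trans[OF Cell.IH] mult_left_mono) auto
  ultimately show ?case by simp
next
  case (Bin f d e)
  let ?m = "2 + b * esize (Bin f d e)"
  have "int_cost (val (Bin f d e) s) \<le> ?m" by (intro int_cost_le val_bound assms Bin)
  moreover have m: "2 + b * esize d \<le> ?m" "2 + b * esize e \<le> ?m" by (simp_all add: algebra_simps)
  moreover have "expr_cost d s \<le> esize d * ?m"
    using Bin.prems by (intro order.trans[OF Bin.IH(1) mult_le_mono2[OF m(1)]]) simp
  moreover have "expr_cost e s \<le> esize e * ?m"
    using Bin.prems by (intro order.trans[OF Bin.IH(2) mult_le_mono2[OF m(2)]]) simp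
  ultimately have "expr_cost d s + expr_cost e s + int_cost (val (Bin f d e) s) \<le> esize d * ?m + esize e * ?m + ?m"
    by linarith
  also have "\<dots> = esize (Bin f d e) * ?m" by (simp only: esize.simps distrib_right mult_1)
  finally show ?case by simp
qed

text \<open>Every step of a program with expressions of size at most 200 costs at most \<open>step_cost b\<close>, as
  long as the entries of the memory are bounded by \<open>2 ^ b\<close>. Times are measured in this unit below.\<close>

definition step_cost :: "nat \<Rightarrow> nat" where
  "step_cost b = 1 + 2 * (200 * (2 + b * 200))"

abbreviation simple_expr :: "expr \<Rightarrow> bool" where
  "simple_expr e \<equiv> small e \<and> esize e \<le> 200"

lemma expr_cost_step:
  assumes "mem_le b s" "4 \<le> b" "simple_expr e"
  shows "expr_cost e s \<le> 200 * (2 + b * 200)"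
proof -
  have "esize e * (2 + b * esize e) \<le> 200 * (2 + b * 200)"
    using assms(3) by (intro mult_mono add_mono) auto
  then show ?thesis using expr_cost_le[OF assms(1,2)] assms(3) by (meson order.trans)
qed

text \<open>The bound on the memory is part of the judgement, so that one unit of time fits all
  steps of a program and bounds on times can simply be added.\<close>

definition runs :: "nat \<Rightarrow> com \<Rightarrow> mem \<Rightarrow> nat \<Rightarrow> nat \<Rightarrow> (mem \<Rightarrow> bool) \<Rightarrow> bool" where
  "runs b c s T q P \<longleftrightarrow> (\<exists>t s'. exec two_opt_oracle c s t q s' \<and> t \<le> T * step_cost b \<and> mem_le b s' \<and> P s')"

lemma runs_weaken: "runs b c s T q P \<Longrightarrow> T \<le> T' \<Longrightarrow> (\<And>s'. mem_le b s' \<Longrightarrow> P s' \<Longrightarrow> P' s') \<Longrightarrow> runs b c s T' q P'"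
  unfolding runs_def by (meson mult_le_mono1 order.trans)

lemma runs_assign:
  assumes "mem_le b s" "4 \<le> b" "simple_expr i" "simple_expr e" "\<bar>val e s\<bar> \<le> 2 ^ b"
    "P (s(a := (s a)(val i s := val e s)))"
  shows "runs b (Assign a i e) s 1 0 P"
proof -
  have "1 + expr_cost i s + expr_cost e s \<le> 1 * step_cost b"
    using expr_cost_step[OF assms(1,2,3)] expr_cost_step[OF assms(1,2,4)] unfolding step_cost_def by simp
  moreover have "mem_le b (s(a := (s a)(val i s := val e s)))"
    using assms(1,5) by (auto simp: mem_le_def)
  ultimately show ?thesis unfolding runs_def using exec.Assign assms(6) by blast
qed

lemma step_cost_pos: "1 \<le> step_cost b"
  by (simp add: step_cost_def)

lemma runs_seq:
  assumes "runs b c s T q Q" "\<And>s'. mem_le b s' \<Longrightarrow> Q s' \<Longrightarrow> runs b d s' U r P"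
  shows "runs b (Seq c d) s (T + U + 1) (q + r) P"
proof -
  obtain t s' where 1: "exec two_opt_oracle c s t q s'" "t \<le> T * step_cost b" "mem_le b s'" "Q s'"
    using assms(1) unfolding runs_def by blast
  obtain u s'' where 2: "exec two_opt_oracle d s' u r s''" "u \<le> U * step_cost b" "mem_le b s''" "P s''"
    using assms(2)[OF 1(3,4)] unfolding runs_def by blast
  have "1 + t + u \<le> (T + U + 1) * step_cost b" using 1(2) 2(2) step_cost_pos[of b] by (simp add: algebra_simps)
  then show ?thesis unfolding runs_def using exec.Seq[OF 1(1) 2(1)] 2 by blast
qed

text \<open>One unit for each entry of the question, one for computing its length and one for the
  answer.\<close>

lemma runs_query:
  assumes "mem_le b s" "4 \<le> b" "simple_expr e" "two_opt_oracle (query_word a e s) = Some y" "\<bar>y\<bar> \<le> 2 ^ b"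
    "P (s(d := (s d)(0 := y)))"
  shows "runs b (Query d a e) s (nat (val e s) + 2) 1 P"
proof -
  have le: "2 + b \<le> step_cost b" unfolding step_cost_def by simp
  have "(\<Sum>x\<leftarrow>query_word a e s. int_cost x) \<le> (\<Sum>x\<leftarrow>query_word a e s. step_cost b)"
  proof (rule sum_list_mono)
    fix x assume "x \<in> set (query_word a e s)"
    then have "\<bar>x\<bar> \<le> 2 ^ b" using assms(1) by (auto simp: query_word_def mem_le_def)
    then show "int_cost x \<le> step_cost b" using int_cost_le le order.trans by blast
  qed
  also have "\<dots> = nat (val e s) * step_cost b" unfolding sum_list_triv by (simp add: query_word_def)
  finally have sum: "(\<Sum>x\<leftarrow>query_word a e s. int_cost x) \<le> nat (val e s) * step_cost b" .
  have "1 + expr_cost e s + (\<Sum>x\<leftarrow>query_word a e s. int_cost x) + int_cost y \<le> (nat (val e s) + 2) * step_cost b"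
  proof -
    have "1 + expr_cost e s \<le> step_cost b"
      using expr_cost_step[OF assms(1-3)] unfolding step_cost_def by simp
    moreover have "int_cost y \<le> step_cost b" using int_cost_le[OF assms(5)] le by simp
    ultimately show ?thesis using sum unfolding distrib_right by linarith
  qed
  moreover have "mem_le b (s(d := (s d)(0 := y)))" using assms(1,5) by (auto simp: mem_le_def)
  ultimately show ?thesis unfolding runs_def using exec.Query[of two_opt_oracle a e s y d, OF assms(4)] assms(6) by blast
qed

abbreviation Var :: "nat \<Rightarrow> expr" where
  "Var x \<equiv> Cell x (Const 0)"

text \<open>The bound \<open>e\<close> is evaluated anew before every round; the rules below
  therefore ask for an invariant that fixes its value.\<close>

definition For :: "nat \<Rightarrow> expr \<Rightarrow> com \<Rightarrow> com" where
  "For x e c = Seq (Assign x (Const 0) (Const 0))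
     (While (Bin Less (Var x) e) (Seq c (Assign x (Const 0) (Bin Add (Var x) (Const 1)))))"

text \<open>A round costs \<open>T\<close> for the body and one unit each for the test, the
  increment and the sequencing; the last unit is the failing test. The limit 190 keeps the test
  below size 200. A negative bound, such as \<open>n - 1\<close> for \<open>n = 0\<close>, means no
  rounds, hence \<open>nat\<close>.\<close>

lemma runs_while:
  assumes "4 \<le> b" "small e" "esize e \<le> 190" "int m \<le> 2 ^ b"
    and bound: "\<And>i s. I i s \<Longrightarrow> nat (val e s) = m"
    and indep: "\<And>i s v. I i s \<Longrightarrow> I i (s(x := (s x)(0 := v)))"
    and body: "\<And>i s. i < m \<Longrightarrow> mem_le b s \<Longrightarrow> I i s \<Longrightarrow> s x 0 = int i \<Longrightarrow>
       runs b c s T q (\<lambda>s'. s' x 0 = int i \<and> I (Suc i) s')"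
  shows "i \<le> m \<Longrightarrow> mem_le b s \<Longrightarrow> I i s \<Longrightarrow> s x 0 = int i \<Longrightarrow>
    runs b (While (Bin Less (Var x) e) (Seq c (Assign x (Const 0) (Bin Add (Var x) (Const 1))))) s
      ((m - i) * (T + 3) + 1) ((m - i) * q) (I m)"
proof (induction "m - i" arbitrary: i s)
  case 0
  let ?t = "Bin Less (Var x) e"
  have t: "val ?t s = 0" using 0 bound[of i s] by (auto simp: nat_eq_iff split: if_splits)
  have "1 + expr_cost ?t s \<le> 1 * step_cost b"
    using expr_cost_step[OF 0(3) assms(1), of ?t] assms(2,3) unfolding step_cost_def by simp
  then show ?case using exec.WhileFalse[OF t] 0 unfolding runs_def by force
next
  case (Suc d)
  let ?t = "Bin Less (Var x) e"
  have im: "i < m" using Suc by simp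
  have t: "val ?t s \<noteq> 0" using Suc bound[of i s] by auto
  have ct: "1 + expr_cost ?t s \<le> 1 * step_cost b"
    using expr_cost_step[OF Suc(4) assms(1), of ?t] assms(2,3) unfolding step_cost_def by simp
  have "runs b (Seq c (Assign x (Const 0) (Bin Add (Var x) (Const 1)))) s (T + 1 + 1) (q + 0)
     (\<lambda>s'. s' x 0 = int (Suc i) \<and> I (Suc i) s')"
  proof (rule runs_seq[OF body[OF im Suc(4,5,6)]])
    fix s' assume s': "mem_le b s'" "s' x 0 = int i \<and> I (Suc i) s'"
    have "int i + 1 \<le> 2 ^ b" using im assms(4) by linarith
    then show "runs b (Assign x (Const 0) (Bin Add (Var x) (Const 1))) s' 1 0 (\<lambda>s'. s' x 0 = int (Suc i) \<and> I (Suc i) s')"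
      using s' assms(1) indep by (intro runs_assign) auto
  qed
  then obtain t1 s1 where 1: "exec two_opt_oracle (Seq c (Assign x (Const 0) (Bin Add (Var x) (Const 1)))) s t1 q s1"
    "t1 \<le> (T + 2) * step_cost b" "mem_le b s1" "s1 x 0 = int (Suc i)" "I (Suc i) s1"
    unfolding runs_def add_0_right by (metis add.assoc one_add_one)
  have "d = m - Suc i" "Suc i \<le> m" using Suc(2) im by auto
  from Suc(1)[OF this 1(3,5,4)]
  obtain u s2 where 2: "exec two_opt_oracle (While ?t (Seq c (Assign x (Const 0) (Bin Add (Var x) (Const 1))))) s1 u ((m - Suc i) * q) s2"
    "u \<le> ((m - Suc i) * (T + 3) + 1) * step_cost b" "mem_le b s2" "I m s2"
    unfolding runs_def by blast
  have mi: "m - i = Suc (m - Suc i)" using im by simp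
  have "1 + expr_cost ?t s + t1 + u \<le> ((m - i) * (T + 3) + 1) * step_cost b"
    using ct 1(2) 2(2) unfolding mi by (simp add: algebra_simps)
  moreover have "q + (m - Suc i) * q = (m - i) * q" unfolding mi by simp
  ultimately show ?case using exec.WhileTrue[OF t 1(1) 2(1)] 2(3,4) unfolding runs_def by metis
qed

lemma runs_for:
  assumes "mem_le b s" "4 \<le> b" "small e" "esize e \<le> 190" "int m \<le> 2 ^ b" "I 0 s"
    and "\<And>i s. I i s \<Longrightarrow> nat (val e s) = m"
    and indep: "\<And>i s v. I i s \<Longrightarrow> I i (s(x := (s x)(0 := v)))"
    and "\<And>i s. i < m \<Longrightarrow> mem_le b s \<Longrightarrow> I i s \<Longrightarrow> s x 0 = int i \<Longrightarrow>
       runs b c s T q (\<lambda>s'. s' x 0 = int i \<and> I (Suc i) s')"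
  shows "runs b (For x e c) s (m * (T + 3) + 3) (m * q) (I m)"
proof -
  have "runs b (For x e c) s (1 + (m * (T + 3) + 1) + 1) (0 + m * q) (I m)"
    unfolding For_def
  proof (rule runs_seq)
    show "runs b (Assign x (Const 0) (Const 0)) s 1 0 (\<lambda>s'. s' x 0 = int 0 \<and> I 0 s')"
      using assms(1,2,6) indep by (intro runs_assign) auto
    fix s' assume s': "mem_le b s'" "s' x 0 = int 0 \<and> I 0 s'"
    show "runs b (While (Bin Less (Var x) e) (Seq c (Assign x (Const 0) (Bin Add (Var x) (Const 1))))) s'
      (m * (T + 3) + 1) (m * q) (I m)"
      using runs_while[of b e m I x c T q 0 s', OF assms(2-5,7-9) le0 s'(1)] s'(2) by (simp only: diff_zero of_nat_0)
  qed
  then have "runs b (For x e c) s (1 + (m * (T + 3) + 1) + 1) (m * q) (I m)" by (simp only: add_0)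
  then show ?thesis by (rule runs_weaken) auto
qed

section \<open>The program\<close>

abbreviation plus_expr (infixl "\<oplus>" 65) where "plus_expr \<equiv> Bin Add"
abbreviation minus_expr (infixl "\<ominus>" 65) where "minus_expr \<equiv> Bin Sub"
abbreviation times_expr (infixl "\<otimes>" 70) where "times_expr \<equiv> Bin Mul"

text \<open>Arrays: 2 is the question to the oracle, 3 the difference table in reverse order, 4 to 6 loop
  counters, 7 the number of vertices of the instance, 8 the current factor \<open>2 ^ n * fact k\<close>
  (in the output phase \<open>2 ^ j * fact j\<close>), 9 the answer of the oracle.\<close>

definition weight_expr :: expr where
  "weight_expr =
     (let n = Var 0; i = Var 5; j = Var 6;
          vi = Bin Div i (Const 4); vj = Bin Div j (Const 4);
          d = Bin Mod i (Const 4) \<oplus> Bin Mod j (Const 4) \<ominus> Const 3;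
          adj = Cell 0 (Const 1 \<oplus> (vi \<otimes> n \<oplus> vj)) \<otimes> (Bin Mod i (Const 2) \<otimes> Bin Mod j (Const 2))
      in Bin Less i (Const 4 \<otimes> n) \<otimes> Bin Less j (Const 4 \<otimes> n) \<otimes>
        (Bin Eq vi vj \<otimes> (Const (-2) \<otimes> (Const 1 \<oplus> d \<otimes> d)) \<oplus>
         (Const 1 \<ominus> Bin Eq vi vj) \<otimes> (Const 1 \<ominus> adj)))"

text \<open>Address of the numerator (\<open>c = 1\<close>) or denominator (\<open>c = 2\<close>) of
  the entry in row \<open>Var 5\<close> and column \<open>Var 6\<close>.\<close>

definition pos_expr :: "int \<Rightarrow> expr" where
  "pos_expr c = Const c \<oplus> Const 2 \<otimes> (Var 5 \<otimes> Var 7 \<oplus> Var 6)"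

text \<open>The instance has \<open>4 * n\<close> gadget vertices and \<open>n + j\<close> hubs,
  where \<open>j\<close> is the counter \<open>Var 4\<close> of the surrounding loop.\<close>

definition build_com :: com where
  "build_com = Seq (Assign 7 (Const 0) (Const 5 \<otimes> Var 0 \<oplus> Var 4))
     (Seq (Assign 2 (Const 0) (Var 7))
       (For 5 (Var 7) (For 6 (Var 7)
         (Seq (Assign 2 (pos_expr 1) weight_expr) (Assign 2 (pos_expr 2) (Const 1))))))"

definition ask_com :: com where
  "ask_com = Seq build_com
     (Seq (Query 9 2 (Const 1 \<oplus> Const 2 \<otimes> (Var 7 \<otimes> Var 7)))
       (Seq (Assign 3 (Var 0 \<ominus> Const 1 \<ominus> Var 4) (Bin Div (Var 9) (Var 8)))
         (Assign 8 (Const 0) (Var 8 \<otimes> (Var 0 \<oplus> Var 4 \<oplus> Const 1)))))"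

definition factor_com :: com where
  "factor_com = Seq (Assign 8 (Const 0) (Const 1))
     (For 5 (Var 0) (Assign 8 (Const 0) (Var 8 \<otimes> (Const 2 \<otimes> (Var 5 \<oplus> Const 1)))))"

text \<open>Entry \<open>i\<close> takes part in \<open>n - 1 - i\<close> rounds and then stays. As
  the values are stored from the largest argument down, all entries end as differences, of orders
  \<open>n - 1 - i\<close>, at the common point \<open>n - 1\<close>.\<close>

definition diff_com :: com where
  "diff_com = For 4 (Var 0) (For 5 (Var 0 \<ominus> Const 1 \<ominus> Var 4)
     (Assign 3 (Var 5) (Cell 3 (Var 5) \<ominus> Cell 3 (Var 5 \<oplus> Const 1))))"

text \<open>A round lowers the common point by one, by solving the difference equation for the value
  at the smaller argument. Entry 0, the constant top difference, stays as it is;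
  \<open>n - 1\<close> rounds lead to 0.\<close>

definition shift_com :: com where
  "shift_com = For 4 (Var 0 \<ominus> Const 1) (For 5 (Var 0 \<ominus> Const 1)
     (Assign 3 (Var 5 \<oplus> Const 1) (Cell 3 (Var 5 \<oplus> Const 1) \<ominus> Cell 3 (Var 5))))"

text \<open>At 0 the difference of order \<open>j\<close> is the coefficient itself; division by
  \<open>2 ^ j * fact j\<close> leaves the number of covers with \<open>j + 1\<close> paths.\<close>

definition output_com :: com where
  "output_com = Seq (Assign 8 (Const 0) (Const 1))
     (For 4 (Var 0) (Seq (Assign 1 (Var 4 \<oplus> Const 1) (Bin Div (Cell 3 (Var 0 \<ominus> Const 1 \<ominus> Var 4)) (Var 8)))
        (Assign 8 (Const 0) (Var 8 \<otimes> (Const 2 \<otimes> (Var 4 \<oplus> Const 1))))))"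

definition main_com :: com where
  "main_com = Seq factor_com (Seq (For 4 (Var 0) ask_com) (Seq diff_com (Seq shift_com output_com)))"

lemma simple_weight_expr: "simple_expr weight_expr"
  by (simp add: weight_expr_def Let_def)

lemma simple_pos_expr: "\<bar>c\<bar> \<le> 16 \<Longrightarrow> simple_expr (pos_expr c)"
  by (simp add: pos_expr_def)

lemma graph_input_adj:
  assumes "i < n" "j < n"
  shows "graph_input n E 0 (1 + (int i * int n + int j)) = (if {i, j} \<in> E then 1 else 0)"
proof -
  have eq: "i' = i \<and> j' = j" if "i' < n" "j' < n" "1 + (int i * int n + int j) = int (1 + i' * n + j')" for i' j'
  proof -
    have "int (i * n + j) = int (i' * n + j')" using that(3) by simp
    then have e: "i * n + j = i' * n + j'" by (simp only: of_nat_eq_iff)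
    have "i = (i * n + j) div n" "i' = (i' * n + j') div n" "j = (i * n + j) mod n" "j' = (i' * n + j') mod n"
      using assms that by simp_all
    then show ?thesis using e by metis
  qed
  have "(\<exists>i'<n. \<exists>j'<n. {i', j'} \<in> E \<and> 1 + (int i * int n + int j) = int (1 + i' * n + j')) \<longleftrightarrow> {i, j} \<in> E"
  proof
    assume "\<exists>i'<n. \<exists>j'<n. {i', j'} \<in> E \<and> 1 + (int i * int n + int j) = int (1 + i' * n + j')"
    then show "{i, j} \<in> E" using eq by blast
  next
    assume "{i, j} \<in> E"
    then show "\<exists>i'<n. \<exists>j'<n. {i', j'} \<in> E \<and> 1 + (int i * int n + int j) = int (1 + i' * n + j')"
      using assms by (intro exI[of _ i] exI[of _ j] conjI) auto
  qed
  moreover have "1 + (int i * int n + int j) \<noteq> 0" using zero_le_mult_iff[of "int i" "int n"] by linarith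
  ultimately show ?thesis unfolding graph_input_def by simp
qed

text \<open>Expressions have no conditional; the cases of \<open>gweight\<close> are selected by
  products with tests of value 0 or 1, and the parity condition is the product of the residues mod
  2.\<close>

lemma val_weight_expr:
  assumes s: "s 0 = graph_input n E 0" "s 5 0 = int i" "s 6 0 = int j"
  shows "val weight_expr s = gweight n E i j"
proof -
  have n: "s 0 0 = int n" using s(1) by (simp add: graph_input_def)
  have div: "int i div 4 = int (i div 4)" "int j div 4 = int (j div 4)" by (simp_all add: zdiv_int)
  have mod: "int i mod 4 = int (i mod 4)" "int j mod 4 = int (j mod 4)"
    "int i mod 2 = int (i mod 2)" "int j mod 2 = int (j mod 2)" by (simp_all add: zmod_int)
  show ?thesis
  proof (cases "i < 4 * n \<and> j < 4 * n")
    case False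
    then have "\<not> int i < 4 * int n \<or> \<not> int j < 4 * int n" by linarith
    then show ?thesis using False s(2,3) n by (auto simp: weight_expr_def Let_def gweight_def)
  next
    case True
    then have lt: "int i < 4 * int n" "int j < 4 * int n" "i div 4 < n" "j div 4 < n" by linarith+
    have "val weight_expr s =
      (if i div 4 = j div 4 then - 2 * (1 + (int (i mod 4) + int (j mod 4) - 3)^2)
       else 1 - s 0 (1 + (int (i div 4) * int n + int (j div 4))) * (int (i mod 2) * int (j mod 2)))"
      using lt(1,2) by (simp add: weight_expr_def Let_def s(2,3) n div mod power2_eq_square del: of_nat_mod of_nat_div)
    also have "\<dots> = gweight n E i j"
      using True lt(3,4) unfolding s(1) graph_input_adj[OF lt(3,4)] gweight_def
      by (auto simp: odd_iff_mod_2_eq_one even_iff_mod_2_eq_zero)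
    finally show ?thesis .
  qed
qed

lemma abs_gweight_le: "\<bar>gweight n E i j\<bar> \<le> 20"
proof -
  have "(int (i mod 4) + int (j mod 4) - 3)^2 \<le> 3^2"
  proof (rule power2_le_iff_abs_le[THEN iffD2])
    have "i mod 4 \<le> 3" "j mod 4 \<le> 3" by presburger+
    then show "\<bar>int (i mod 4) + int (j mod 4) - 3\<bar> \<le> 3" by linarith
  qed simp
  then have "(int (i mod 4) + int (j mod 4) - 3)^2 \<le> 9" by simp
  moreover have "0 \<le> (int (i mod 4) + int (j mod 4) - 3)^2" by simp
  moreover have *: "\<bar>- 2 * (1 + y)\<bar> \<le> 20" if "0 \<le> y" "y \<le> 9" for y :: int using that by simp
  ultimately have "\<bar>- 2 * (1 + (int (i mod 4) + int (j mod 4) - 3)^2)\<bar> \<le> 20" by blast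
  then show ?thesis unfolding gweight_def by simp
qed

text \<open>The instances have at most \<open>6 * n\<close> vertices, so oracle answers are at most
  \<open>(6 * n) ^ (6 * n)\<close>, which is at most \<open>2 ^ (36 * n * n)\<close>. The rest is
  slack for factorials, loop bounds and small \<open>n\<close>.\<close>

definition bits :: "nat \<Rightarrow> nat" where
  "bits n = 40 * (n + 1)\<^sup>2"

lemma bits_ge: "40 \<le> bits n" "40 * n \<le> bits n" "40 * n\<^sup>2 + 80 * n \<le> bits n"
  by (simp_all add: bits_def power2_eq_square algebra_simps)

lemma le_two_power_bits: "m \<le> bits n \<Longrightarrow> int m \<le> 2 ^ bits n"
  by (metis less_exp less_imp_le of_nat_le_iff of_nat_numeral of_nat_power order.trans)

lemma power_le_bits:
  assumes "m \<le> 6 * n"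
  shows "int (m ^ m) \<le> 2 ^ bits n"
proof -
  have "m ^ m \<le> (6 * n) ^ m" using assms by (intro power_mono) auto
  also have "\<dots> \<le> (2 ^ (6 * n)) ^ m" using less_exp[of "6 * n"] by (intro power_mono) simp_all
  also have "\<dots> = 2 ^ (6 * n * m)" by (simp add: power_mult)
  also have "\<dots> \<le> 2 ^ bits n"
  proof (rule power_increasing)
    have "6 * n * m \<le> 6 * n * (6 * n)" using assms by (intro mult_left_mono) auto
    also have "\<dots> = 36 * n\<^sup>2" by (simp add: power2_eq_square)
    also have "\<dots> \<le> bits n" using bits_ge(3)[of n] by simp
    finally show "6 * n * m \<le> bits n" .
  qed simp
  finally have "int (m ^ m) \<le> int (2 ^ bits n)" by (simp only: of_nat_le_iff)
  then show ?thesis by simp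
qed

lemma fact_le_bits:
  assumes "m \<le> 2 * n" "l \<le> n"
  shows "int (2 ^ l * fact m) \<le> 2 ^ bits n"
proof -
  have "fact m \<le> m ^ m" using fact_le_power[of m, where 'a = nat] by simp
  also have "\<dots> \<le> (2 * n) ^ m" using assms by (intro power_mono) auto
  also have "\<dots> \<le> (2 ^ (2 * n)) ^ m" using less_exp[of "2 * n"] by (intro power_mono) simp_all
  also have "\<dots> = 2 ^ (2 * n * m)" by (simp add: power_mult)
  finally have "2 ^ l * fact m \<le> (2 ^ l * 2 ^ (2 * n * m) :: nat)" by simp
  also have "\<dots> = 2 ^ (l + 2 * n * m)" by (simp add: power_add)
  also have "\<dots> \<le> 2 ^ bits n"
  proof (rule power_increasing)
    have "2 * n * m \<le> 2 * n * (2 * n)" using assms by (intro mult_left_mono) auto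
    also have "\<dots> = 4 * n\<^sup>2" by (simp add: power2_eq_square)
    finally show "l + 2 * n * m \<le> bits n" using bits_ge(3)[of n] assms(2) by linarith
  qed simp
  finally have "int (2 ^ l * fact m) \<le> int (2 ^ bits n)" by (simp only: of_nat_le_iff)
  then show ?thesis by simp
qed

section \<open>Correctness and running time of the program\<close>

locale program =
  fixes n :: nat and E :: "nat set set"
  assumes graph: "simple_graph {0..<n} E"
begin

abbreviation b where "b \<equiv> bits n"
abbreviation G where "G \<equiv> graph_input n E 0"
abbreviation cov where "cov \<equiv> tsp_instance.cover_coeff n E"
abbreviation D where "D \<equiv> diff_table cov n"

lemma b4: "4 \<le> b" using bits_ge(1)[of n] by simp

lemma G_simps: "G 0 = int n"
  by (simp add: graph_input_def)

lemma le_bits: "m \<le> 40 * n + 40 \<Longrightarrow> int m \<le> 2 ^ b"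
proof -
  assume "m \<le> 40 * n + 40"
  moreover have "40 * n + 40 \<le> b" using bits_ge(3)[of n] by (simp add: bits_def power2_eq_square algebra_simps)
  ultimately show ?thesis by (intro le_two_power_bits) simp
qed

lemma runs_factor:
  assumes "mem_le b s" "s 0 = G"
  shows "runs b factor_com s (4 * n + 5) 0 (\<lambda>s. s 0 = G \<and> s 8 0 = int (2 ^ n * fact n))"
proof -
  let ?I = "\<lambda>i s. s 0 = G \<and> s 8 0 = int (2 ^ i * fact i)"
  have "runs b factor_com s (1 + (n * (1 + 3) + 3) + 1) (0 + n * 0) (?I n)"
    unfolding factor_com_def
  proof (rule runs_seq)
    show "runs b (Assign 8 (Const 0) (Const 1)) s 1 0 (\<lambda>s. ?I 0 s)"
      using assms b4 by (intro runs_assign) auto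
    fix s assume s: "mem_le b s" "?I 0 s"
    show "runs b (For 5 (Var 0) (Assign 8 (Const 0) (Var 8 \<otimes> (Const 2 \<otimes> (Var 5 \<oplus> Const 1))))) s (n * (1 + 3) + 3) (n * 0) (?I n)"
    proof (rule runs_for[where I = ?I])
      fix i s assume i: "i < n" "mem_le b s" "?I i s" "s 5 0 = int i"
      have e: "int (2 ^ i * fact i) * (2 * (int i + 1)) = int (2 ^ Suc i * fact (Suc i))"
        by (simp add: algebra_simps)
      have "int (2 ^ Suc i * fact (Suc i)) \<le> 2 ^ b" using i by (intro fact_le_bits) auto
      then show "runs b (Assign 8 (Const 0) (Var 8 \<otimes> (Const 2 \<otimes> (Var 5 \<oplus> Const 1)))) s 1 0
        (\<lambda>s'. s' 5 0 = int i \<and> ?I (Suc i) s')"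
        using i b4 e by (intro runs_assign) (simp_all del: of_nat_mult of_nat_Suc of_nat_power fact_Suc power_Suc)
    qed (use s b4 G_simps le_bits[of n] in auto)
  qed
  then show ?thesis by (simp add: algebra_simps)
qed

lemma instance_of_word:
  assumes n: "1 \<le> n" "n \<le> k" and N: "N = 4 * n + k"
    and xs: "xs = map (\<lambda>i. m (int i)) [0..<1 + 2 * N * N]" "m 0 = int N"
    and entry: "\<And>i j. i < N \<Longrightarrow> j < N \<Longrightarrow> m (1 + 2 * int (i * N + j)) = gweight n E i j \<and> m (2 + 2 * int (i * N + j)) = 1"
  shows "tsp_instance n k E (inst_weight xs)" "valid_inst xs" "inst_size xs = N"
proof -
  have nth: "xs ! i = m (int i)" if "i < 1 + 2 * N * N" for i using that xs(1) by (simp del: upt_Suc)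
  have len: "length xs = 1 + 2 * N * N" using xs(1) by simp
  show size: "inst_size xs = N" using nth[of 0] xs(2) by (simp add: inst_size_def)
  have less: "2 + 2 * (i * N + j) < 1 + 2 * N * N" if "i < N" "j < N" for i j
  proof -
    have "i * N + j < i * N + N" using that by simp
    also have "\<dots> = Suc i * N" by simp
    also have "\<dots> \<le> N * N" using that by (intro mult_right_mono) auto
    finally show ?thesis by simp
  qed
  have num: "inst_num xs i j = gweight n E i j" "inst_den xs i j = 1" if "i < N" "j < N" for i j
    using entry[OF that] nth[of "1 + 2 * (i * N + j)"] nth[of "2 + 2 * (i * N + j)"] less[OF that] size
    by (simp_all add: inst_num_def inst_den_def)
  show "valid_inst xs" unfolding valid_inst_def size len using num nth[of 0] xs(2) len by auto
  show "tsp_instance n k E (inst_weight xs)"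
  proof
    fix i j assume ij: "i < 4 * n + k" "j < 4 * n + k" "i \<noteq> j"
    have "Min {i, j} < N" "Max {i, j} < N" using ij N by auto
    then have "inst_weight xs {i, j} = of_int (gweight n E (Min {i, j}) (Max {i, j}))"
      unfolding inst_weight_def by (simp add: num of_int_rat)
    moreover have "gweight n E (Min {i, j}) (Max {i, j}) = gweight n E i j"
      using gweight_commute[of n E i j] by (auto simp: min_def max_def)
    ultimately show "inst_weight xs {i, j} = of_int (gweight n E i j)" by simp
  qed (use n graph in auto)
qed

lemma f_two_opt_D:
  assumes "tsp_instance n k E w"
  shows "f_two_opt {0..<4 * n + k} w = 2 ^ n * fact k * D 0 (k - 1)"
  using tsp_instance.f_two_opt_eq[OF assms] by (simp add: diff_table_def)

lemma f_two_opt_bits: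
  assumes "tsp_instance n k E w" "k \<le> 2 * n"
  shows "int (f_two_opt {0..<4 * n + k} w) \<le> 2 ^ b"
proof -
  have "int (f_two_opt {0..<4 * n + k} w) \<le> int ((4 * n + k) ^ (4 * n + k))"
    using tsp_instance.f_two_opt_le[OF assms(1)] by (simp only: of_nat_le_iff)
  also have "\<dots> \<le> 2 ^ b" using assms(2) by (intro power_le_bits) simp
  finally show ?thesis .
qed

text \<open>Each of these entries is at most \<open>D 0 (2 * n - 2)\<close>, a factor of the number
  of 2-optimal tours for \<open>k = 2 * n - 1\<close>. So the trivial bound on the number of tours
  also bounds the table, and with it the numbers of path covers.\<close>

lemma D_bits:
  assumes "a + x \<le> 2 * n - 2" "1 \<le> n"
  shows "int (D a x) \<le> 2 ^ b"
proof -
  define w :: "nat set \<Rightarrow> rat" where "w e = of_int (gweight n E (Min e) (Max e))" for e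
  have inst: "tsp_instance n (2 * n - 1) E w"
  proof
    fix i j :: nat
    show "w {i, j} = of_int (gweight n E i j)"
      using gweight_commute[of n E i j] by (auto simp: w_def min_def max_def)
  qed (use assms(2) graph in auto)
  have "D a x \<le> D 0 (x + a)" by (rule diff_table_le)
  also have "\<dots> \<le> D 0 (2 * n - 1 - 1)" using assms by (intro diff_table_mono) simp
  also have "\<dots> \<le> f_two_opt {0..<4 * n + (2 * n - 1)} w" unfolding f_two_opt_D[OF inst] by simp
  finally have "int (D a x) \<le> int (f_two_opt {0..<4 * n + (2 * n - 1)} w)" by (simp only: of_nat_le_iff)
  also have "\<dots> \<le> 2 ^ b" by (rule f_two_opt_bits[OF inst]) simp
  finally show ?thesis .
qed

lemma runs_entry:
  assumes "mem_le b s" "s 0 = G" "s 5 0 = int i" "s 6 0 = int j" "s 7 0 = int N"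
  shows "runs b (Seq (Assign 2 (pos_expr 1) weight_expr) (Assign 2 (pos_expr 2) (Const 1))) s 3 0
    (\<lambda>s'. s' = s(2 := (s 2)(1 + 2 * int (i * N + j) := gweight n E i j, 2 + 2 * int (i * N + j) := 1)))"
proof -
  let ?s1 = "s(2 := (s 2)(1 + 2 * int (i * N + j) := gweight n E i j))"
  have "runs b (Seq (Assign 2 (pos_expr 1) weight_expr) (Assign 2 (pos_expr 2) (Const 1))) s (1 + 1 + 1) (0 + 0)
    (\<lambda>s'. s' = s(2 := (s 2)(1 + 2 * int (i * N + j) := gweight n E i j, 2 + 2 * int (i * N + j) := 1)))"
  proof (rule runs_seq)
    have v: "val weight_expr s = gweight n E i j" using assms by (intro val_weight_expr) auto
    have "\<bar>gweight n E i j\<bar> \<le> 2 ^ b" using abs_gweight_le[of n E i j] le_bits[of 20] by simp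
    moreover have "val (pos_expr 1) s = 1 + 2 * int (i * N + j)" using assms by (simp add: pos_expr_def)
    ultimately show "runs b (Assign 2 (pos_expr 1) weight_expr) s 1 0 (\<lambda>s'. s' = ?s1)"
      using assms(1) b4 simple_weight_expr simple_pos_expr[of 1] v by (intro runs_assign) simp_all
    fix s' assume s': "mem_le b s'" "s' = ?s1"
    have "val (pos_expr 2) s' = 2 + 2 * int (i * N + j)" using assms s'(2) by (simp add: pos_expr_def)
    then show "runs b (Assign 2 (pos_expr 2) (Const 1)) s' 1 0
      (\<lambda>s'. s' = s(2 := (s 2)(1 + 2 * int (i * N + j) := gweight n E i j, 2 + 2 * int (i * N + j) := 1)))"
      using s' b4 simple_pos_expr[of 2] by (intro runs_assign) simp_all
  qed
  then show ?thesis by (simp add: numeral_3_eq_3)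
qed

lemma runs_build:
  assumes "mem_le b s" "s 0 = G" "s 4 0 = int j" "j < n" "N = 5 * n + j"
  shows "runs b build_com s (N * (6 * N + 6) + 8) 0 (\<lambda>s'. s' 0 = G \<and> s' 3 = s 3 \<and> s' 4 = s 4 \<and> s' 8 = s 8 \<and>
     s' 7 0 = int N \<and> s' 2 0 = int N \<and>
     (\<forall>i<N. \<forall>j<N. s' 2 (1 + 2 * int (i * N + j)) = gweight n E i j \<and> s' 2 (2 + 2 * int (i * N + j)) = 1))"
proof -
  define base where "base s' \<longleftrightarrow> s' 0 = G \<and> s' 3 = s 3 \<and> s' 4 = s 4 \<and> s' 8 = s 8 \<and> s' 7 0 = int N \<and> s' 2 0 = int N"
    for s' :: mem
  define fill where "fill i j s' \<longleftrightarrow> s' 2 (1 + 2 * int (i * N + j)) = gweight n E i j \<and> s' 2 (2 + 2 * int (i * N + j)) = 1"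
    for i j and s' :: mem
  \<comment> \<open>Row-major progress: rows before \<open>r\<close> and the first \<open>c\<close>
    entries of row \<open>r\<close> are in place. A full row \<open>J r N\<close> amounts to
    \<open>J (Suc r) 0\<close>.\<close>
  define J where "J r c s' \<longleftrightarrow> base s' \<and> (\<forall>i<N. \<forall>j<N. i < r \<or> i = r \<and> j < c \<longrightarrow> fill i j s')" for r c s'
  have Nb: "int N \<le> 2 ^ b" using assms(4,5) by (intro le_bits) simp
  have J_upd: "J r c (s'(x := (s' x)(0 := v)))" if "J r c s'" "x = 5 \<or> x = 6" for r c s' x v
    using that unfolding J_def base_def fill_def by auto
  let ?c = "Seq (Assign 2 (pos_expr 1) weight_expr) (Assign 2 (pos_expr 2) (Const 1))"
  have entry: "runs b ?c s' 3 0 (\<lambda>s''. s'' 6 0 = int c \<and> s'' 5 0 = int r \<and> J r (Suc c) s'')"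
    if h: "r < N" "c < N" "mem_le b s'" "s' 5 0 = int r" "J r c s'" "s' 6 0 = int c" for r c s'
  proof (rule runs_weaken[OF runs_entry[of s' r c N]])
    show "mem_le b s'" "s' 5 0 = int r" "s' 6 0 = int c" using h by auto
    show "s' 0 = G" "s' 7 0 = int N" using h by (auto simp: J_def base_def)
    fix s'' assume s'': "s'' = s'(2 := (s' 2)(1 + 2 * int (r * N + c) := gweight n E r c, 2 + 2 * int (r * N + c) := 1))"
    have "fill i j s''" if ij: "i < N" "j < N" "i < r \<or> i = r \<and> j < Suc c" for i j
    proof (cases "i = r \<and> j = c")
      case True
      then show ?thesis unfolding s'' fill_def by auto
    next
      case False
      then have "fill i j s'" using h ij unfolding J_def by auto
      moreover have "i * N + j \<noteq> r * N + c"
      proof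
        assume e: "i * N + j = r * N + c"
        have "i = (i * N + j) div N" "r = (r * N + c) div N" "j = (i * N + j) mod N" "c = (r * N + c) mod N"
          using ij h by simp_all
        then show False using e False by metis
      qed
      then have "int (i * N + j) \<noteq> int (r * N + c)" by (simp only: of_nat_eq_iff not_False_eq_True)
      ultimately show ?thesis unfolding s'' fill_def fun_upd_apply by presburger
    qed
    moreover have "base s''" using h(5) unfolding s'' J_def base_def by (auto simp del: of_nat_add of_nat_mult)
    ultimately show "s'' 6 0 = int c \<and> s'' 5 0 = int r \<and> J r (Suc c) s''"
      using h unfolding J_def by (simp add: s'')
  qed simp
  have row: "runs b (For 6 (Var 7) ?c) s' (N * (3 + 3) + 3) 0 (\<lambda>s''. s'' 5 0 = int r \<and> J (Suc r) 0 s'')"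
    if h: "r < N" "mem_le b s'" "s' 5 0 = int r" "J r 0 s'" for r s'
  proof -
    have "runs b (For 6 (Var 7) ?c) s' (N * (3 + 3) + 3) (N * 0) (\<lambda>s'. s' 5 0 = int r \<and> J r N s')"
    proof (rule runs_for[where I = "\<lambda>c s'. s' 5 0 = int r \<and> J r c s'"])
      show "\<And>i s. s 5 0 = int r \<and> J r i s \<Longrightarrow> nat (val (Var 7) s) = N" by (simp add: J_def base_def)
      show "\<And>i s v. s 5 0 = int r \<and> J r i s \<Longrightarrow> (s(6 := (s 6)(0 := v))) 5 0 = int r \<and> J r i (s(6 := (s 6)(0 := v)))"
        using J_upd by auto
      fix c s' assume "c < N" "mem_le b s'" "s' 5 0 = int r \<and> J r c s'" "s' 6 0 = int c"
      then show "runs b ?c s' 3 0 (\<lambda>s''. s'' 6 0 = int c \<and> s'' 5 0 = int r \<and> J r (Suc c) s'')"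
        using entry h(1) by blast
    qed (use h b4 Nb in auto)
    then show ?thesis unfolding mult_0_right
    proof (rule runs_weaken)
      show "s'' 5 0 = int r \<and> J (Suc r) 0 s''" if "s'' 5 0 = int r \<and> J r N s''" for s''
        using that unfolding J_def by (auto simp: less_Suc_eq)
    qed simp
  qed
  have all: "runs b (For 5 (Var 7) (For 6 (Var 7) ?c)) s' (N * (N * (3 + 3) + 3 + 3) + 3) (N * 0) (J N 0)"
    if h: "mem_le b s'" "J 0 0 s'" for s'
  proof (rule runs_for[where I = "\<lambda>r. J r 0"])
    show "\<And>i s. J i 0 s \<Longrightarrow> nat (val (Var 7) s) = N" by (simp add: J_def base_def)
    show "\<And>i s v. J i 0 s \<Longrightarrow> J i 0 (s(5 := (s 5)(0 := v)))" using J_upd by auto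
    show "\<And>i s. i < N \<Longrightarrow> mem_le b s \<Longrightarrow> J i 0 s \<Longrightarrow> s 5 0 = int i \<Longrightarrow>
           runs b (For 6 (Var 7) ?c) s (N * (3 + 3) + 3) 0 (\<lambda>s'. s' 5 0 = int i \<and> J (Suc i) 0 s')"
      using row by blast
  qed (use h b4 Nb in auto)
  have "runs b build_com s (1 + (1 + (N * (N * (3 + 3) + 3 + 3) + 3) + 1) + 1) (0 + (0 + N * 0)) (J N 0)"
    unfolding build_com_def
  proof (rule runs_seq)
    show "runs b (Assign 7 (Const 0) (Const 5 \<otimes> Var 0 \<oplus> Var 4)) s 1 0
       (\<lambda>s'. s' 0 = G \<and> s' 3 = s 3 \<and> s' 4 = s 4 \<and> s' 8 = s 8 \<and> s' 7 0 = int N)"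
      using assms b4 Nb G_simps by (intro runs_assign) auto
    fix s1 assume s1: "mem_le b s1" "s1 0 = G \<and> s1 3 = s 3 \<and> s1 4 = s 4 \<and> s1 8 = s 8 \<and> s1 7 0 = int N"
    show "runs b (Seq (Assign 2 (Const 0) (Var 7)) (For 5 (Var 7) (For 6 (Var 7) ?c))) s1
       (1 + (N * (N * (3 + 3) + 3 + 3) + 3) + 1) (0 + N * 0) (J N 0)"
    proof (rule runs_seq[OF _ all])
      show "runs b (Assign 2 (Const 0) (Var 7)) s1 1 0 (J 0 0)"
        using s1 b4 Nb by (intro runs_assign) (auto simp: J_def base_def)
    qed
  qed
  then show ?thesis unfolding mult_0_right add_0_right
  proof (rule runs_weaken)
    fix s' assume "J N 0 s'"
    then show "s' 0 = G \<and> s' 3 = s 3 \<and> s' 4 = s 4 \<and> s' 8 = s 8 \<and>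
     s' 7 0 = int N \<and> s' 2 0 = int N \<and>
     (\<forall>i<N. \<forall>j<N. s' 2 (1 + 2 * int (i * N + j)) = gweight n E i j \<and> s' 2 (2 + 2 * int (i * N + j)) = 1)"
      unfolding J_def base_def fill_def by blast
  qed (simp add: algebra_simps)
qed

end

context program
begin

lemma runs_ask:
  assumes "mem_le b s" "s 0 = G" "s 4 0 = int j" "j < n" "s 8 0 = int (2 ^ n * fact (n + j))"
  shows "runs b ask_com s (1000 * (n + 1)\<^sup>2) 1 (\<lambda>s'. s' 0 = G \<and> s' 4 = s 4 \<and>
    s' 8 0 = int (2 ^ n * fact (n + Suc j)) \<and> s' 3 = (s 3)(int (n - 1 - j) := int (D 0 (n - 1 + j))))"
proof -
  define N where "N = 5 * n + j"
  define built where "built s' \<longleftrightarrow> s' 0 = G \<and> s' 3 = s 3 \<and> s' 4 = s 4 \<and> s' 8 = s 8 \<and>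
     s' 7 0 = int N \<and> s' 2 0 = int N \<and>
     (\<forall>i<N. \<forall>j<N. s' 2 (1 + 2 * int (i * N + j)) = gweight n E i j \<and> s' 2 (2 + 2 * int (i * N + j)) = 1)" for s' :: mem
  let ?P = "\<lambda>s' :: mem. s' 0 = G \<and> s' 4 = s 4 \<and>
    s' 8 0 = int (2 ^ n * fact (n + Suc j)) \<and> s' 3 = (s 3)(int (n - 1 - j) := int (D 0 (n - 1 + j)))"
  \<comment> \<open>With \<open>k = n + j\<close> hubs the polynomial is evaluated at
    \<open>k - 1\<close>.\<close>
  have d: "n - 1 + j = n + j - 1" using assms(4) by simp
  have "runs b ask_com s ((N * (6 * N + 6) + 8) + ((1 + 2 * N * N + 2) + (1 + 1 + 1) + 1) + 1) (0 + (1 + (0 + 0))) ?P"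
    unfolding ask_com_def
  proof (rule runs_seq)
    show "runs b build_com s (N * (6 * N + 6) + 8) 0 built"
      unfolding built_def using runs_build[OF assms(1-4) N_def] .
    fix s1 assume s1: "mem_le b s1" "built s1"
    let ?e = "Const 1 \<oplus> Const 2 \<otimes> (Var 7 \<otimes> Var 7)"
    define xs where "xs = query_word 2 ?e s1"
    have ve: "nat (val ?e s1) = 1 + 2 * N * N"
    proof -
      have "val ?e s1 = int (1 + 2 * N * N)" using s1 by (simp add: built_def)
      then show ?thesis by (simp only: nat_int)
    qed
    have xs: "xs = map (\<lambda>i. s1 2 (int i)) [0..<1 + 2 * N * N]"
      unfolding xs_def query_word_def ve ..
    have N: "N = 4 * n + (n + j)" by (simp add: N_def)
    have entry: "s1 2 (1 + 2 * int (i * N + j)) = gweight n E i j \<and> s1 2 (2 + 2 * int (i * N + j)) = 1"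
      if "i < N" "j < N" for i j using s1(2) that unfolding built_def by blast
    have "1 \<le> n" "n \<le> n + j" using assms(4) by auto
    note inst = instance_of_word[OF this N xs _ entry]
    have s120: "s1 2 0 = int N" using s1(2) unfolding built_def by blast
    define f where "f = f_two_opt {0..<N} (inst_weight xs)"
    have orc: "two_opt_oracle (query_word 2 ?e s1) = Some (int f)"
      unfolding two_opt_oracle_def xs_def[symmetric] using inst s120 f_def by simp
    have f: "f = 2 ^ n * fact (n + j) * D 0 (n + j - 1)"
      unfolding f_def N using f_two_opt_D[OF inst(1)] s120 by simp
    have fb: "int f \<le> 2 ^ b"
      unfolding f_def N using f_two_opt_bits[OF inst(1)] s120 assms(4) by simp
    show "runs b (Seq (Query 9 2 ?e) (Seq (Assign 3 (Var 0 \<ominus> Const 1 \<ominus> Var 4) (Bin Div (Var 9) (Var 8)))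
         (Assign 8 (Const 0) (Var 8 \<otimes> (Var 0 \<oplus> Var 4 \<oplus> Const 1))))) s1
       ((1 + 2 * N * N + 2) + (1 + 1 + 1) + 1) (1 + (0 + 0)) ?P"
    proof (rule runs_seq)
      show "runs b (Query 9 2 ?e) s1 (1 + 2 * N * N + 2) 1 (\<lambda>s'. s' = s1(9 := (s1 9)(0 := int f)))"
        unfolding ve[symmetric] using s1(1) b4 orc fb by (intro runs_query) auto
      fix s2 assume s2: "mem_le b s2" "s2 = s1(9 := (s1 9)(0 := int f))"
      have old: "s2 0 = G" "s2 4 = s 4" "s2 8 0 = int (2 ^ n * fact (n + j))" "s2 3 = s 3" "s2 9 0 = int f" "s2 4 0 = int j"
        using s1(2) s2(2) assms unfolding built_def by auto
      show "runs b (Seq (Assign 3 (Var 0 \<ominus> Const 1 \<ominus> Var 4) (Bin Div (Var 9) (Var 8)))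
         (Assign 8 (Const 0) (Var 8 \<otimes> (Var 0 \<oplus> Var 4 \<oplus> Const 1)))) s2 (1 + 1 + 1) (0 + 0) ?P"
      proof (rule runs_seq)
        let ?Q = "\<lambda>s' :: mem. s' 0 = G \<and> s' 4 = s 4 \<and> s' 4 0 = int j \<and> s' 8 0 = int (2 ^ n * fact (n + j)) \<and>
           s' 3 = (s 3)(int (n - 1 - j) := int (D 0 (n - 1 + j)))"
        have v: "val (Bin Div (Var 9) (Var 8)) s2 = int (D 0 (n - 1 + j))"
        proof -
          have "val (Bin Div (Var 9) (Var 8)) s2 = int f div int (2 ^ n * fact (n + j))" by (simp add: old del: of_nat_mult)
          also have "\<dots> = int (f div (2 ^ n * fact (n + j)))" by (simp only: zdiv_int)
          also have "f div (2 ^ n * fact (n + j)) = D 0 (n - 1 + j)" unfolding f d by simp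
          finally show ?thesis .
        qed
        have a: "val (Var 0 \<ominus> Const 1 \<ominus> Var 4) s2 = int (n - 1 - j)"
          using assms(4) by (simp add: old(1,2) assms(3) G_simps of_nat_diff)
        have "int (D 0 (n - 1 + j)) \<le> 2 ^ b" using assms(4) by (intro D_bits) auto
        then show "runs b (Assign 3 (Var 0 \<ominus> Const 1 \<ominus> Var 4) (Bin Div (Var 9) (Var 8))) s2 1 0 ?Q"
          using s2(1) b4 v a old by (intro runs_assign) (simp_all only: small.simps esize.simps, simp_all)
        fix s3 assume s3: "mem_le b s3" "?Q s3"
        have v: "val (Var 8 \<otimes> (Var 0 \<oplus> Var 4 \<oplus> Const 1)) s3 = int (2 ^ n * fact (n + Suc j))"
          using s3(2) assms(3) by (simp add: G_simps algebra_simps)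
        have "int (2 ^ n * fact (n + Suc j)) \<le> 2 ^ b" using assms(4) by (intro fact_le_bits) auto
        then show "runs b (Assign 8 (Const 0) (Var 8 \<otimes> (Var 0 \<oplus> Var 4 \<oplus> Const 1))) s3 1 0 ?P"
          using s3 b4 v by (intro runs_assign) (simp_all only: small.simps esize.simps, simp_all)
      qed
    qed
  qed
  then show ?thesis unfolding add_0_right add_0
  proof (rule runs_weaken)
    have "N \<le> 6 * n" using N_def assms(4) by simp
    then have "N * N \<le> 6 * n * (6 * n)" by (intro mult_mono) auto
    then show "(N * (6 * N + 6) + 8) + ((1 + 2 * N * N + 2) + (1 + 1 + 1) + 1) + 1 \<le> 1000 * (n + 1)\<^sup>2"
      using \<open>N \<le> 6 * n\<close> by (simp add: power2_eq_square algebra_simps)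
  qed
qed

definition holds :: "(nat \<Rightarrow> nat) \<Rightarrow> mem \<Rightarrow> bool" where
  "holds f s \<longleftrightarrow> s 0 = G \<and> (\<forall>i<n. s 3 (int i) = int (f i))"

lemma holds_upd: "holds f s \<Longrightarrow> x \<noteq> 0 \<Longrightarrow> x \<noteq> 3 \<Longrightarrow> holds f (s(x := y))"
  by (simp add: holds_def)

lemma holds_cong: "holds f s \<Longrightarrow> (\<And>i. i < n \<Longrightarrow> f i = g i) \<Longrightarrow> holds g s"
  by (simp add: holds_def)

lemma runs_asks:
  assumes "mem_le b s" "s 0 = G" "s 8 0 = int (2 ^ n * fact n)"
  shows "runs b (For 4 (Var 0) ask_com) s (n * (1000 * (n + 1)\<^sup>2 + 3) + 3) n
    (holds (\<lambda>i. D 0 (n - 1 + (n - 1 - i))))"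
proof -
  let ?I = "\<lambda>j (s :: mem). s 0 = G \<and> s 8 0 = int (2 ^ n * fact (n + j)) \<and> (\<forall>i<j. s 3 (int (n - 1 - i)) = int (D 0 (n - 1 + i)))"
  have "runs b (For 4 (Var 0) ask_com) s (n * (1000 * (n + 1)\<^sup>2 + 3) + 3) (n * 1) (?I n)"
  proof (rule runs_for[where I = ?I])
    show "\<And>i s v. ?I i s \<Longrightarrow> ?I i (s(4 := (s 4)(0 := v)))" by simp
    show "\<And>i s. ?I i s \<Longrightarrow> nat (val (Var 0) s) = n" using G_simps by simp
    fix j s assume j: "j < n" "mem_le b s" "?I j s" "s 4 0 = int j"
    show "runs b ask_com s (1000 * (n + 1)\<^sup>2) 1 (\<lambda>s'. s' 4 0 = int j \<and> ?I (Suc j) s')"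
    proof (rule runs_weaken[OF runs_ask[of s j]])
      fix s' :: mem assume s': "s' 0 = G \<and> s' 4 = s 4 \<and> s' 8 0 = int (2 ^ n * fact (n + Suc j)) \<and>
        s' 3 = (s 3)(int (n - 1 - j) := int (D 0 (n - 1 + j)))"
      have "s' 3 (int (n - 1 - i)) = int (D 0 (n - 1 + i))" if "i < Suc j" for i
      proof (cases "i = j")
        case False
        then have "n - 1 - i \<noteq> n - 1 - j" using that j(1) by linarith
        then have "int (n - 1 - i) \<noteq> int (n - 1 - j)" unfolding of_nat_eq_iff .
        then have "s' 3 (int (n - 1 - i)) = s 3 (int (n - 1 - i))" using s' by (metis fun_upd_other)
        moreover have "i < j" using that False by simp
        ultimately show ?thesis using j(3) by metis
      qed (use s' in simp)
      then show "s' 4 0 = int j \<and> ?I (Suc j) s'" using s' j(4) by (simp del: of_nat_mult)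
    qed (use j in auto)
  qed (use assms b4 le_bits[of n] in auto)
  then show ?thesis unfolding mult_1_right
  proof (rule runs_weaken)
    fix s' assume I: "?I n s'"
    have "s' 3 (int i) = int (D 0 (n - 1 + (n - 1 - i)))" if "i < n" for i
    proof -
      have "n - 1 - (n - 1 - i) = i" "n - 1 - i < n" using that by simp_all
      then show ?thesis using I by metis
    qed
    then show "holds (\<lambda>i. D 0 (n - 1 + (n - 1 - i))) s'" using I by (simp add: holds_def)
  qed simp
qed

lemma runs_store:
  assumes "mem_le b s" "simple_expr i" "simple_expr e" "val i s = int j" "val e s = int v" "int v \<le> 2 ^ b"
    "holds f s" "\<And>i. i < n \<Longrightarrow> g i = (if i = j then v else f i)"
  shows "runs b (Assign 3 i e) s 1 0 (\<lambda>s'. (\<forall>x. x \<noteq> 3 \<longrightarrow> s' x = s x) \<and> holds g s')"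
  using assms b4 by (intro runs_assign) (auto simp: holds_def)

text \<open>Contents of the array after \<open>r\<close> rounds of \<open>diff_com\<close>. The
  minimum expresses that entry \<open>i\<close> is final after \<open>n - 1 - i\<close>
  rounds.\<close>

definition level :: "nat \<Rightarrow> nat \<Rightarrow> nat" where
  "level r i = D (min (n - 1 - i) r) (n - 1 + (n - 1 - i - min (n - 1 - i) r))"

lemma level_bits: "i < n \<Longrightarrow> int (level r i) \<le> 2 ^ b"
  unfolding level_def by (intro D_bits) (auto simp: min_def)

lemma level_step:
  assumes "i < n - 1 - r"
  shows "int (level r i) - int (level r (Suc i)) = int (level (Suc r) i)"
proof -
  have m: "min (n - 1 - i) r = r" "min (n - 1 - Suc i) r = r" "min (n - 1 - i) (Suc r) = Suc r" using assms by auto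
  have x: "n - 1 + (n - 1 - i - r) = Suc (n - 1 + (n - 1 - Suc i - r))"
    "n - 1 + (n - 1 - i - Suc r) = n - 1 + (n - 1 - Suc i - r)" using assms by auto
  show ?thesis unfolding level_def m x by (rule diff_table_diff)
qed

lemma runs_diff:
  assumes "mem_le b s" "holds (\<lambda>i. D 0 (n - 1 + (n - 1 - i))) s"
  shows "runs b diff_com s (n * (n * 4 + 3 + 3) + 3) 0 (holds (\<lambda>i. D (n - 1 - i) (n - 1)))"
proof -
  let ?c = "Assign 3 (Var 5) (Cell 3 (Var 5) \<ominus> Cell 3 (Var 5 \<oplus> Const 1))"
  \<comment> \<open>State within a round: entry \<open>i + 1\<close> is still old when entry
    \<open>i\<close> is overwritten, so the table can be updated in place.\<close>
  let ?f = "\<lambda>r i i0. if i0 < i then level (Suc r) i0 else level r i0"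
  have inner: "runs b (For 5 (Var 0 \<ominus> Const 1 \<ominus> Var 4) ?c) s (n * 4 + 3) 0
      (\<lambda>s'. s' 4 0 = int r \<and> holds (level (Suc r)) s')"
    if r: "r < n" "mem_le b s" "holds (level r) s" "s 4 0 = int r" for r s
  proof -
    let ?I = "\<lambda>i s. s 4 0 = int r \<and> holds (?f r i) s"
    have "runs b (For 5 (Var 0 \<ominus> Const 1 \<ominus> Var 4) ?c) s ((n - 1 - r) * (1 + 3) + 3) ((n - 1 - r) * 0) (?I (n - 1 - r))"
    proof (rule runs_for[where I = ?I])
      show "\<And>i s v. ?I i s \<Longrightarrow> ?I i (s(5 := (s 5)(0 := v)))" by (auto intro: holds_upd)
      show "nat (val (Var 0 \<ominus> Const 1 \<ominus> Var 4) s) = n - 1 - r" if "?I i s" for i s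
      proof -
        have "val (Var 0 \<ominus> Const 1 \<ominus> Var 4) s = int (n - 1 - r)"
          using that r(1) by (simp add: holds_def G_simps of_nat_diff)
        then show ?thesis by simp
      qed
      fix i s assume i: "i < n - 1 - r" "mem_le b s" "?I i s" "s 5 0 = int i"
      have v: "s 3 (int i) = int (level r i)" "s 3 (int i + 1) = int (level r (Suc i))"
      proof -
        have "i < n" "Suc i < n" using i(1) by auto
        then have "s 3 (int i) = int (?f r i i)" "s 3 (int (Suc i)) = int (?f r i (Suc i))"
          using i(3) unfolding holds_def by blast+
        then show "s 3 (int i) = int (level r i)" "s 3 (int i + 1) = int (level r (Suc i))" by (simp_all add: add.commute)
      qed
      have "runs b ?c s 1 0 (\<lambda>s'. (\<forall>x. x \<noteq> 3 \<longrightarrow> s' x = s x) \<and> holds (?f r (Suc i)) s')"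
      proof (rule runs_store[where j = i and v = "level (Suc r) i" and f = "?f r i"])
        show "val (Cell 3 (Var 5) \<ominus> Cell 3 (Var 5 \<oplus> Const 1)) s = int (level (Suc r) i)"
          using level_step[OF i(1)] v i(4) by simp
        show "int (level (Suc r) i) \<le> 2 ^ b" using i(1) by (intro level_bits) simp
      qed (use i in auto)
      then show "runs b ?c s 1 0 (\<lambda>s'. s' 5 0 = int i \<and> ?I (Suc i) s')"
        by (rule runs_weaken) (use i in auto)
    qed (use r b4 le_bits[of "n - 1 - r"] in auto)
    then show ?thesis unfolding mult_0_right
    proof (rule runs_weaken)
      show "(n - 1 - r) * (1 + 3) + 3 \<le> n * 4 + 3" by simp
      fix s' assume s': "?I (n - 1 - r) s'"
      have "?f r (n - 1 - r) i = level (Suc r) i" if "i < n" for i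
        by (auto simp: level_def min_def not_less)
      then show "s' 4 0 = int r \<and> holds (level (Suc r)) s'" using s' holds_cong[of _ s' "level (Suc r)"] by blast
    qed
  qed
  have "runs b diff_com s (n * (n * 4 + 3 + 3) + 3) (n * 0) (holds (level n))"
    unfolding diff_com_def
  proof (rule runs_for[where I = "\<lambda>r. holds (level r)"])
    show "holds (level 0) s" by (rule holds_cong[OF assms(2)]) (simp add: level_def)
    show "\<And>i s. holds (level i) s \<Longrightarrow> nat (val (Var 0) s) = n" by (simp add: holds_def G_simps)
    show "\<And>i s v. holds (level i) s \<Longrightarrow> holds (level i) (s(4 := (s 4)(0 := v)))" by (auto intro: holds_upd)
    show "\<And>i s. i < n \<Longrightarrow> mem_le b s \<Longrightarrow> holds (level i) s \<Longrightarrow> s 4 0 = int i \<Longrightarrow>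
      runs b (For 5 (Var 0 \<ominus> Const 1 \<ominus> Var 4) ?c) s (n * 4 + 3) 0 (\<lambda>s'. s' 4 0 = int i \<and> holds (level (Suc i)) s')"
      using inner by blast
  qed (use assms b4 le_bits[of n] in auto)
  then show ?thesis unfolding mult_0_right
    by (rule runs_weaken) (auto elim!: holds_cong simp: level_def)
qed

lemma runs_shift:
  assumes "mem_le b s" "holds (\<lambda>i. D (n - 1 - i) (n - 1)) s"
  shows "runs b shift_com s (n * (n * 4 + 3 + 3) + 3) 0 (holds (\<lambda>i. cov (n - 1 - i)))"
proof -
  let ?c = "Assign 3 (Var 5 \<oplus> Const 1) (Cell 3 (Var 5 \<oplus> Const 1) \<ominus> Cell 3 (Var 5))"
  let ?l = "\<lambda>r i. D (n - 1 - i) (n - 1 - r)"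
  \<comment> \<open>Here \<open><=\<close>, unlike in the difference phase: entry \<open>i\<close>
    is already new when entry \<open>i + 1\<close> is overwritten.\<close>
  let ?f = "\<lambda>r i i0. if i0 \<le> i then ?l (Suc r) i0 else ?l r i0"
  have bnd: "nat (val (Var 0 \<ominus> Const 1) s) = n - 1" if "holds f s" for f s
    using that by (simp add: holds_def G_simps nat_diff_distrib')
  have inner: "runs b (For 5 (Var 0 \<ominus> Const 1) ?c) s ((n - 1) * (1 + 3) + 3) ((n - 1) * 0)
      (\<lambda>s'. s' 4 0 = int r \<and> holds (?f r (n - 1)) s')"
    if r: "r < n - 1" "mem_le b s" "holds (?l r) s" "s 4 0 = int r" for r s
  proof -
    let ?I = "\<lambda>i s. s 4 0 = int r \<and> holds (?f r i) s"
    show ?thesis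
    proof (rule runs_for[where I = ?I])
      \<comment> \<open>Entry 0 is constant in the argument, so it is right for the next point
        before the round starts.\<close>
      have "holds (?f r 0) s"
        by (rule holds_cong[OF r(3)]) (use diff_table_last in auto)
      then show "?I 0 s" using r by simp
      show "\<And>i s v. ?I i s \<Longrightarrow> ?I i (s(5 := (s 5)(0 := v)))" by (auto intro: holds_upd)
      show "nat (val (Var 0 \<ominus> Const 1) s) = n - 1" if "?I i s" for i s using that bnd by blast
      fix i s assume i: "i < n - 1" "mem_le b s" "?I i s" "s 5 0 = int i"
      have v: "s 3 (int i) = int (?l (Suc r) i)" "s 3 (int i + 1) = int (?l r (Suc i))"
      proof -
        have "i < n" "Suc i < n" using i(1) by auto
        then have "s 3 (int i) = int (?f r i i)" "s 3 (int (Suc i)) = int (?f r i (Suc i))"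
          using i(3) unfolding holds_def by blast+
        then show "s 3 (int i) = int (?l (Suc r) i)" "s 3 (int i + 1) = int (?l r (Suc i))" by (simp_all add: add.commute)
      qed
      have st: "int (?l r (Suc i)) - int (?l (Suc r) i) = int (?l (Suc r) (Suc i))"
      proof -
        have "n - 1 - r = Suc (n - 1 - Suc r)" "n - 1 - i = Suc (n - 1 - Suc i)" using r(1) i(1) by auto
        then show ?thesis using diff_table_Suc[of cov n "n - 1 - Suc i" "n - 1 - Suc r"] by simp
      qed
      have "runs b ?c s 1 0 (\<lambda>s'. (\<forall>x. x \<noteq> 3 \<longrightarrow> s' x = s x) \<and> holds (?f r (Suc i)) s')"
      proof (rule runs_store[where j = "Suc i" and v = "?l (Suc r) (Suc i)" and f = "?f r i"])
        show "val (Cell 3 (Var 5 \<oplus> Const 1) \<ominus> Cell 3 (Var 5)) s = int (?l (Suc r) (Suc i))"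
          using st v i(4) by simp
        show "int (?l (Suc r) (Suc i)) \<le> 2 ^ b" using i(1) r(1) by (intro D_bits) auto
      qed (use i in \<open>auto simp: le_Suc_eq\<close>)
      then show "runs b ?c s 1 0 (\<lambda>s'. s' 5 0 = int i \<and> ?I (Suc i) s')"
        by (rule runs_weaken) (use i in auto)
    qed (use r b4 le_bits[of "n - 1"] in auto)
  qed
  have step: "runs b (For 5 (Var 0 \<ominus> Const 1) ?c) s (n * 4 + 3) 0 (\<lambda>s'. s' 4 0 = int r \<and> holds (?l (Suc r)) s')"
    if r: "r < n - 1" "mem_le b s" "holds (?l r) s" "s 4 0 = int r" for r s
    using inner[OF r] unfolding mult_0_right
    by (rule runs_weaken) (auto elim!: holds_cong)
  have "runs b shift_com s ((n - 1) * (n * 4 + 3 + 3) + 3) ((n - 1) * 0) (holds (?l (n - 1)))"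
    unfolding shift_com_def
  proof (rule runs_for[where I = "\<lambda>r. holds (?l r)"])
    show "holds (?l 0) s" using assms(2) by simp
    show "\<And>i s. holds (?l i) s \<Longrightarrow> nat (val (Var 0 \<ominus> Const 1) s) = n - 1" by (rule bnd)
    show "\<And>i s v. holds (?l i) s \<Longrightarrow> holds (?l i) (s(4 := (s 4)(0 := v)))" by (auto intro: holds_upd)
    show "\<And>i s. i < n - 1 \<Longrightarrow> mem_le b s \<Longrightarrow> holds (?l i) s \<Longrightarrow> s 4 0 = int i \<Longrightarrow>
      runs b (For 5 (Var 0 \<ominus> Const 1) ?c) s (n * 4 + 3) 0 (\<lambda>s'. s' 4 0 = int i \<and> holds (?l (Suc i)) s')"
      by (rule step)
  qed (use assms b4 le_bits[of "n - 1"] in auto)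
  then show ?thesis unfolding mult_0_right
    by (rule runs_weaken) (auto elim!: holds_cong simp: diff_table_0)
qed

text \<open>The defining equation of \<open>cover_coeff\<close> lives in the locale of instances, so
  some instance must be exhibited; \<open>k = n\<close> will do.\<close>

lemma cov_eq: "1 \<le> n \<Longrightarrow> cov j = num_path_covers {0..<n} E (Suc j) * (2 ^ j * fact j)"
proof -
  assume n: "1 \<le> n"
  have "tsp_instance n n E (\<lambda>e. of_int (gweight n E (Min e) (Max e)))"
  proof
    fix i j :: nat
    show "of_int (gweight n E (Min {i, j}) (Max {i, j})) = (of_int (gweight n E i j) :: rat)"
      using gweight_commute[of n E i j] by (auto simp: min_def max_def)
  qed (use n graph in auto)
  from tsp_instance.cover_coeff_def[OF this] show ?thesis by simp
qed

lemma runs_output: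
  assumes "mem_le b s" "holds (\<lambda>i. cov (n - 1 - i)) s"
  shows "runs b output_com s (n * 6 + 5) 0 (\<lambda>s. \<forall>l. 1 \<le> l \<and> l \<le> n \<longrightarrow> s 1 (int l) = int (num_path_covers {0..<n} E l))"
proof -
  let ?h = "holds (\<lambda>i. cov (n - 1 - i))"
  let ?I = "\<lambda>j s. ?h s \<and> s 8 0 = int (2 ^ j * fact j) \<and> (\<forall>l. 1 \<le> l \<and> l \<le> j \<longrightarrow> s 1 (int l) = int (num_path_covers {0..<n} E l))"
  let ?a = "Assign 1 (Var 4 \<oplus> Const 1) (Bin Div (Cell 3 (Var 0 \<ominus> Const 1 \<ominus> Var 4)) (Var 8))"
  let ?g = "Assign 8 (Const 0) (Var 8 \<otimes> (Const 2 \<otimes> (Var 4 \<oplus> Const 1)))"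
  have "runs b output_com s (1 + (n * (3 + 3) + 3) + 1) (0 + n * 0) (?I n)"
    unfolding output_com_def
  proof (rule runs_seq)
    show "runs b (Assign 8 (Const 0) (Const 1)) s 1 0 (?I 0)"
      using assms b4 by (intro runs_assign) (auto intro: holds_upd)
    fix s assume s: "mem_le b s" "?I 0 s"
    show "runs b (For 4 (Var 0) (Seq ?a ?g)) s (n * (3 + 3) + 3) (n * 0) (?I n)"
    proof (rule runs_for[where I = ?I])
      show "\<And>i s. ?I i s \<Longrightarrow> nat (val (Var 0) s) = n" by (simp add: holds_def G_simps)
      show "\<And>i s v. ?I i s \<Longrightarrow> ?I i (s(4 := (s 4)(0 := v)))" by (auto intro: holds_upd)
      fix j s assume j: "j < n" "mem_le b s" "?I j s" "s 4 0 = int j"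
      have "runs b (Seq ?a ?g) s (1 + 1 + 1) (0 + 0) (\<lambda>s'. s' 4 0 = int j \<and> ?I (Suc j) s')"
      proof (rule runs_seq)
        let ?N = "num_path_covers {0..<n} E (Suc j)"
        have a: "val (Var 0 \<ominus> Const 1 \<ominus> Var 4) s = int (n - 1 - j)"
          using j by (simp add: holds_def G_simps of_nat_diff)
        have "n - 1 - j < n" "n - 1 - (n - 1 - j) = j" using j(1) by auto
        then have "s 3 (int (n - 1 - j)) = int (cov j)" using j(3) unfolding holds_def by metis
        then have "val (Bin Div (Cell 3 (Var 0 \<ominus> Const 1 \<ominus> Var 4)) (Var 8)) s = int (cov j) div int (2 ^ j * fact j)"
          using a j(3) by (simp del: of_nat_mult)
        also have "\<dots> = int (cov j div (2 ^ j * fact j))" by (simp only: zdiv_int)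
        also have "cov j div (2 ^ j * fact j) = ?N" using cov_eq[of j] j(1) by simp
        finally have v: "val (Bin Div (Cell 3 (Var 0 \<ominus> Const 1 \<ominus> Var 4)) (Var 8)) s = int ?N" .
        have "int ?N \<le> int (cov j)"
          unfolding of_nat_le_iff using cov_eq[of j] j(1) by simp
        also have "\<dots> = int (D j 0)" using j(1) by (simp add: diff_table_0)
        also have "\<dots> \<le> 2 ^ b" using j(1) by (intro D_bits) auto
        finally have le: "int ?N \<le> 2 ^ b" .
        show "runs b ?a s 1 0 (\<lambda>s'. s' = s(1 := (s 1)(int j + 1 := int ?N)))"
          using j b4 v le by (intro runs_assign) (simp_all only: small.simps esize.simps, simp_all)
        fix s1 assume s1: "mem_le b s1" "s1 = s(1 := (s 1)(int j + 1 := int ?N))"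
        have I1: "s1 4 0 = int j" "?h s1" "s1 8 0 = int (2 ^ j * fact j)"
          using j(3,4) s1(2) by (auto intro: holds_upd)
        have out: "s1 1 (int l) = int (num_path_covers {0..<n} E l)" if "1 \<le> l" "l \<le> Suc j" for l
          using that j(3) unfolding s1(2) by (cases "l = Suc j") (auto simp: add.commute)
        have v: "val (Var 8 \<otimes> (Const 2 \<otimes> (Var 4 \<oplus> Const 1))) s1 = int (2 ^ Suc j * fact (Suc j))"
          using I1 by (simp add: algebra_simps)
        have "int (2 ^ Suc j * fact (Suc j)) \<le> 2 ^ b" using j(1) by (intro fact_le_bits) auto
        then have le2: "\<bar>int (2 ^ Suc j * fact (Suc j))\<bar> \<le> 2 ^ b" by (simp only: abs_of_nat)
        show "runs b ?g s1 1 0 (\<lambda>s'. s' 4 0 = int j \<and> ?I (Suc j) s')"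
        proof (rule runs_assign)
          show "\<bar>val (Var 8 \<otimes> (Const 2 \<otimes> (Var 4 \<oplus> Const 1))) s1\<bar> \<le> 2 ^ b" unfolding v by (rule le2)
          show "(s1(8 := (s1 8)(val (Const 0) s1 := val (Var 8 \<otimes> (Const 2 \<otimes> (Var 4 \<oplus> Const 1))) s1))) 4 0 = int j \<and>
             ?I (Suc j) (s1(8 := (s1 8)(val (Const 0) s1 := val (Var 8 \<otimes> (Const 2 \<otimes> (Var 4 \<oplus> Const 1))) s1)))"
            unfolding v using I1 out by (auto intro: holds_upd simp del: of_nat_mult of_nat_Suc fact_Suc power_Suc)
        qed (use s1 b4 in auto)
      qed
      then show "runs b (Seq ?a ?g) s 3 0 (\<lambda>s'. s' 4 0 = int j \<and> ?I (Suc j) s')" by (simp add: numeral_3_eq_3)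
    qed (use s b4 le_bits[of n] in auto)
  qed
  then show ?thesis unfolding mult_0_right add_0_right
    by (rule runs_weaken) auto
qed

lemma runs_main:
  assumes "mem_le b s" "s 0 = G"
  shows "runs b main_com s
    ((4 * n + 5) + ((n * (1000 * (n + 1)\<^sup>2 + 3) + 3) + ((n * (n * 4 + 3 + 3) + 3) + ((n * (n * 4 + 3 + 3) + 3) + (n * 6 + 5) + 1) + 1) + 1) + 1)
    (0 + (n + (0 + (0 + 0))))
    (\<lambda>s. \<forall>l. 1 \<le> l \<and> l \<le> n \<longrightarrow> s 1 (int l) = int (num_path_covers {0..<n} E l))"
  unfolding main_com_def
proof (rule runs_seq[OF runs_factor[OF assms]], rule runs_seq)
  fix s assume "mem_le b s" "s 0 = G \<and> s 8 0 = int (2 ^ n * fact n)"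
  then show "runs b (For 4 (Var 0) ask_com) s (n * (1000 * (n + 1)\<^sup>2 + 3) + 3) n
    (holds (\<lambda>i. D 0 (n - 1 + (n - 1 - i))))" by (intro runs_asks) auto
next
  fix s' assume "mem_le b s'" "holds (\<lambda>i. D 0 (n - 1 + (n - 1 - i))) s'"
  then show "runs b (Seq diff_com (Seq shift_com output_com)) s'
    ((n * (n * 4 + 3 + 3) + 3) + ((n * (n * 4 + 3 + 3) + 3) + (n * 6 + 5) + 1) + 1) (0 + (0 + 0))
    (\<lambda>s. \<forall>l. 1 \<le> l \<and> l \<le> n \<longrightarrow> s 1 (int l) = int (num_path_covers {0..<n} E l))"
    by (intro runs_seq[OF runs_diff] runs_seq[OF runs_shift] runs_output)
qed

text \<open>The cubic term stems from \<open>n\<close> instances with quadratically many entries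
  each.\<close>

lemma main_result:
  "\<exists>t s. exec two_opt_oracle main_com (graph_input n E) t n s \<and> t \<le> 2000 * (n + 1) ^ 3 * step_cost b \<and>
     (\<forall>l. 1 \<le> l \<and> l \<le> n \<longrightarrow> s 1 (int l) = int (num_path_covers {0..<n} E l))"
proof -
  have "mem_le b (graph_input n E)"
    using le_bits[of n] by (auto simp: mem_le_def graph_input_def)
  from runs_main[OF this refl]
  have "runs b main_com (graph_input n E) (2000 * (n + 1) ^ 3) (0 + (n + (0 + (0 + 0))))
    (\<lambda>s. \<forall>l. 1 \<le> l \<and> l \<le> n \<longrightarrow> s 1 (int l) = int (num_path_covers {0..<n} E l))"
    by (rule runs_weaken) (simp_all add: power2_eq_square power3_eq_cube algebra_simps)
  then show ?thesis unfolding runs_def add_0_right add_0 by blast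
qed

end

theorem theorem1:
  "\<exists>(c :: com) (p :: nat poly).
     \<forall>(n :: nat) (E :: nat set set). simple_graph {0..<n} E \<longrightarrow>
       (\<exists>t s. exec two_opt_oracle c (graph_input n E) t n s \<and>
          t \<le> poly p (n + card E) \<and>
          (\<forall>l. 1 \<le> l \<and> l \<le> n \<longrightarrow> s 1 (int l) = int (num_path_covers {0..<n} E l)))"
proof (rule exI[of _ main_com],
    rule exI[of _ "[:2000:] * [:1, 1:] ^ 3 * ([:801:] + [:80000 * 40:] * [:1, 1:] ^ 2)"], intro allI impI)
  fix n :: nat and E :: "nat set set"
  assume "simple_graph {0..<n} E"
  then interpret program n E by unfold_locales
  obtain t s where ts: "exec two_opt_oracle main_com (graph_input n E) t n s"
    "t \<le> 2000 * (n + 1) ^ 3 * step_cost (bits n)"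
    "\<forall>l. 1 \<le> l \<and> l \<le> n \<longrightarrow> s 1 (int l) = int (num_path_covers {0..<n} E l)"
    using main_result by blast
  define N where "N = n + card E"
  have "2000 * (n + 1) ^ 3 * step_cost (bits n) \<le> 2000 * (N + 1) ^ 3 * (801 + 80000 * (40 * (N + 1)\<^sup>2))"
  proof -
    \<comment> \<open>Here 801 = 1 + 2 * 200 * 2 and 80000 = 2 * 200 * 200. The polynomial of the
      theorem is the number of steps times this cost, with \<open>n + 1\<close> replaced by the
      larger \<open>N + 1\<close>.\<close>
    have "step_cost (bits n) = 801 + 80000 * (40 * (n + 1)\<^sup>2)" by (simp add: step_cost_def bits_def)
    then show ?thesis unfolding N_def by (simp only:) (intro mult_mono power_mono add_mono order_refl; simp)
  qed
  also have "\<dots> = poly ([:2000:] * [:1, 1:] ^ 3 * ([:801:] + [:80000 * 40:] * [:1, 1:] ^ 2)) N"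
    by (simp add: poly_power algebra_simps)
  finally have "2000 * (n + 1) ^ 3 * step_cost (bits n) \<le> poly ([:2000:] * [:1, 1:] ^ 3 * ([:801:] + [:80000 * 40:] * [:1, 1:] ^ 2)) N" .
  with ts(2) have "t \<le> poly ([:2000:] * [:1, 1:] ^ 3 * ([:801:] + [:80000 * 40:] * [:1, 1:] ^ 2)) (n + card E)"
    unfolding N_def by (rule order.trans)
  then show "\<exists>t s. exec two_opt_oracle main_com (graph_input n E) t n s \<and>
      t \<le> poly ([:2000:] * [:1, 1:] ^ 3 * ([:801:] + [:80000 * 40:] * [:1, 1:] ^ 2)) (n + card E) \<and>
      (\<forall>l. 1 \<le> l \<and> l \<le> n \<longrightarrow> s 1 (int l) = int (num_path_covers {0..<n} E l))"
    using ts by blast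
qed

end
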